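(* Let $d\ge1$, $s\in\mathbb{R}$ with $s\ge0$, $\mathbb{F}\in\{\mathbb{R},\mathbb{C}\}$, and let $\Gamma=\prod_{i=1}^d\Gamma_i$ with each $\Gamma_i=\mathbb{R}$ or $\Gamma_i=L_i\mathbb{T}$, $L_i>0$. Let $R_\Gamma=\{i\in\{1,\dots,d\}:\Gamma_i=\mathbb{R}\}$. If $1\notin R_\Gamma$ and $R_\Gamma\neq\varnothing$, then $X^s(\Gamma;\mathbb{F})$ is complete if and only if $|R_\Gamma|>2$.
   Context: $L\mathbb{T}=\mathbb{R}/L\mathbb{Z}$. The dual group is $\hat\Gamma=\prod_{i=1}^d\hat\Gamma_i\subseteq\mathbb{R}^d$, $\hat\Gamma_i=\mathbb{R}$ if $\Gamma_i=\mathbb{R}$, $\hat\Gamma_i=L_i^{-1}\mathbb{Z}$ if $\Gamma_i=L_i\mathbb{T}$, with the product of Lebesgue and counting measures. $\hat f$ is the unitary Fourier transform, $\hat f(\xi)=(\prod_{i\notin R_\Gamma}L_i)^{-1/2}\int_\Gamma f(x)e^{-2\pi i\xi\cdot x}dx$ on Schwartz functions, extended to tempered distributions $\mathscr{S}'(\Gamma;\mathbb{C})$ (dual of the Schwartz class of smooth functions on $\Gamma$ with all derivatives rapidly decaying in the $\mathbb{R}$-variables). $\langle\xi\rangle=(1+|\xi|^2)^{1/2}$; $\mu(\xi)=\frac{|\xi_1|}{|\xi|}+|\xi|$ for $\xi\ne0$, $\mu(0)=1$. $X^s(\Gamma;\mathbb{C})=\{f\in\mathscr{S}'(\Gamma;\mathbb{C}):\hat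 f\in L^1_{\mathrm{loc}}(\hat\Gamma;\mathbb{C}),\ \|\mu\langle\cdot\rangle^{s-1}\hat f\|_{L^2}<\infty\}$, $X^s(\Gamma;\mathbb{R})$ is the subset with $f=\overline f$, both normed by $\|f\|_{X^s}=\|\mu\langle\cdot\rangle^{s-1}\hat f\|_{L^2(\hat\Gamma)}$. *)

theory Defs
  imports "HOL-Analysis.Analysis"
begin

section \<open>The group and its dual\<close>

text \<open>
  A factor is the real line or the circle of circumference \<open>L\<close>.  The group is given by a family
  \<open>\<Gamma> :: 'n \<Rightarrow> factor\<close>, so that \<open>d = CARD('n)\<close>.  A function on the group is represented by a function
  on \<open>real ^ 'n\<close> that is periodic in the circle variables; the dual group is a subset of
  \<open>real ^ 'n\<close>, and a function on it is represented by a function on \<open>real ^ 'n\<close> whose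
  values off the dual group are irrelevant.
\<close>

datatype factor = Line | Circle real

definition admissible :: "('n \<Rightarrow> factor) \<Rightarrow> bool" where
  "admissible \<Gamma> \<longleftrightarrow> (\<forall>i L. \<Gamma> i = Circle L \<longrightarrow> L > 0)"

definition line_indices :: "('n \<Rightarrow> factor) \<Rightarrow> 'n set" where
  "line_indices \<Gamma> = {i. \<Gamma> i = Line}"

definition dual_factor :: "factor \<Rightarrow> real set" where
  "dual_factor F = (case F of Line \<Rightarrow> UNIV | Circle L \<Rightarrow> range (\<lambda>k::int. of_int k / L))"

definition dual_factor_measure :: "factor \<Rightarrow> real measure" where
  "dual_factor_measure F = (case F of Line \<Rightarrow> lborel | Circle L \<Rightarrow> count_space (dual_factor F))"

definition dual_group :: "('n::finite \<Rightarrow> factor) \<Rightarrow> (real ^ 'n) set" where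
  "dual_group \<Gamma> = {\<xi>. \<forall>i. \<xi> $ i \<in> dual_factor (\<Gamma> i)}"

text \<open>The product measure, pushed forward to \<open>real ^ 'n\<close>; it is concentrated on the dual group.\<close>

definition dual_measure :: "('n::finite \<Rightarrow> factor) \<Rightarrow> (real ^ 'n) measure" where
  "dual_measure \<Gamma> = distr (\<Pi>\<^sub>M i\<in>UNIV. dual_factor_measure (\<Gamma> i)) borel (\<lambda>\<xi>. \<chi> i. \<xi> i)"


section \<open>Smooth functions, Schwartz functions, tempered distributions\<close>

definition partial_deriv :: "'n::finite \<Rightarrow> (real ^ 'n \<Rightarrow> complex) \<Rightarrow> real ^ 'n \<Rightarrow> complex" where
  "partial_deriv i f x = vector_derivative (\<lambda>t. f (x + t *\<^sub>R axis i 1)) (at 0)"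

definition partial_derivs :: "'n::finite list \<Rightarrow> (real ^ 'n \<Rightarrow> complex) \<Rightarrow> real ^ 'n \<Rightarrow> complex" where
  "partial_derivs is f = foldr partial_deriv is f"

text \<open>
  All iterated partial derivatives in the directions \<open>D\<close> exist at the points of \<open>S\<close> and are
  continuous on \<open>S\<close>.  With \<open>D = UNIV\<close>, \<open>S = UNIV\<close> this is smoothness on \<open>real ^ 'n\<close>; with the line
  directions and \<open>S\<close> the dual group (which is invariant under translation in those directions)
  it is smoothness on the dual group.
\<close>

definition smooth_along :: "'n::finite set \<Rightarrow> (real ^ 'n) set \<Rightarrow> (real ^ 'n \<Rightarrow> complex) \<Rightarrow> bool" where
  "smooth_along D S f \<longleftrightarrow>
     (\<forall>is\<in>lists D. continuous_on S (partial_derivs is f) \<and>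
        (\<forall>i\<in>D. \<forall>x\<in>S. (\<lambda>t::real. partial_derivs is f (x + t *\<^sub>R axis i 1)) differentiable (at 0)))"

definition periodic :: "('n::finite \<Rightarrow> factor) \<Rightarrow> (real ^ 'n \<Rightarrow> complex) \<Rightarrow> bool" where
  "periodic \<Gamma> f \<longleftrightarrow> (\<forall>i L x. \<Gamma> i = Circle L \<longrightarrow> f (x + L *\<^sub>R axis i 1) = f x)"

definition line_part :: "('n::finite \<Rightarrow> factor) \<Rightarrow> real ^ 'n \<Rightarrow> real ^ 'n" where
  "line_part \<Gamma> x = (\<chi> i. if i \<in> line_indices \<Gamma> then x $ i else 0)"

definition weighted_deriv ::
    "('n::finite \<Rightarrow> factor) \<Rightarrow> nat \<Rightarrow> 'n list \<Rightarrow> (real ^ 'n \<Rightarrow> complex) \<Rightarrow> real ^ 'n \<Rightarrow> real" where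
  "weighted_deriv \<Gamma> N is f x = (1 + norm (line_part \<Gamma> x)) ^ N * norm (partial_derivs is f x)"

definition schwartz :: "('n::finite \<Rightarrow> factor) \<Rightarrow> (real ^ 'n \<Rightarrow> complex) set" where
  "schwartz \<Gamma> = {f. periodic \<Gamma> f \<and> smooth_along UNIV UNIV f \<and>
                    (\<forall>N is. bdd_above (range (weighted_deriv \<Gamma> N is f)))}"

definition schwartz_seminorm ::
    "('n::finite \<Rightarrow> factor) \<Rightarrow> nat \<Rightarrow> 'n list \<Rightarrow> (real ^ 'n \<Rightarrow> complex) \<Rightarrow> real" where
  "schwartz_seminorm \<Gamma> N is f = (SUP x. weighted_deriv \<Gamma> N is f x)"

definition schwartz_topology :: "('n::finite \<Rightarrow> factor) \<Rightarrow> (real ^ 'n \<Rightarrow> complex) topology" where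
  "schwartz_topology \<Gamma> = topology_generated_by
     {{\<psi> \<in> schwartz \<Gamma>. schwartz_seminorm \<Gamma> N is (\<lambda>x. \<psi> x - \<phi> x) < \<epsilon>} | N is \<phi> \<epsilon>.
        \<phi> \<in> schwartz \<Gamma> \<and> 0 < \<epsilon>}"

text \<open>
  Functionals are extended by zero outside the Schwartz class, so that equality of distributions
  is equality in HOL.
\<close>

type_synonym 'n functional = "(real ^ 'n \<Rightarrow> complex) \<Rightarrow> complex"

definition tempered :: "('n::finite \<Rightarrow> factor) \<Rightarrow> 'n functional set" where
  "tempered \<Gamma> = {f. (\<forall>\<phi>. \<phi> \<notin> schwartz \<Gamma> \<longrightarrow> f \<phi> = 0) \<and>
      (\<forall>\<phi>\<in>schwartz \<Gamma>. \<forall>\<psi>\<in>schwartz \<Gamma>. f (\<lambda>x. \<phi> x + \<psi> x) = f \<phi> + f \<psi>) \<and>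
      (\<forall>\<phi>\<in>schwartz \<Gamma>. \<forall>c. f (\<lambda>x. c * \<phi> x) = c * f \<phi>) \<and>
      continuous_map (schwartz_topology \<Gamma>) euclidean f}"

definition cnj_dist :: "'n::finite functional \<Rightarrow> 'n functional" where
  "cnj_dist f \<phi> = cnj (f (\<lambda>x. cnj (\<phi> x)))"


section \<open>Fourier transform\<close>

definition ft_const :: "('n::finite \<Rightarrow> factor) \<Rightarrow> real" where
  "ft_const \<Gamma> = (\<Prod>i\<in>UNIV. case \<Gamma> i of Line \<Rightarrow> 1 | Circle L \<Rightarrow> L) powr (- 1 / 2)"

definition fundamental_cell :: "('n::finite \<Rightarrow> factor) \<Rightarrow> (real ^ 'n) set" where
  "fundamental_cell \<Gamma> = {x. \<forall>i L. \<Gamma> i = Circle L \<longrightarrow> 0 \<le> x $ i \<and> x $ i < L}"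

definition fourier :: "('n::finite \<Rightarrow> factor) \<Rightarrow> (real ^ 'n \<Rightarrow> complex) \<Rightarrow> real ^ 'n \<Rightarrow> complex" where
  "fourier \<Gamma> f \<xi> =
     of_real (ft_const \<Gamma>) * (LINT x:fundamental_cell \<Gamma>|lborel. f x * cis (- 2 * pi * (\<xi> \<bullet> x)))"

text \<open>
  The transpose of the Fourier transform, mapping functions on the dual group to functions on the
  group.  By \<open>fourier_transpose\<close> below, extending \<open>fourier\<close> to tempered distributions by duality
  amounts to pairing with \<open>fourier_dual \<Gamma> \<phi>\<close>; this is \<open>fourier_dist\<close>.
\<close>

definition fourier_dual :: "('n::finite \<Rightarrow> factor) \<Rightarrow> (real ^ 'n \<Rightarrow> complex) \<Rightarrow> real ^ 'n \<Rightarrow> complex" where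
  "fourier_dual \<Gamma> \<phi> x =
     of_real (ft_const \<Gamma>) * (LINT \<xi>|dual_measure \<Gamma>. \<phi> \<xi> * cis (- 2 * pi * (\<xi> \<bullet> x)))"

lemma cell_borel [measurable]: "fundamental_cell \<Gamma> \<in> sets borel"
proof -
  have "fundamental_cell \<Gamma> = (\<Inter>i. {x. case \<Gamma> i of Line \<Rightarrow> True | Circle L \<Rightarrow> 0 \<le> x $ i \<and> x $ i < L})"
    by (auto simp: fundamental_cell_def split: factor.splits)
  also have "\<dots> \<in> sets borel"
  proof (rule sets.finite_INT)
    fix i
    show "{x. case \<Gamma> i of Line \<Rightarrow> True | Circle L \<Rightarrow> 0 \<le> x $ i \<and> x $ i < L} \<in> sets borel"
    proof (cases "\<Gamma> i")
      case (Circle L)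
      have "{x::real^'a. 0 \<le> x $ i \<and> x $ i < L} = {x. 0 \<le> x $ i} - {x. L \<le> x $ i}"
        by auto
      also have "\<dots> \<in> sets borel"
        by (intro sets.Diff borel_closed closed_Collect_le continuous_intros)
      finally show ?thesis using Circle by simp
    qed simp
  qed auto
  finally show ?thesis .
qed

lemma chi_measurable [measurable]:
  "(\<lambda>\<xi>. \<chi> i. \<xi> i) \<in> measurable (\<Pi>\<^sub>M i\<in>UNIV. dual_factor_measure (\<Gamma> i)) (borel :: (real ^ 'n::finite) measure)"
proof (subst borel_measurable_euclidean_space, intro ballI)
  fix b :: "real ^ 'n" assume "b \<in> Basis"
  then obtain i where b: "b = axis i 1" by (auto simp: Basis_vec_def)
  have "(\<lambda>x. x) \<in> measurable (dual_factor_measure (\<Gamma> i)) borel"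
    by (auto simp: dual_factor_measure_def split: factor.splits)
  then have "(\<lambda>\<xi>. \<xi> i) \<in> borel_measurable (\<Pi>\<^sub>M i\<in>UNIV. dual_factor_measure (\<Gamma> i))"
    by (rule measurable_compose[rotated]) (rule measurable_component_singleton, simp)
  then show "(\<lambda>\<xi>. (\<chi> i. \<xi> i) \<bullet> b) \<in> borel_measurable (\<Pi>\<^sub>M i\<in>UNIV. dual_factor_measure (\<Gamma> i))"
    by (simp add: b inner_axis)
qed

lemma sigma_finite_dual_factor_measure: "sigma_finite_measure (dual_factor_measure F)"
  by (cases F) (auto simp: dual_factor_measure_def dual_factor_def lborel.sigma_finite_measure_axioms
      intro!: sigma_finite_measure_count_space_countable)

lemma fourier_transpose:
  fixes f \<phi> :: "real ^ 'n::finite \<Rightarrow> complex"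
  assumes f: "set_integrable lborel (fundamental_cell \<Gamma>) f"
    and \<phi>: "integrable (dual_measure \<Gamma>) \<phi>"
  shows "(LINT \<xi>|dual_measure \<Gamma>. fourier \<Gamma> f \<xi> * \<phi> \<xi>)
       = (LINT x:fundamental_cell \<Gamma>|lborel. f x * fourier_dual \<Gamma> \<phi> x)"
proof -
  interpret product_sigma_finite "\<lambda>i. dual_factor_measure (\<Gamma> i)"
    by (simp add: product_sigma_finite_def sigma_finite_dual_factor_measure)
  let ?v = "\<lambda>\<xi>::'n \<Rightarrow> real. (\<chi> i. \<xi> i) :: real ^ 'n"
  let ?C = "fundamental_cell \<Gamma>"
  define P where "P = (\<Pi>\<^sub>M i\<in>UNIV. dual_factor_measure (\<Gamma> i))"
  define F where "F x = indicator ?C x *\<^sub>R f x" for x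
  interpret P: sigma_finite_measure P
    unfolding P_def by (rule sigma_finite) simp
  interpret PL: pair_sigma_finite P "lborel :: (real ^ 'n) measure" ..
  have v [measurable]: "?v \<in> measurable P borel"
    unfolding P_def by measurable
  have F: "integrable lborel F"
    using f unfolding F_def set_integrable_def .
  have \<phi>P: "integrable P (\<lambda>\<xi>. \<phi> (?v \<xi>))"
    using \<phi> unfolding dual_measure_def P_def[symmetric] by (rule integrable_distr[OF v])
  have [measurable]: "\<phi> \<in> borel_measurable borel"
    using borel_measurable_integrable[OF \<phi>] unfolding dual_measure_def by simp
  have [measurable]: "F \<in> borel_measurable borel"
    using borel_measurable_integrable[OF F] by simp
  have [measurable]: "cis \<in> borel_measurable borel"
    by (intro borel_measurable_continuous_onI continuous_intros)
  let ?e = "\<lambda>\<xi> x. cis (- 2 * pi * (?v \<xi> \<bullet> x))"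
  have int: "integrable (P \<Otimes>\<^sub>M lborel) (\<lambda>(\<xi>, x). F x * \<phi> (?v \<xi>) * ?e \<xi> x)"
  proof (rule PL.Fubini_integrable)
    show "(\<lambda>(\<xi>, x). F x * \<phi> (?v \<xi>) * ?e \<xi> x) \<in> borel_measurable (P \<Otimes>\<^sub>M lborel)"
      by measurable
    have "integrable P (\<lambda>\<xi>. (LINT x|lborel. norm (F x)) * norm (\<phi> (?v \<xi>)))"
      using \<phi>P by (intro integrable_mult_right integrable_norm)
    then show "integrable P (\<lambda>\<xi>. LINT x|lborel. norm (case (\<xi>, x) of (\<xi>, x) \<Rightarrow> F x * \<phi> (?v \<xi>) * ?e \<xi> x))"
      by (simp add: norm_mult)
    have "integrable lborel (\<lambda>x. F x * \<phi> (?v \<xi>) * ?e \<xi> x)" for \<xi>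
      by (rule Bochner_Integration.integrable_bound[of _ "\<lambda>x. F x * \<phi> (?v \<xi>)"])
        (use F in \<open>auto simp: norm_mult\<close>)
    then show "AE \<xi> in P. integrable lborel (\<lambda>x. case (\<xi>, x) of (\<xi>, x) \<Rightarrow> F x * \<phi> (?v \<xi>) * ?e \<xi> x)"
      by simp
  qed
  have 1: "fourier \<Gamma> f (?v \<xi>) * \<phi> (?v \<xi>) = ft_const \<Gamma> * (LINT x|lborel. F x * \<phi> (?v \<xi>) * ?e \<xi> x)" for \<xi>
  proof -
    have "(LINT x|lborel. F x * \<phi> (?v \<xi>) * ?e \<xi> x) = (LINT x|lborel. (F x * ?e \<xi> x) * \<phi> (?v \<xi>))"
      by (simp add: mult_ac)
    also have "\<dots> = (LINT x|lborel. F x * ?e \<xi> x) * \<phi> (?v \<xi>)"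
      by (rule integral_mult_left_zero)
    finally show ?thesis
      by (simp add: fourier_def set_lebesgue_integral_def F_def)
  qed
  have 2: "F x * fourier_dual \<Gamma> \<phi> x = ft_const \<Gamma> * (LINT \<xi>|P. F x * \<phi> (?v \<xi>) * ?e \<xi> x)" for x
  proof -
    have "fourier_dual \<Gamma> \<phi> x = ft_const \<Gamma> * (LINT \<xi>|P. \<phi> (?v \<xi>) * ?e \<xi> x)"
      unfolding fourier_dual_def dual_measure_def P_def[symmetric]
      by (subst integral_distr[OF v]) (auto intro!: borel_measurable_times)
    moreover have "(LINT \<xi>|P. F x * \<phi> (?v \<xi>) * ?e \<xi> x) = F x * (LINT \<xi>|P. \<phi> (?v \<xi>) * ?e \<xi> x)"
      by (simp add: mult.assoc)
    ultimately show ?thesis by simp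
  qed
  have "(\<lambda>\<xi>. fourier \<Gamma> f \<xi> * \<phi> \<xi>) \<in> borel_measurable borel"
    unfolding fourier_def set_lebesgue_integral_def scaleR_conv_of_real
  proof -
    have "(\<lambda>\<xi>. LINT x|lborel. F x * cis (- 2 * pi * (\<xi> \<bullet> x))) \<in> borel_measurable borel"
      by measurable
    then show "(\<lambda>\<xi>. of_real (ft_const \<Gamma>) * (LINT x|lborel. of_real (indicator ?C x) * (f x * cis (- 2 * pi * (\<xi> \<bullet> x)))) * \<phi> \<xi>)
        \<in> borel_measurable borel"
      by (simp add: F_def scaleR_conv_of_real mult.assoc)
  qed
  then have "(LINT \<xi>|dual_measure \<Gamma>. fourier \<Gamma> f \<xi> * \<phi> \<xi>) = (LINT \<xi>|P. fourier \<Gamma> f (?v \<xi>) * \<phi> (?v \<xi>))"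
    unfolding dual_measure_def P_def[symmetric] by (subst integral_distr[OF v]) auto
  also have "\<dots> = ft_const \<Gamma> * (LINT \<xi>|P. LINT x|lborel. F x * \<phi> (?v \<xi>) * ?e \<xi> x)"
    unfolding 1 by simp
  also have "(LINT \<xi>|P. LINT x|lborel. F x * \<phi> (?v \<xi>) * ?e \<xi> x)
      = (LINT x|lborel. LINT \<xi>|P. F x * \<phi> (?v \<xi>) * ?e \<xi> x)"
    by (rule PL.Fubini_integral[OF int, symmetric])
  also have "ft_const \<Gamma> * \<dots> = (LINT x|lborel. F x * fourier_dual \<Gamma> \<phi> x)"
    unfolding 2 by simp
  finally show ?thesis
    by (simp add: set_lebesgue_integral_def F_def)
qed

definition fourier_dist :: "('n::finite \<Rightarrow> factor) \<Rightarrow> 'n functional \<Rightarrow> 'n functional" where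
  "fourier_dist \<Gamma> f \<phi> = f (fourier_dual \<Gamma> \<phi>)"

definition dual_test_functions :: "('n::finite \<Rightarrow> factor) \<Rightarrow> (real ^ 'n \<Rightarrow> complex) set" where
  "dual_test_functions \<Gamma> = {\<phi>. smooth_along (line_indices \<Gamma>) (dual_group \<Gamma>) \<phi> \<and>
     (\<exists>K. compact K \<and> (\<forall>\<xi>\<in>dual_group \<Gamma> - K. \<phi> \<xi> = 0))}"

definition locally_integrable :: "('n::finite \<Rightarrow> factor) \<Rightarrow> (real ^ 'n \<Rightarrow> complex) \<Rightarrow> bool" where
  "locally_integrable \<Gamma> g \<longleftrightarrow> g \<in> borel_measurable (dual_measure \<Gamma>) \<and>
     (\<forall>K. compact K \<longrightarrow> set_integrable (dual_measure \<Gamma>) K g)"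

text \<open>As distributions on the dual group, the Fourier transform of \<open>f\<close> equals \<open>g\<close>.\<close>

definition fourier_is_fun :: "('n::finite \<Rightarrow> factor) \<Rightarrow> 'n functional \<Rightarrow> (real ^ 'n \<Rightarrow> complex) \<Rightarrow> bool" where
  "fourier_is_fun \<Gamma> f g \<longleftrightarrow> locally_integrable \<Gamma> g \<and>
     (\<forall>\<phi>\<in>dual_test_functions \<Gamma>. fourier_dist \<Gamma> f \<phi> = (LINT \<xi>|dual_measure \<Gamma>. g \<xi> * \<phi> \<xi>))"

text \<open>The representative is unique only up to null sets, which do not affect the norm below.\<close>

definition fourier_fun :: "('n::finite \<Rightarrow> factor) \<Rightarrow> 'n functional \<Rightarrow> real ^ 'n \<Rightarrow> complex" where
  "fourier_fun \<Gamma> f = (SOME g. fourier_is_fun \<Gamma> f g)"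


section \<open>The spaces\<close>

text \<open>The distinguished coordinate of the weight (the first one) is the parameter \<open>j\<close>.\<close>

definition japanese :: "real ^ 'n::finite \<Rightarrow> real" where
  "japanese \<xi> = sqrt (1 + (norm \<xi>)\<^sup>2)"

definition mu :: "'n::finite \<Rightarrow> real ^ 'n \<Rightarrow> real" where
  "mu j \<xi> = (if \<xi> = 0 then 1 else \<bar>\<xi> $ j\<bar> / norm \<xi> + norm \<xi>)"

definition X_norm_sq :: "('n::finite \<Rightarrow> factor) \<Rightarrow> 'n \<Rightarrow> real \<Rightarrow> 'n functional \<Rightarrow> ennreal" where
  "X_norm_sq \<Gamma> j s f =
     (\<integral>\<^sup>+\<xi>. ennreal ((mu j \<xi> * japanese \<xi> powr (s - 1) * norm (fourier_fun \<Gamma> f \<xi>))\<^sup>2) \<partial>dual_measure \<Gamma>)"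

definition X_norm :: "('n::finite \<Rightarrow> factor) \<Rightarrow> 'n \<Rightarrow> real \<Rightarrow> 'n functional \<Rightarrow> real" where
  "X_norm \<Gamma> j s f = sqrt (enn2real (X_norm_sq \<Gamma> j s f))"

datatype scalars = Real_scalars | Complex_scalars

definition X_space :: "scalars \<Rightarrow> ('n::finite \<Rightarrow> factor) \<Rightarrow> 'n \<Rightarrow> real \<Rightarrow> 'n functional set" where
  "X_space \<F> \<Gamma> j s =
     {f \<in> tempered \<Gamma>. (\<exists>g. fourier_is_fun \<Gamma> f g) \<and> X_norm_sq \<Gamma> j s f < \<infinity> \<and>
        (\<F> = Real_scalars \<longrightarrow> f = cnj_dist f)}"

definition X_complete :: "scalars \<Rightarrow> ('n::finite \<Rightarrow> factor) \<Rightarrow> 'n \<Rightarrow> real \<Rightarrow> bool" where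
  "X_complete \<F> \<Gamma> j s \<longleftrightarrow>
     (\<forall>\<sigma>::nat \<Rightarrow> 'n functional.
        (\<forall>n. \<sigma> n \<in> X_space \<F> \<Gamma> j s) \<and>
        (\<forall>\<epsilon>>0. \<exists>N. \<forall>m\<ge>N. \<forall>n\<ge>N. X_norm \<Gamma> j s (\<lambda>\<phi>. \<sigma> m \<phi> - \<sigma> n \<phi>) < \<epsilon>) \<longrightarrow>
        (\<exists>f\<in>X_space \<F> \<Gamma> j s. (\<lambda>n. X_norm \<Gamma> j s (\<lambda>\<phi>. \<sigma> n \<phi> - f \<phi>)) \<longlonglongrightarrow> 0))"

end

theory Submission
  imports Defs "HOL-Probability.Probability"
begin

text \<open>
  Let \<open>R\<close> be the set of line directions and \<open>w\<close> the weight of the norm.  The Fourier transform identifies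
  the space isometrically with the functions on the dual group that are square integrable against
  \<open>w\<^sup>2\<close> and locally integrable, with the symmetry \<open>g (- \<xi>) = cnj (g \<xi>)\<close> in the case of real scalars.
  Square integrability against \<open>w\<^sup>2\<close> and the symmetry pass to limits, so that completeness depends only
  on whether local integrability does.

  Away from the origin \<open>w\<close> is bounded below on compact sets, and there local integrability follows from
  square integrability.  On the component of the origin in the dual group, a copy of \<open>\<real>\<^sup>R\<close>, the coordinate
  \<open>\<xi>\<^sub>j\<close> vanishes because \<open>j\<close> is a circle direction, and \<open>w\<close> is comparable to \<open>\<bar>\<xi>\<bar>\<close> near \<open>0\<close>.  If
  \<open>card R > 2\<close>, then \<open>1 / \<bar>\<xi>\<bar>\<^sup>2\<close> is integrable near \<open>0\<close>, and by the Cauchy--Schwarz inequality the weighted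
  norm controls the integral over compact sets.  This is \<open>X_complete_of_three_lines\<close>, with the integral
  of the inverse weight estimated in \<open>nn_integral_decay_over_weight\<close>.  If \<open>card R \<le> 2\<close>, take dyadic shells
  \<open>A\<^sub>k\<close> of radius \<open>2\<^sup>-\<^sup>k\<close> around \<open>0\<close> in \<open>\<real>\<^sup>R\<close> and heights \<open>a\<^sub>k\<close> for which the mass \<open>a\<^sub>k \<bar>A\<^sub>k\<bar>\<close> is proportional to
  \<open>1 / (k + 1)\<close>.  The squared norm of \<open>a\<^sub>k\<close> times the indicator of \<open>A\<^sub>k\<close> is then \<open>O(1 / (k + 1)\<^sup>2)\<close>, so the
  partial sums form a Cauchy sequence, but a limit would have to coincide with the full sum, whose
  integral near the origin is a divergent harmonic series.  This is \<open>not_X_complete_of_few_lines\<close>.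

  The identification rests on three facts.  The Fourier transform of a Schwartz function is
  bounded by \<open>\<Prod>i. 1 / (1 + \<xi>\<^sub>i\<^sup>2)\<close> times finitely many seminorms (\<open>fourier_decay\<close>); hence every \<open>g\<close>
  that is integrable against this product is the Fourier transform of a tempered distribution.  That the
  Fourier transform of this distribution is \<open>g\<close> again is the inversion formula for test functions
  (\<open>fourier_inversion\<close>), together with the fact that the transforms of test functions are Schwartz
  functions (\<open>fourier_dual_schwartz\<close>).  Finally \<open>g\<close> is determined up to null sets because the test functions
  separate locally integrable functions (\<open>AE_zero_of_tests\<close>).
\<close>

section \<open>Calculus of partial derivatives along a set of directions\<close>

lemma partial_deriv_eqI:
  assumes "((\<lambda>t::real. f (x + t *\<^sub>R axis i 1)) has_vector_derivative d) (at 0)"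
  shows "partial_deriv i f x = d"
  using vector_derivative_at[OF assms] by (simp add: partial_deriv_def)

lemma has_partial_deriv:
  assumes "(\<lambda>t::real. f (x + t *\<^sub>R axis i 1)) differentiable (at 0)"
  shows "((\<lambda>t. f (x + t *\<^sub>R axis i 1)) has_vector_derivative partial_deriv i f x) (at 0)"
  using assms by (simp add: partial_deriv_def vector_derivative_works)

lemma partial_derivs_Nil [simp]: "partial_derivs [] f = f"
  and partial_derivs_Cons: "partial_derivs (i # is) f = partial_deriv i (partial_derivs is f)"
  and partial_derivs_snoc: "partial_derivs (is @ [i]) f = partial_derivs is (partial_deriv i f)"
  by (simp_all add: partial_derivs_def)

text \<open>
  The Leibniz rule is proved by induction on the order of differentiation, for which the finite
  orders have to be separated.
\<close>

primrec smooth_upto ::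
    "nat \<Rightarrow> 'n::finite set \<Rightarrow> (real ^ 'n) set \<Rightarrow> (real ^ 'n \<Rightarrow> complex) \<Rightarrow> bool" where
  "smooth_upto 0 D S f \<longleftrightarrow> continuous_on S f"
| "smooth_upto (Suc k) D S f \<longleftrightarrow> continuous_on S f \<and>
     (\<forall>i\<in>D. (\<forall>x\<in>S. (\<lambda>t::real. f (x + t *\<^sub>R axis i 1)) differentiable (at 0)) \<and>
            smooth_upto k D S (partial_deriv i f))"

lemma smooth_along_coinduct:
  assumes "P f"
    and "\<And>f. P f \<Longrightarrow> continuous_on S f"
    and "\<And>f i x. P f \<Longrightarrow> i \<in> D \<Longrightarrow> x \<in> S \<Longrightarrow> (\<lambda>t::real. f (x + t *\<^sub>R axis i 1)) differentiable (at 0)"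
    and "\<And>f i. P f \<Longrightarrow> i \<in> D \<Longrightarrow> P (partial_deriv i f)"
  shows "smooth_along D S f"
proof -
  have "P (partial_derivs is f)" if "is \<in> lists D" for "is"
    using that by induction (auto simp: partial_derivs_Cons assms)
  then show ?thesis
    unfolding smooth_along_def using assms by blast
qed

lemma smooth_along_continuous: "smooth_along D S f \<Longrightarrow> continuous_on S f"
  unfolding smooth_along_def by (metis lists.Nil partial_derivs_Nil)

lemma smooth_along_differentiable:
  "smooth_along D S f \<Longrightarrow> i \<in> D \<Longrightarrow> x \<in> S \<Longrightarrow> (\<lambda>t::real. f (x + t *\<^sub>R axis i 1)) differentiable (at 0)"
  unfolding smooth_along_def by (metis lists.Nil partial_derivs_Nil)

lemma smooth_along_partial_deriv:
  "smooth_along D S f \<Longrightarrow> i \<in> D \<Longrightarrow> smooth_along D S (partial_deriv i f)"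
  unfolding smooth_along_def partial_derivs_snoc[symmetric] by auto

lemma smooth_along_iff: "smooth_along D S f \<longleftrightarrow> (\<forall>k. smooth_upto k D S f)"
proof
  assume "smooth_along D S f"
  then have "smooth_upto k D S f" for k
    by (induction k arbitrary: f)
      (auto simp: smooth_along_continuous smooth_along_differentiable smooth_along_partial_deriv)
  then show "\<forall>k. smooth_upto k D S f" ..
next
  assume *: "\<forall>k. smooth_upto k D S f"
  show "smooth_along D S f"
  proof (rule smooth_along_coinduct[of "\<lambda>f. \<forall>k. smooth_upto k D S f"])
    show "continuous_on S f" if "\<forall>k. smooth_upto k D S f" for f
      using that[rule_format, of 0] by simp
    show "(\<lambda>t. f (x + t *\<^sub>R axis i 1)) differentiable at 0"
      if "\<forall>k. smooth_upto k D S f" "i \<in> D" "x \<in> S" for f i x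
      using that(1)[rule_format, of "Suc 0"] that(2,3) unfolding smooth_upto.simps by blast
    show "\<forall>k. smooth_upto k D S (partial_deriv i f)" if "\<forall>k. smooth_upto k D S f" "i \<in> D" for f i
      using that by (metis smooth_upto.simps(2))
  qed fact
qed

text \<open>
  If \<open>S\<close> is invariant under translation in the directions \<open>D\<close>, then the derivatives at the points of \<open>S\<close>
  depend only on the values on \<open>S\<close>.  The dual group has this property for the line directions.
\<close>

definition translation_closed :: "'n::finite set \<Rightarrow> (real ^ 'n) set \<Rightarrow> bool" where
  "translation_closed D S \<longleftrightarrow> (\<forall>i\<in>D. \<forall>x\<in>S. \<forall>t. x + t *\<^sub>R axis i 1 \<in> S)"

lemma translation_closed_UNIV [simp]: "translation_closed D UNIV"
  by (simp add: translation_closed_def)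

lemma translation_closed_dual_group: "translation_closed (line_indices \<Gamma>) (dual_group \<Gamma>)"
  by (auto simp: translation_closed_def dual_group_def line_indices_def dual_factor_def axis_def)

lemma along_line_cong:
  assumes "translation_closed D S" "i \<in> D" "x \<in> S" "\<And>x. x \<in> S \<Longrightarrow> f x = g x"
  shows "(\<lambda>t::real. f (x + t *\<^sub>R axis i 1)) = (\<lambda>t. g (x + t *\<^sub>R axis i 1))"
  using assms by (auto simp: translation_closed_def)

lemma partial_deriv_cong:
  assumes "translation_closed D S" "i \<in> D" "x \<in> S" "\<And>x. x \<in> S \<Longrightarrow> f x = g x"
  shows "partial_deriv i f x = partial_deriv i g x"
  unfolding partial_deriv_def using along_line_cong[of D S i x f g] assms by simp

lemma smooth_upto_cong:
  assumes "translation_closed D S" "\<And>x. x \<in> S \<Longrightarrow> f x = g x" "smooth_upto k D S f"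
  shows "smooth_upto k D S g"
  using assms(2,3)
proof (induction k arbitrary: f g)
  case 0
  then show ?case using continuous_on_cong[of S S f g] by simp
next
  case (Suc k)
  have "continuous_on S g"
    using Suc.prems continuous_on_cong[of S S f g] by simp
  moreover have "(\<lambda>t::real. g (x + t *\<^sub>R axis i 1)) differentiable (at 0)" if "i \<in> D" "x \<in> S" for i x
  proof -
    have "(\<lambda>t::real. f (x + t *\<^sub>R axis i 1)) = (\<lambda>t. g (x + t *\<^sub>R axis i 1))"
      by (rule along_line_cong[OF assms(1) that]) (rule Suc.prems(1))
    moreover have "(\<lambda>t::real. f (x + t *\<^sub>R axis i 1)) differentiable (at 0)"
      using Suc.prems(2) that unfolding smooth_upto.simps by blast
    ultimately show ?thesis by metis
  qed
  moreover have "smooth_upto k D S (partial_deriv i g)" if "i \<in> D" for i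
    by (rule Suc.IH[of "partial_deriv i f"])
      (use Suc.prems that partial_deriv_cong[OF assms(1) that, of _ f g] in auto)
  ultimately show ?case by simp
qed

lemma smooth_along_cong:
  assumes "translation_closed D S" "\<And>x. x \<in> S \<Longrightarrow> f x = g x" "smooth_along D S f"
  shows "smooth_along D S g"
  using smooth_upto_cong[of D S f g] assms unfolding smooth_along_iff by blast

lemma smooth_upto_SucI:
  assumes "translation_closed D S" "continuous_on S f"
    and "\<And>i x. i \<in> D \<Longrightarrow> x \<in> S \<Longrightarrow> ((\<lambda>t. f (x + t *\<^sub>R axis i 1)) has_vector_derivative f' i x) (at 0)"
    and "\<And>i. i \<in> D \<Longrightarrow> smooth_upto k D S (f' i)"
  shows "smooth_upto (Suc k) D S f"
proof -
  have "smooth_upto k D S (partial_deriv i f)" if "i \<in> D" for i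
    by (rule smooth_upto_cong[OF assms(1) _ assms(4)[OF that]])
      (simp add: partial_deriv_eqI[OF assms(3)] that)
  then show ?thesis
    using assms by (auto simp: has_vector_derivative_def differentiable_def)
qed

lemma smooth_upto_lower: "smooth_upto (Suc k) D S f \<Longrightarrow> smooth_upto k D S f"
  by (induction k arbitrary: f) auto

lemma smooth_upto_deriv:
  "smooth_upto (Suc k) D S f \<Longrightarrow> i \<in> D \<Longrightarrow> x \<in> S \<Longrightarrow>
    ((\<lambda>t. f (x + t *\<^sub>R axis i 1)) has_vector_derivative partial_deriv i f x) (at 0)"
  by (auto intro: has_partial_deriv)

lemma smooth_upto_const [simp]: "smooth_upto k D S (\<lambda>_. c)"
proof (induction k arbitrary: c)
  case (Suc k)
  have "partial_deriv i (\<lambda>_::real^'a. c) = (\<lambda>_. 0)" for i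
    by (auto intro!: partial_deriv_eqI derivative_eq_intros)
  then show ?case using Suc by simp
qed simp

lemma smooth_upto_add:
  assumes "translation_closed D S" "smooth_upto k D S f" "smooth_upto k D S g"
  shows "smooth_upto k D S (\<lambda>x. f x + g x)"
  using assms(2,3)
proof (induction k arbitrary: f g)
  case (Suc k)
  show ?case
    by (rule smooth_upto_SucI[where f' = "\<lambda>i x. partial_deriv i f x + partial_deriv i g x"])
      (use Suc in \<open>auto intro!: continuous_on_add has_vector_derivative_add has_partial_deriv assms(1)\<close>)
qed (auto intro: continuous_on_add)

lemma smooth_upto_mult:
  assumes "translation_closed D S" "smooth_upto k D S f" "smooth_upto k D S g"
  shows "smooth_upto k D S (\<lambda>x. f x * g x)"
  using assms(2,3)
proof (induction k arbitrary: f g)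
  case (Suc k)
  note low = smooth_upto_lower[OF Suc.prems(1)] smooth_upto_lower[OF Suc.prems(2)]
  show ?case
  proof (rule smooth_upto_SucI[where f' = "\<lambda>i x. f x * partial_deriv i g x + partial_deriv i f x * g x"])
    show "smooth_upto k D S (\<lambda>x. f x * partial_deriv i g x + partial_deriv i f x * g x)" if "i \<in> D" for i
      using Suc.prems that by (intro smooth_upto_add[OF assms(1)] Suc.IH low) auto
    show "((\<lambda>t. f (x + t *\<^sub>R axis i 1) * g (x + t *\<^sub>R axis i 1)) has_vector_derivative
          f x * partial_deriv i g x + partial_deriv i f x * g x) (at 0)" if "i \<in> D" "x \<in> S" for i x
      using has_vector_derivative_mult[OF smooth_upto_deriv[OF Suc.prems(1) that]
          smooth_upto_deriv[OF Suc.prems(2) that]] by simp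
  qed (use Suc.prems in \<open>auto intro!: continuous_on_mult assms(1)\<close>)
qed (auto intro: continuous_on_mult)

lemma smooth_upto_prod:
  assumes "translation_closed D S" "finite A" "\<And>a. a \<in> A \<Longrightarrow> smooth_upto k D S (f a)"
  shows "smooth_upto k D S (\<lambda>x. \<Prod>a\<in>A. f a x)"
  using assms(2,3) by induction (auto intro: smooth_upto_mult[OF assms(1)])

lemma smooth_upto_coordinate:
  assumes "translation_closed D S"
  shows "smooth_upto k D S (\<lambda>x. of_real (x $ l))"
proof (cases k)
  case 0
  then show ?thesis by (auto intro!: continuous_intros)
next
  case (Suc k)
  show ?thesis unfolding Suc
  proof (rule smooth_upto_SucI[where f' = "\<lambda>i x. of_real (axis i 1 $ l)", OF assms])
    have "((\<lambda>t. x $ l + t * axis i 1 $ l) has_vector_derivative axis i 1 $ l) (at 0)" for x and i :: 'a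
      by (auto intro!: derivative_eq_intros simp: has_real_derivative_iff_has_vector_derivative[symmetric])
    then have "((\<lambda>t. x $ l + t * axis i 1 $ l) has_real_derivative axis i 1 $ l) (at 0)" for x and i :: 'a
      by (simp add: has_real_derivative_iff_has_vector_derivative)
    from has_vector_derivative_of_real[OF this]
    show "((\<lambda>t. of_real ((x + t *\<^sub>R axis i 1) $ l)) has_vector_derivative
        complex_of_real (axis i 1 $ l)) (at 0)" for x and i :: 'a
      by (simp del: of_real_add of_real_mult)
  qed (auto intro!: continuous_intros)
qed

lemma smooth_upto_cnj:
  assumes "translation_closed D S" "smooth_upto k D S f"
  shows "smooth_upto k D S (\<lambda>x. cnj (f x))"
  using assms(2)
proof (induction k arbitrary: f)
  case (Suc k)
  show ?case
    by (rule smooth_upto_SucI[where f' = "\<lambda>i x. cnj (partial_deriv i f x)"])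
      (use Suc in \<open>auto intro!: continuous_intros has_vector_derivative_cnj has_partial_deriv assms(1)\<close>)
qed (auto intro: continuous_intros)

lemma smooth_upto_reflect:
  assumes "translation_closed D S" "\<And>x. x \<in> S \<Longrightarrow> - x \<in> S" "smooth_upto k D S f"
  shows "smooth_upto k D S (\<lambda>x. f (- x))"
  using assms(3)
proof (induction k arbitrary: f)
  case 0
  then show ?case
    using assms(2) by (auto intro!: continuous_on_compose2[of S f] continuous_intros)
next
  case (Suc k)
  show ?case
  proof (rule smooth_upto_SucI[where f' = "\<lambda>i x. - 1 * partial_deriv i f (- x)"])
    show "((\<lambda>t. f (- (x + t *\<^sub>R axis i 1))) has_vector_derivative - 1 * partial_deriv i f (- x)) (at 0)"
      if "i \<in> D" "x \<in> S" for i x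
    proof -
      have "((\<lambda>t. f (- x + t *\<^sub>R axis i 1)) has_vector_derivative partial_deriv i f (- x)) (at (- 0))"
        using smooth_upto_deriv[OF Suc.prems that(1), of "- x"] that assms(2) by simp
      moreover have "((\<lambda>t::real. - t) has_vector_derivative - 1) (at 0)"
        by (auto intro!: derivative_eq_intros)
      ultimately have "((\<lambda>t. f (- x + t *\<^sub>R axis i 1)) \<circ> uminus has_vector_derivative
          - 1 *\<^sub>R partial_deriv i f (- x)) (at 0)"
        by (intro vector_diff_chain_at)
      then show ?thesis by (simp add: o_def minus_diff_commute)
    qed
    show "smooth_upto k D S (\<lambda>x. - 1 * partial_deriv i f (- x))" if "i \<in> D" for i
      by (rule smooth_upto_mult) (use Suc that assms(1) in auto)
  qed (use Suc.prems assms in \<open>auto intro!: continuous_on_compose2[of S f] continuous_intros\<close>)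
qed


section \<open>The measures on the group and on its dual\<close>

definition cell_factor :: "factor \<Rightarrow> real set" where
  "cell_factor F = (case F of Line \<Rightarrow> UNIV | Circle L \<Rightarrow> {0..<L})"

lemma indicator_fundamental_cell:
  "(indicator (fundamental_cell \<Gamma>) x :: 'a::comm_semiring_1) = (\<Prod>i\<in>UNIV. indicator (cell_factor (\<Gamma> i)) (x $ i))"
proof -
  have *: "x \<in> fundamental_cell \<Gamma> \<longleftrightarrow> (\<forall>i. x $ i \<in> cell_factor (\<Gamma> i))"
    by (auto simp: fundamental_cell_def cell_factor_def split: factor.splits)
  show ?thesis
  proof (cases "x \<in> fundamental_cell \<Gamma>")
    case False
    then obtain i where "x $ i \<notin> cell_factor (\<Gamma> i)" using * by auto
    then have "(\<Prod>i\<in>UNIV. indicator (cell_factor (\<Gamma> i)) (x $ i)) = (0 :: 'a)"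
      by (intro prod_zero) (auto intro!: exI[of _ i])
    with False show ?thesis by simp
  qed (use * in simp)
qed

lemma cell_factor_borel [measurable]: "cell_factor F \<in> sets borel"
  by (auto simp: cell_factor_def split: factor.splits)

lemma product_sigma_finite_dual: "product_sigma_finite (\<lambda>i. dual_factor_measure (\<Gamma> i))"
  by (simp add: product_sigma_finite_def sigma_finite_dual_factor_measure)

lemma space_dual_factor_measure: "space (dual_factor_measure F) = dual_factor F"
  by (auto simp: dual_factor_measure_def dual_factor_def split: factor.splits)

lemma borel_measurable_dual_factor: "f \<in> borel_measurable borel \<Longrightarrow> f \<in> measurable (dual_factor_measure F) N"
  if "sets N = sets borel" for f :: "real \<Rightarrow> 'a::topological_space" and N
  using that by (auto simp: dual_factor_measure_def measurable_count_space_eq1 sets_eq_imp_space_eq[OF that]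
      cong: measurable_cong_sets split: factor.splits)

lemma borel_sets_dual_factor: "A \<in> sets borel \<Longrightarrow> A \<inter> dual_factor F \<in> sets (dual_factor_measure F)"
  by (auto simp: dual_factor_measure_def dual_factor_def split: factor.splits)

lemma sets_dual_measure [simp, measurable_cong]: "sets (dual_measure \<Gamma>) = sets borel"
  and space_dual_measure [simp]: "space (dual_measure \<Gamma>) = UNIV"
  by (simp_all add: dual_measure_def)

lemma emeasure_dual_measure_box:
  fixes A :: "'n::finite \<Rightarrow> real set"
  assumes "\<And>i. A i \<in> sets borel"
  shows "emeasure (dual_measure \<Gamma>) {\<xi>. \<forall>i. \<xi> $ i \<in> A i}
       = (\<Prod>i\<in>UNIV. emeasure (dual_factor_measure (\<Gamma> i)) (A i \<inter> dual_factor (\<Gamma> i)))"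
proof -
  interpret product_sigma_finite "\<lambda>i. dual_factor_measure (\<Gamma> i)" by (rule product_sigma_finite_dual)
  have "{\<xi>::real^'n. \<xi> $ i \<in> A i} \<in> sets borel" for i
  proof -
    have "(\<lambda>\<xi>::real^'n. \<xi> $ i) -` A i \<inter> space borel \<in> sets borel"
      using assms by (intro measurable_sets[of _ borel borel]) auto
    then show ?thesis by (simp add: vimage_def)
  qed
  then have "(\<Inter>i. {\<xi>::real^'n. \<xi> $ i \<in> A i}) \<in> sets borel"
    by (intro sets.finite_INT) auto
  then have s: "{\<xi>::real^'n. \<forall>i. \<xi> $ i \<in> A i} \<in> sets borel"
    by (simp add: INTER_eq)
  have "(\<lambda>\<xi>. \<chi> i. \<xi> i) -` {\<xi>. \<forall>i. \<xi> $ i \<in> A i} \<inter> space (\<Pi>\<^sub>M i\<in>UNIV. dual_factor_measure (\<Gamma> i))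
     = (\<Pi>\<^sub>E i\<in>UNIV. A i \<inter> dual_factor (\<Gamma> i))"
    by (auto simp: space_PiM space_dual_factor_measure PiE_iff)
  then show ?thesis
    unfolding dual_measure_def using s assms
    by (subst emeasure_distr) (auto intro!: emeasure_PiM borel_sets_dual_factor)
qed

text \<open>
  Lebesgue measure is the dual measure of a group without circle factors.  The product formulas for
  the dual group therefore apply to integrals over the group as well.
\<close>

lemma lborel_eq_dual_measure: "(lborel :: (real ^ 'n::finite) measure) = dual_measure (\<lambda>_. Line)"
proof (rule lborel_eqI)
  fix l u :: "real ^ 'n"
  assume *: "\<And>b. b \<in> Basis \<Longrightarrow> l \<bullet> b \<le> u \<bullet> b"
  have le: "l $ i \<le> u $ i" for i
    using *[of "axis i 1"] by (simp add: inner_axis)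
  have "box l u = {\<xi>. \<forall>i. \<xi> $ i \<in> {l $ i<..<u $ i}}"
    by (auto simp: mem_box_cart)
  then have "emeasure (dual_measure (\<lambda>_. Line)) (box l u) = (\<Prod>i\<in>UNIV. ennreal (u $ i - l $ i))"
    using le by (subst \<open>box l u = _\<close>, subst emeasure_dual_measure_box)
      (auto simp: dual_factor_measure_def dual_factor_def)
  also have "\<dots> = ennreal (\<Prod>i\<in>UNIV. (u - l) $ i)"
    using le by (simp add: prod_ennreal)
  also have "(\<Prod>i\<in>UNIV. (u - l) $ i) = (\<Prod>b\<in>Basis. (u - l) \<bullet> b)"
  proof -
    have "Basis = range (\<lambda>i::'n. axis i (1::real))" by (auto simp: Basis_vec_def)
    moreover have "inj (\<lambda>i::'n. axis i (1::real))" by (auto simp: inj_on_def axis_eq_axis)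
    ultimately show ?thesis
      using prod.reindex[of "\<lambda>i::'n. axis i (1::real)" UNIV "\<lambda>b. (u - l) \<bullet> b"] by (simp add: inner_axis)
  qed
  finally show "emeasure (dual_measure (\<lambda>_. Line)) (box l u) = ennreal (\<Prod>b\<in>Basis. (u - l) \<bullet> b)" .
qed simp

lemma nn_integral_dual_prod:
  assumes "\<And>i. f i \<in> borel_measurable borel"
  shows "(\<integral>\<^sup>+\<xi>. (\<Prod>i\<in>UNIV. f i (\<xi> $ i)) \<partial>dual_measure \<Gamma>) = (\<Prod>i\<in>UNIV. \<integral>\<^sup>+t. f i t \<partial>dual_factor_measure (\<Gamma> i))"
proof -
  interpret product_sigma_finite "\<lambda>i. dual_factor_measure (\<Gamma> i)" by (rule product_sigma_finite_dual)
  have [measurable]: "f i \<in> borel_measurable borel" for i by fact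
  have "(\<integral>\<^sup>+\<xi>. (\<Prod>i\<in>UNIV. f i (\<xi> $ i)) \<partial>dual_measure \<Gamma>)
      = (\<integral>\<^sup>+\<xi>. (\<Prod>i\<in>UNIV. f i (\<xi> i)) \<partial>(\<Pi>\<^sub>M i\<in>UNIV. dual_factor_measure (\<Gamma> i)))"
    unfolding dual_measure_def by (subst nn_integral_distr) (auto intro!: borel_measurable_prod_ennreal)
  also have "\<dots> = (\<Prod>i\<in>UNIV. \<integral>\<^sup>+t. f i t \<partial>dual_factor_measure (\<Gamma> i))"
    using assms by (intro product_nn_integral_prod) (auto intro: borel_measurable_dual_factor)
  finally show ?thesis .
qed

lemma
  fixes f :: "'n::finite \<Rightarrow> real \<Rightarrow> 'a::{real_normed_field, banach, second_countable_topology}"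
  assumes "\<And>i. f i \<in> borel_measurable borel" "\<And>i. integrable (dual_factor_measure (\<Gamma> i)) (f i)"
  shows integral_dual_prod: "(LINT \<xi>|dual_measure \<Gamma>. (\<Prod>i\<in>UNIV. f i (\<xi> $ i))) = (\<Prod>i\<in>UNIV. LINT t|dual_factor_measure (\<Gamma> i). f i t)"
    and integrable_dual_prod: "integrable (dual_measure \<Gamma>) (\<lambda>\<xi>. \<Prod>i\<in>UNIV. f i (\<xi> $ i))"
proof -
  interpret product_sigma_finite "\<lambda>i. dual_factor_measure (\<Gamma> i)" by (rule product_sigma_finite_dual)
  have [measurable]: "f i \<in> borel_measurable borel" for i by fact
  show "(LINT \<xi>|dual_measure \<Gamma>. (\<Prod>i\<in>UNIV. f i (\<xi> $ i))) = (\<Prod>i\<in>UNIV. LINT t|dual_factor_measure (\<Gamma> i). f i t)"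
    unfolding dual_measure_def
    by (subst integral_distr) (auto intro!: product_integral_prod assms)
  show "integrable (dual_measure \<Gamma>) (\<lambda>\<xi>. \<Prod>i\<in>UNIV. f i (\<xi> $ i))"
    unfolding dual_measure_def
    by (subst integrable_distr_eq) (auto intro!: product_integrable_prod assms)
qed

lemma
  fixes f :: "'n::finite \<Rightarrow> real \<Rightarrow> 'a::{real_normed_field, banach, second_countable_topology}"
  assumes "\<And>i. f i \<in> borel_measurable borel" "\<And>i. set_integrable lborel (cell_factor (\<Gamma> i)) (f i)"
  shows integral_cell_prod:
      "(LINT x:fundamental_cell \<Gamma>|lborel. (\<Prod>i\<in>UNIV. f i (x $ i))) = (\<Prod>i\<in>UNIV. LINT t:cell_factor (\<Gamma> i)|lborel. f i t)"
    and integrable_cell_prod: "set_integrable lborel (fundamental_cell \<Gamma>) (\<lambda>x. \<Prod>i\<in>UNIV. f i (x $ i))"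
proof -
  define h where "h i t = indicator (cell_factor (\<Gamma> i)) t *\<^sub>R f i t" for i t
  have [measurable]: "f i \<in> borel_measurable borel" for i by fact
  have h: "h i \<in> borel_measurable borel" "integrable (dual_factor_measure Line) (h i)" for i
    using assms(2)[of i] by (simp_all add: h_def[abs_def] set_integrable_def dual_factor_measure_def)
  have *: "indicator (fundamental_cell \<Gamma>) x *\<^sub>R (\<Prod>i\<in>UNIV. f i (x $ i)) = (\<Prod>i\<in>UNIV. h i (x $ i))" for x
    by (simp add: h_def indicator_fundamental_cell scaleR_conv_of_real prod.distrib del: of_real_indicator)
  show "(LINT x:fundamental_cell \<Gamma>|lborel. (\<Prod>i\<in>UNIV. f i (x $ i))) = (\<Prod>i\<in>UNIV. LINT t:cell_factor (\<Gamma> i)|lborel. f i t)"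
    unfolding set_lebesgue_integral_def * lborel_eq_dual_measure
    using integral_dual_prod[of h "\<lambda>_. Line", OF h] by (simp add: h_def dual_factor_measure_def)
  show "set_integrable lborel (fundamental_cell \<Gamma>) (\<lambda>x. \<Prod>i\<in>UNIV. f i (x $ i))"
    unfolding set_integrable_def * lborel_eq_dual_measure
    using integrable_dual_prod[of h "\<lambda>_. Line", OF h] by simp
qed

lemma closed_dual_factor: "closed (dual_factor F)"
proof (cases F)
  case (Circle L)
  have "range (\<lambda>k::int. of_int k / L) = (\<lambda>x. (1 / L) *\<^sub>R x) ` range of_int"
    by (auto simp: image_image)
  then show ?thesis
    using Circle closed_scaling[OF closed_of_int_image[of UNIV, where 'a = real], of "1 / L"]
    by (simp add: dual_factor_def)
qed (simp add: dual_factor_def)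

lemma closed_dual_group: "closed (dual_group \<Gamma>)"
proof -
  have "dual_group \<Gamma> = (\<Inter>i. (\<lambda>\<xi>. \<xi> $ i) -` dual_factor (\<Gamma> i))"
    by (auto simp: dual_group_def)
  also have "closed \<dots>"
    by (intro closed_INT ballI closed_vimage closed_dual_factor continuous_intros)
  finally show ?thesis .
qed

lemma dual_group_borel [measurable]: "dual_group \<Gamma> \<in> sets borel"
  by (simp add: closed_dual_group)

lemma AE_dual_group: "AE \<xi> in dual_measure \<Gamma>. \<xi> \<in> dual_group \<Gamma>"
proof -
  have "AE \<xi> in (\<Pi>\<^sub>M i\<in>UNIV. dual_factor_measure (\<Gamma> i)). (\<chi> i. \<xi> i) \<in> dual_group \<Gamma>"
    by (rule AE_I2) (auto simp: space_PiM space_dual_factor_measure dual_group_def PiE_iff)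
  then show ?thesis
    unfolding dual_measure_def by (subst AE_distr_iff) auto
qed

lemma uminus_dual_factor: "x \<in> dual_factor F \<Longrightarrow> - x \<in> dual_factor F"
proof (cases F)
  case (Circle L)
  have "- (of_int k / L) \<in> dual_factor F" for k
    using rangeI[of "\<lambda>k::int. of_int k / L" "- k"] Circle by (simp add: dual_factor_def)
  then show "x \<in> dual_factor F \<Longrightarrow> - x \<in> dual_factor F"
    using Circle by (auto simp: dual_factor_def)
qed (simp add: dual_factor_def)

lemma uminus_dual_group: "\<xi> \<in> dual_group \<Gamma> \<Longrightarrow> - \<xi> \<in> dual_group \<Gamma>"
  by (auto simp: dual_group_def uminus_dual_factor)

lemma emeasure_dual_factor_reflect:
  assumes "A \<in> sets (dual_factor_measure F)"
  shows "uminus -` A \<in> sets (dual_factor_measure F)"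
    and "emeasure (dual_factor_measure F) (uminus -` A) = emeasure (dual_factor_measure F) A"
proof -
  have "uminus -` A \<in> sets (dual_factor_measure F) \<and>
      emeasure (dual_factor_measure F) (uminus -` A) = emeasure (dual_factor_measure F) A"
  proof (cases F)
    case Line
    have [measurable]: "A \<in> sets borel" using assms Line by (simp add: dual_factor_measure_def)
    have "uminus -` A \<inter> space borel \<in> sets borel" by measurable
    moreover have "emeasure (distr lborel borel uminus) A = emeasure lborel (uminus -` A)"
      by (subst emeasure_distr) auto
    ultimately show ?thesis
      using lborel_distr_uminus by (auto simp: Line dual_factor_measure_def)
  next
    case (Circle L)
    then have A: "A \<subseteq> dual_factor F" using assms by (simp add: dual_factor_measure_def)
    then have "uminus -` A \<subseteq> dual_factor F"
      using uminus_dual_factor by (metis minus_minus subset_iff vimage_eq)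
    moreover have "bij_betw uminus (uminus -` A) A"
      by (rule bij_betwI[of _ _ _ uminus]) auto
    ultimately show ?thesis
      using A Circle by (auto simp: dual_factor_measure_def emeasure_count_space
          bij_betw_finite dest: bij_betw_same_card)
  qed
  then show "uminus -` A \<in> sets (dual_factor_measure F)"
    and "emeasure (dual_factor_measure F) (uminus -` A) = emeasure (dual_factor_measure F) A" by auto
qed

text \<open>
  The invariance under reflection is used to compare a distribution with its conjugate.
\<close>

lemma dual_measure_reflect: "distr (dual_measure \<Gamma>) borel uminus = dual_measure \<Gamma>"
proof -
  interpret product_sigma_finite "\<lambda>i. dual_factor_measure (\<Gamma> i)" by (rule product_sigma_finite_dual)
  define P where "P = (\<Pi>\<^sub>M i\<in>UNIV. dual_factor_measure (\<Gamma> i))"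
  let ?n = "\<lambda>x i. - x i :: real"
  have neg [measurable]: "?n \<in> measurable P P"
    unfolding P_def
  proof (rule measurable_PiM_single')
    show "(\<lambda>x. - x i) \<in> measurable (Pi\<^sub>M UNIV (\<lambda>i. dual_factor_measure (\<Gamma> i))) (dual_factor_measure (\<Gamma> i))" for i
    proof (rule measurable_compose[OF measurable_component_singleton])
      show "uminus \<in> measurable (dual_factor_measure (\<Gamma> i)) (dual_factor_measure (\<Gamma> i))"
      proof (rule measurableI)
        fix A assume "A \<in> sets (dual_factor_measure (\<Gamma> i))"
        then show "uminus -` A \<inter> space (dual_factor_measure (\<Gamma> i)) \<in> sets (dual_factor_measure (\<Gamma> i))"
          by (intro sets.Int emeasure_dual_factor_reflect) auto
      qed (auto simp: space_dual_factor_measure uminus_dual_factor)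
    qed simp
  qed (auto simp: space_PiM space_dual_factor_measure uminus_dual_factor PiE_iff)
  have "distr P P ?n = P"
    unfolding P_def
  proof (rule PiM_eqI)
    fix A assume A: "\<And>i. i \<in> UNIV \<Longrightarrow> A i \<in> sets (dual_factor_measure (\<Gamma> i))"
    have "?n -` Pi\<^sub>E UNIV A \<inter> space P = Pi\<^sub>E UNIV (\<lambda>i. uminus -` A i)"
      using A[THEN sets.sets_into_space] uminus_dual_factor
      by (fastforce simp: P_def space_PiM space_dual_factor_measure PiE_iff)
    moreover have "Pi\<^sub>E UNIV A \<in> sets P"
      unfolding P_def using A by (intro sets_PiM_I_finite) auto
    ultimately have "emeasure (distr P P ?n) (Pi\<^sub>E UNIV A) = emeasure P (Pi\<^sub>E UNIV (\<lambda>i. uminus -` A i))"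
      by (simp add: emeasure_distr[OF neg])
    also have "\<dots> = (\<Prod>i\<in>UNIV. emeasure (dual_factor_measure (\<Gamma> i)) (A i))"
      unfolding P_def using A by (simp add: emeasure_PiM emeasure_dual_factor_reflect)
    finally show "emeasure (distr (Pi\<^sub>M UNIV (\<lambda>i. dual_factor_measure (\<Gamma> i))) (Pi\<^sub>M UNIV (\<lambda>i. dual_factor_measure (\<Gamma> i))) ?n)
        (Pi\<^sub>E UNIV A) = (\<Prod>i\<in>UNIV. emeasure (dual_factor_measure (\<Gamma> i)) (A i))"
      unfolding P_def .
  qed auto
  then have "dual_measure \<Gamma> = distr (distr P P ?n) borel (\<lambda>\<xi>. \<chi> i. \<xi> i)"
    by (simp add: dual_measure_def P_def)
  also have "\<dots> = distr P borel (\<lambda>\<xi>. - (\<chi> i. \<xi> i))"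
    unfolding P_def[symmetric] by (subst distr_distr)
      (use neg in \<open>auto simp: P_def o_def vec_eq_iff intro!: distr_cong arg_cong[where f = vec_lambda]\<close>)
  also have "\<dots> = distr (dual_measure \<Gamma>) borel uminus"
    unfolding dual_measure_def P_def[symmetric] by (subst distr_distr) (auto simp: P_def o_def)
  finally show ?thesis ..
qed

lemma AE_dual_reflect: "AE \<xi> in dual_measure \<Gamma>. P \<xi> \<Longrightarrow> AE \<xi> in dual_measure \<Gamma>. P (- \<xi>)"
proof (rule AE_distrD[of uminus "dual_measure \<Gamma>" borel P])
  assume "AE \<xi> in dual_measure \<Gamma>. P \<xi>"
  then show "AE \<xi> in distr (dual_measure \<Gamma>) borel uminus. P \<xi>"
    by (subst dual_measure_reflect)
qed simp

lemma integral_dual_reflect: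
  fixes h :: "real ^ 'n::finite \<Rightarrow> 'a::{banach, second_countable_topology}"
  assumes "h \<in> borel_measurable borel"
  shows "(LINT \<xi>|dual_measure \<Gamma>. h (- \<xi>)) = (LINT \<xi>|dual_measure \<Gamma>. h \<xi>)"
  using integral_distr[of uminus "dual_measure \<Gamma>" borel h] assms by (simp add: dual_measure_reflect)

text \<open>Only finitely many points of a lattice lie in a bounded interval.\<close>

lemma emeasure_dual_bounded_finite:
  fixes b :: real
  assumes "admissible \<Gamma>"
  shows "emeasure (dual_measure \<Gamma>) (cball 0 b) < \<infinity>"
proof -
  have fin: "emeasure (dual_factor_measure (\<Gamma> i)) ({-b..b} \<inter> dual_factor (\<Gamma> i)) < \<infinity>" for i
  proof (cases "\<Gamma> i")
    case Line
    then show ?thesis by (cases "b \<ge> 0") (auto simp: dual_factor_measure_def dual_factor_def)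
  next
    case (Circle L)
    then have L: "L > 0" using assms by (auto simp: admissible_def)
    have "{-b..b} \<inter> dual_factor (\<Gamma> i) \<subseteq> (\<lambda>k::int. of_int k / L) ` {\<lfloor>- b * L\<rfloor>..\<lceil>b * L\<rceil>}"
    proof
      fix x assume "x \<in> {-b..b} \<inter> dual_factor (\<Gamma> i)"
      then obtain k :: int where k: "x = of_int k / L" "-b \<le> x" "x \<le> b"
        using Circle by (auto simp: dual_factor_def)
      then have "- b * L \<le> of_int k" "of_int k \<le> b * L"
        using L by (simp_all only: pos_le_divide_eq pos_divide_le_eq)
      then show "x \<in> (\<lambda>k::int. of_int k / L) ` {\<lfloor>- b * L\<rfloor>..\<lceil>b * L\<rceil>}"
        using k by (auto simp: floor_le_iff le_ceiling_iff)
    qed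
    then have "finite ({-b..b} \<inter> dual_factor (\<Gamma> i))" by (rule finite_subset) auto
    then show ?thesis by (simp add: Circle dual_factor_measure_def emeasure_count_space_finite of_nat_less_top)
  qed
  have "emeasure (dual_measure \<Gamma>) (cball 0 b) \<le> emeasure (dual_measure \<Gamma>) {\<xi>. \<forall>i. \<xi> $ i \<in> {-b..b}}"
  proof (rule emeasure_mono)
    show "cball 0 b \<subseteq> {\<xi>::real^'a. \<forall>i. \<xi> $ i \<in> {-b..b}}"
    proof safe
      fix x :: "real^'a" and i assume "x \<in> cball 0 b"
      then have "\<bar>x $ i\<bar> \<le> b" using component_le_norm_cart[of x i] by simp
      then show "x $ i \<in> {-b..b}" by auto
    qed
    have "{\<xi>::real^'a. \<forall>i. \<xi> $ i \<in> {-b..b}} = cbox (\<chi> i. -b) (\<chi> i. b)"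
      by (auto simp: mem_box_cart)
    then show "{\<xi>. \<forall>i. \<xi> $ i \<in> {-b..b}} \<in> sets (dual_measure \<Gamma>)" by simp
  qed
  also have "\<dots> < \<infinity>"
    using fin by (subst emeasure_dual_measure_box) (auto simp: less_top[symmetric] ennreal_prod_eq_top)
  finally show ?thesis .
qed


section \<open>Integration by parts\<close>

lemma integral_deriv_line:
  fixes F F' :: "real \<Rightarrow> complex"
  assumes deriv: "\<And>t. (F has_vector_derivative F' t) (at t)" and cont: "continuous_on UNIV F'"
    and lim: "(F \<longlongrightarrow> 0) at_top" "(F \<longlongrightarrow> 0) at_bot"
  shows "(LINT t|lborel. F' t) = 0"
proof (cases "integrable lborel F'")
  case True
  have "(\<lambda>n::nat. LINT t|lborel. indicator {- real n..real n} t *\<^sub>R F' t) \<longlonglongrightarrow> (LINT t|lborel. F' t)"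
  proof (rule integral_dominated_convergence[where w = "\<lambda>t. norm (F' t)"])
    show "AE t in lborel. (\<lambda>n. indicator {- real n..real n} t *\<^sub>R F' t) \<longlonglongrightarrow> F' t"
    proof (rule AE_I2, rule tendsto_eventually)
      fix t :: real
      have "\<forall>\<^sub>F n in sequentially. real n \<ge> \<bar>t\<bar>" by real_asymp
      then show "\<forall>\<^sub>F n in sequentially. indicator {- real n..real n} t *\<^sub>R F' t = F' t"
        by eventually_elim (auto simp: indicator_def abs_le_iff)
    qed
  qed (use True in \<open>auto simp: indicator_def intro!: AE_I2\<close>)
  moreover have "(LINT t|lborel. indicator {- real n..real n} t *\<^sub>R F' t) = F (real n) - F (- real n)" for n
    using deriv cont by (intro integral_FTC_Icc)
      (auto intro: has_vector_derivative_at_within continuous_on_subset)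
  moreover have "(\<lambda>n. F (real n) - F (- real n)) \<longlonglongrightarrow> 0 - 0"
    by (intro tendsto_diff filterlim_compose[OF lim(1)] filterlim_compose[OF lim(2)]) real_asymp+
  ultimately show ?thesis by (simp add: LIMSEQ_unique)
  \<comment> \<open>A function that is not integrable has integral \<open>0\<close> by convention.\<close>
qed (simp add: not_integrable_integral_eq)

lemma integral_deriv_circle:
  fixes F F' :: "real \<Rightarrow> complex"
  assumes deriv: "\<And>t. (F has_vector_derivative F' t) (at t)" and cont: "continuous_on UNIV F'"
    and "F L = F 0" "L > 0"
  shows "(LINT t|lborel. indicator {0..<L} t *\<^sub>R F' t) = 0"
proof -
  have [measurable]: "F' \<in> borel_measurable borel"
    using cont by (rule borel_measurable_continuous_onI)
  have "(LINT t|lborel. indicator {0..<L} t *\<^sub>R F' t) = (LINT t|lborel. indicator {0..L} t *\<^sub>R F' t)"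
  proof (rule integral_cong_AE)
    show "AE t in lborel. indicator {0..<L} t *\<^sub>R F' t = indicator {0..L} t *\<^sub>R F' t"
      using AE_lborel_singleton[of L] by eventually_elim (auto simp: indicator_def)
  qed auto
  also have "\<dots> = F L - F 0"
    using deriv cont assms(4) by (intro integral_FTC_Icc)
      (auto intro: has_vector_derivative_at_within continuous_on_subset)
  finally show ?thesis using assms(3) by simp
qed

lemma has_vector_derivative_shift:
  fixes x e :: "'a::real_normed_vector"
  assumes "((\<lambda>u. f (x + t *\<^sub>R e + u *\<^sub>R e)) has_vector_derivative d) (at 0)"
  shows "((\<lambda>t. f (x + t *\<^sub>R e)) has_vector_derivative d) (at t)"
proof -
  have "((\<lambda>u. f (x + t *\<^sub>R e + u *\<^sub>R e)) has_vector_derivative d) (at (t - t))"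
    using assms by simp
  moreover have "((\<lambda>u. u - t) has_vector_derivative 1) (at t)"
    by (auto intro!: derivative_eq_intros)
  ultimately have "((\<lambda>u. f (x + t *\<^sub>R e + u *\<^sub>R e)) \<circ> (\<lambda>u. u - t) has_vector_derivative 1 *\<^sub>R d) (at t)"
    by (intro vector_diff_chain_at)
  moreover have "x + t *\<^sub>R e + (u - t) *\<^sub>R e = x + u *\<^sub>R e" for u
    by (simp add: scaleR_left_diff_distrib)
  ultimately show ?thesis by (simp add: o_def)
qed

text \<open>
  Integration by parts in several variables is Fubini's theorem with the innermost integral taken in
  the direction of differentiation.
\<close>

lemma (in product_sigma_finite) integral_zero_if_coordinate_integral_zero:
  fixes G :: "_ \<Rightarrow> 'b::{banach, second_countable_topology}"
  assumes "finite I" "i \<in> I" "integrable (Pi\<^sub>M I M) G"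
    and "\<And>x. x \<in> space (Pi\<^sub>M (I - {i}) M) \<Longrightarrow> (LINT t|M i. G (x(i := t))) = 0"
  shows "integral\<^sup>L (Pi\<^sub>M I M) G = 0"
proof -
  have I: "insert i (I - {i}) = I" using assms by auto
  have "integral\<^sup>L (Pi\<^sub>M I M) G = (LINT x|Pi\<^sub>M (I - {i}) M. LINT t|M i. G (x(i := t)))"
    using product_integral_insert[of "I - {i}" i G] assms I by simp
  also have "\<dots> = (LINT x|Pi\<^sub>M (I - {i}) M. 0)"
    by (intro Bochner_Integration.integral_cong refl) (use assms(4) in auto)
  finally show ?thesis by simp
qed

lemma vec_lambda_upd: "(\<chi> k. (y(i := t)) k) = (\<chi> k. (y(i := 0)) k) + t *\<^sub>R axis i (1::real)"
  by (simp add: vec_eq_iff axis_def)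

lemma dual_integral_partial_deriv:
  fixes G G' :: "real ^ 'n::finite \<Rightarrow> complex"
  assumes i: "i \<in> line_indices \<Gamma>" and int: "integrable (dual_measure \<Gamma>) G'"
    and deriv: "\<And>\<xi>. \<xi> \<in> dual_group \<Gamma> \<Longrightarrow> ((\<lambda>t. G (\<xi> + t *\<^sub>R axis i 1)) has_vector_derivative G' \<xi>) (at 0)"
    and cont: "continuous_on (dual_group \<Gamma>) G'"
    and lim: "\<And>\<xi>. \<xi> \<in> dual_group \<Gamma> \<Longrightarrow> ((\<lambda>t. G (\<xi> + t *\<^sub>R axis i 1)) \<longlongrightarrow> 0) at_top"
      "\<And>\<xi>. \<xi> \<in> dual_group \<Gamma> \<Longrightarrow> ((\<lambda>t. G (\<xi> + t *\<^sub>R axis i 1)) \<longlongrightarrow> 0) at_bot"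
  shows "(LINT \<xi>|dual_measure \<Gamma>. G' \<xi>) = 0"
proof -
  interpret product_sigma_finite "\<lambda>i. dual_factor_measure (\<Gamma> i)" by (rule product_sigma_finite_dual)
  let ?v = "\<lambda>\<xi>::'n \<Rightarrow> real. (\<chi> i. \<xi> i) :: real ^ 'n"
  have [measurable]: "G' \<in> borel_measurable borel"
    using borel_measurable_integrable[OF int] by simp
  have tc: "\<xi> + t *\<^sub>R axis i 1 \<in> dual_group \<Gamma>" if "\<xi> \<in> dual_group \<Gamma>" for \<xi> t
    using translation_closed_dual_group[of \<Gamma>] i that by (simp add: translation_closed_def)
  have "integral\<^sup>L (Pi\<^sub>M UNIV (\<lambda>i. dual_factor_measure (\<Gamma> i))) (\<lambda>x. G' (?v x)) = 0"
  proof (rule integral_zero_if_coordinate_integral_zero)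
    show "integrable (Pi\<^sub>M UNIV (\<lambda>i. dual_factor_measure (\<Gamma> i))) (\<lambda>x. G' (?v x))"
      using int unfolding dual_measure_def by (rule integrable_distr[OF chi_measurable])
    fix y assume y: "y \<in> space (Pi\<^sub>M (UNIV - {i}) (\<lambda>i. dual_factor_measure (\<Gamma> i)))"
    define x where "x = ?v (y(i := 0))"
    have x: "?v (y(i := t)) = x + t *\<^sub>R axis i 1" for t
      unfolding x_def by (rule vec_lambda_upd)
    have v: "x \<in> dual_group \<Gamma>"
      using y i by (auto simp: x_def dual_group_def space_PiM space_dual_factor_measure PiE_iff
          line_indices_def dual_factor_def)
    have "(LINT t|lborel. G' (x + t *\<^sub>R axis i 1)) = 0"
    proof (rule integral_deriv_line)
      show "((\<lambda>t. G (x + t *\<^sub>R axis i 1)) has_vector_derivative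
          G' (x + t *\<^sub>R axis i 1)) (at t)" for t
        by (rule has_vector_derivative_shift, intro deriv tc v)
      show "continuous_on UNIV (\<lambda>t. G' (x + t *\<^sub>R axis i 1))"
        using tc[OF v] by (intro continuous_on_compose2[OF cont]) (auto intro!: continuous_intros)
    qed (intro lim v)+
    then show "(LINT t|dual_factor_measure (\<Gamma> i). G' (?v (y(i := t)))) = 0"
      using i unfolding x by (simp add: line_indices_def dual_factor_measure_def)
  qed auto
  then show ?thesis
    unfolding dual_measure_def by (subst integral_distr) auto
qed

text \<open>
  In a line direction the boundary terms vanish in the limit; in a circle direction the values at the two
  ends of the cell cancel by periodicity.
\<close>

lemma cell_integral_partial_deriv:
  fixes G G' :: "real ^ 'n::finite \<Rightarrow> complex"
  assumes "admissible \<Gamma>" and int: "set_integrable lborel (fundamental_cell \<Gamma>) G'"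
    and deriv: "\<And>x. ((\<lambda>t. G (x + t *\<^sub>R axis i 1)) has_vector_derivative G' x) (at 0)"
    and cont: "continuous_on UNIV G'"
    and lim: "\<And>x. \<Gamma> i = Line \<Longrightarrow> ((\<lambda>t. G (x + t *\<^sub>R axis i 1)) \<longlongrightarrow> 0) at_top"
      "\<And>x. \<Gamma> i = Line \<Longrightarrow> ((\<lambda>t. G (x + t *\<^sub>R axis i 1)) \<longlongrightarrow> 0) at_bot"
    and per: "\<And>L x. \<Gamma> i = Circle L \<Longrightarrow> G (x + L *\<^sub>R axis i 1) = G x"
  shows "(LINT x:fundamental_cell \<Gamma>|lborel. G' x) = 0"
proof -
  interpret product_sigma_finite "\<lambda>_::'n. lborel :: real measure"
    by (simp add: product_sigma_finite_def lborel.sigma_finite_measure_axioms)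
  let ?v = "\<lambda>\<xi>::'n \<Rightarrow> real. (\<chi> i. \<xi> i) :: real ^ 'n"
  define H where "H x = indicator (fundamental_cell \<Gamma>) x *\<^sub>R G' x" for x
  have [measurable]: "G' \<in> borel_measurable borel"
    using cont by (rule borel_measurable_continuous_onI)
  have [measurable]: "H \<in> borel_measurable borel"
    unfolding H_def by measurable
  have P: "(lborel :: (real ^ 'n) measure) = distr (Pi\<^sub>M UNIV (\<lambda>_. lborel)) borel ?v"
    by (subst lborel_eq_dual_measure) (simp add: dual_measure_def dual_factor_measure_def)
  have v: "?v \<in> measurable (Pi\<^sub>M UNIV (\<lambda>_. lborel)) borel"
    using chi_measurable[of "\<lambda>_. Line"] by (simp add: dual_factor_measure_def)
  have "integral\<^sup>L (Pi\<^sub>M UNIV (\<lambda>_. lborel)) (\<lambda>x. H (?v x)) = 0"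
  proof (rule integral_zero_if_coordinate_integral_zero)
    have "integrable (distr (Pi\<^sub>M UNIV (\<lambda>_. lborel)) borel ?v) H"
      using int unfolding set_integrable_def H_def P[symmetric] .
    then show "integrable (Pi\<^sub>M UNIV (\<lambda>_. lborel)) (\<lambda>x. H (?v x))"
      by (rule integrable_distr[OF v])
    fix y :: "'n \<Rightarrow> real"
    define c where "c = (\<Prod>k\<in>UNIV - {i}. indicator (cell_factor (\<Gamma> k)) (y k) :: real)"
    define x where "x = ?v (y(i := 0))"
    have x: "?v (y(i := t)) = x + t *\<^sub>R axis i 1" for t
      unfolding x_def by (rule vec_lambda_upd)
    have ind: "indicator (fundamental_cell \<Gamma>) (?v (y(i := t))) = c * indicator (cell_factor (\<Gamma> i)) t" for t
      unfolding indicator_fundamental_cell c_def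
      by (subst prod.remove[of _ i]) (auto intro!: prod.cong)
    have d: "((\<lambda>t. G (x + t *\<^sub>R axis i 1)) has_vector_derivative G' (x + t *\<^sub>R axis i 1)) (at t)" for t
      by (rule has_vector_derivative_shift, rule deriv)
    have co: "continuous_on UNIV (\<lambda>t. G' (x + t *\<^sub>R axis i 1))"
      by (intro continuous_on_compose2[OF cont]) (auto intro!: continuous_intros)
    have "(LINT t|lborel. indicator (cell_factor (\<Gamma> i)) t *\<^sub>R G' (x + t *\<^sub>R axis i 1)) = 0"
    proof (cases "\<Gamma> i")
      case Line
      with integral_deriv_line[OF d co lim] show ?thesis by (simp add: cell_factor_def)
    next
      case (Circle L)
      with assms have "L > 0" by (auto simp: admissible_def)
      with Circle integral_deriv_circle[OF d co] per[OF Circle, of x] show ?thesis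
        by (simp add: cell_factor_def)
    qed
    then have "(LINT t|lborel. c *\<^sub>R (indicator (cell_factor (\<Gamma> i)) t *\<^sub>R G' (x + t *\<^sub>R axis i 1))) = 0"
      by (simp only: integral_scaleR_right scaleR_zero_right)
    then show "(LINT t|lborel. H (?v (y(i := t)))) = 0"
      unfolding H_def x ind[unfolded x] by (simp only: scaleR_scaleR)
  qed auto
  then show ?thesis
    unfolding set_lebesgue_integral_def H_def[symmetric]
    by (subst P, subst integral_distr[OF v]) auto
qed


section \<open>Test functions on the dual group and their Fourier transforms\<close>

text \<open>
  A test function may take arbitrary, even non-measurable, values off the dual group.  Most of the
  argument is therefore carried out for test functions that vanish there.
\<close>

definition null_extended_tests :: "('n::finite \<Rightarrow> factor) \<Rightarrow> (real ^ 'n \<Rightarrow> complex) set" where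
  "null_extended_tests \<Gamma> = {\<phi> \<in> dual_test_functions \<Gamma>. \<forall>\<xi>. \<xi> \<notin> dual_group \<Gamma> \<longrightarrow> \<phi> \<xi> = 0}"

lemma null_extended_tests_iff:
  "\<phi> \<in> null_extended_tests \<Gamma> \<longleftrightarrow> smooth_along (line_indices \<Gamma>) (dual_group \<Gamma>) \<phi> \<and>
     (\<forall>\<xi>. \<xi> \<notin> dual_group \<Gamma> \<longrightarrow> \<phi> \<xi> = 0) \<and> (\<exists>b>0. \<forall>\<xi>. norm \<xi> > b \<longrightarrow> \<phi> \<xi> = 0)"
proof -
  have "(\<exists>K. compact K \<and> (\<forall>\<xi>\<in>dual_group \<Gamma> - K. \<phi> \<xi> = 0)) \<longleftrightarrow> (\<exists>b>0. \<forall>\<xi>. norm \<xi> > b \<longrightarrow> \<phi> \<xi> = 0)"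
    if *: "\<forall>\<xi>. \<xi> \<notin> dual_group \<Gamma> \<longrightarrow> \<phi> \<xi> = 0"
  proof safe
    fix K assume K: "compact K" "\<forall>\<xi>\<in>dual_group \<Gamma> - K. \<phi> \<xi> = 0"
    then obtain b where "b > 0" "\<forall>x\<in>K. norm x \<le> b"
      using compact_imp_bounded[OF K(1)] unfolding bounded_pos by blast
    with K * show "\<exists>b>0. \<forall>\<xi>. norm \<xi> > b \<longrightarrow> \<phi> \<xi> = 0"
      by (metis Diff_iff linorder_not_less)
  next
    fix b :: real assume "\<forall>\<xi>. norm \<xi> > b \<longrightarrow> \<phi> \<xi> = 0"
    then show "\<exists>K. compact K \<and> (\<forall>\<xi>\<in>dual_group \<Gamma> - K. \<phi> \<xi> = 0)"
      by (intro exI[of _ "cball 0 b"]) auto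
  qed
  then show ?thesis
    unfolding null_extended_tests_def dual_test_functions_def by blast
qed

lemma null_extension_in_tests:
  assumes "\<phi> \<in> dual_test_functions \<Gamma>"
  shows "(\<lambda>\<xi>. indicator (dual_group \<Gamma>) \<xi> * \<phi> \<xi>) \<in> null_extended_tests \<Gamma>"
proof -
  have "smooth_along (line_indices \<Gamma>) (dual_group \<Gamma>) (\<lambda>\<xi>. indicator (dual_group \<Gamma>) \<xi> * \<phi> \<xi>)"
    by (rule smooth_along_cong[OF translation_closed_dual_group, of _ \<phi>])
      (use assms in \<open>auto simp: dual_test_functions_def\<close>)
  then show ?thesis
    using assms by (auto simp: null_extended_tests_def dual_test_functions_def)
qed

lemma test_borel [measurable_dest]:
  assumes "\<phi> \<in> null_extended_tests \<Gamma>"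
  shows "\<phi> \<in> borel_measurable borel"
proof -
  have "continuous_on (dual_group \<Gamma>) \<phi>"
    using assms smooth_along_continuous by (auto simp: null_extended_tests_iff)
  then have "(\<lambda>\<xi>. indicator (dual_group \<Gamma>) \<xi> *\<^sub>R \<phi> \<xi>) \<in> borel_measurable borel"
    by (rule borel_measurable_continuous_on_indicator[OF dual_group_borel])
  also have "(\<lambda>\<xi>. indicator (dual_group \<Gamma>) \<xi> *\<^sub>R \<phi> \<xi>) = \<phi>"
    using assms by (auto simp: null_extended_tests_iff indicator_def)
  finally show ?thesis .
qed

lemma test_bounded:
  assumes "\<phi> \<in> null_extended_tests \<Gamma>"
  obtains B where "\<And>\<xi>. norm (\<phi> \<xi>) \<le> B" "B > 0"
proof -
  obtain b where b: "\<forall>\<xi>. norm \<xi> > b \<longrightarrow> \<phi> \<xi> = 0"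
    using assms by (auto simp: null_extended_tests_iff)
  have "continuous_on (dual_group \<Gamma>) \<phi>"
    using assms smooth_along_continuous by (auto simp: null_extended_tests_iff)
  then have "compact (\<phi> ` (dual_group \<Gamma> \<inter> cball 0 b))"
    by (intro compact_continuous_image closed_Int_compact closed_dual_group)
      (auto intro: continuous_on_subset)
  then have "bounded (\<phi> ` (dual_group \<Gamma> \<inter> cball 0 b))" by (rule compact_imp_bounded)
  then obtain B where B: "B > 0" "\<forall>x\<in>\<phi> ` (dual_group \<Gamma> \<inter> cball 0 b). norm x \<le> B"
    unfolding bounded_pos by blast
  have "norm (\<phi> \<xi>) \<le> B" for \<xi>
  proof (cases "\<xi> \<in> dual_group \<Gamma> \<inter> cball 0 b")
    case False
    then have "\<phi> \<xi> = 0" using assms b by (auto simp: null_extended_tests_iff)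
    then show ?thesis using B by simp
  qed (use B in auto)
  with B that show ?thesis by blast
qed

lemma integrable_bounded_support:
  fixes f :: "real ^ 'n::finite \<Rightarrow> 'a::{banach, second_countable_topology}"
  assumes "admissible \<Gamma>" "f \<in> borel_measurable borel" "\<And>\<xi>. norm (f \<xi>) \<le> B" "\<And>\<xi>. norm \<xi> > b \<Longrightarrow> f \<xi> = 0"
  shows "integrable (dual_measure \<Gamma>) f"
proof (rule Bochner_Integration.integrable_bound[where f = "\<lambda>\<xi>. indicator (cball 0 b) \<xi> * B"])
  show "integrable (dual_measure \<Gamma>) (\<lambda>\<xi>. indicator (cball 0 b) \<xi> * B)"
    using emeasure_dual_bounded_finite[OF assms(1)] by (simp add: integrable_indicator_iff)
  show "AE \<xi> in dual_measure \<Gamma>. norm (f \<xi>) \<le> norm (indicator (cball 0 b) \<xi> * B)"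
  proof (rule AE_I2)
    fix \<xi>
    show "norm (f \<xi>) \<le> norm (indicator (cball 0 b) \<xi> * B)"
      using assms(3)[of \<xi>] assms(4)[of \<xi>] by (cases "norm \<xi> > b") auto
  qed
qed (use assms in simp)

lemma test_integrable:
  assumes "admissible \<Gamma>" "\<phi> \<in> null_extended_tests \<Gamma>"
  shows "integrable (dual_measure \<Gamma>) \<phi>"
proof -
  obtain B where B: "\<And>\<xi>. norm (\<phi> \<xi>) \<le> B" using test_bounded[OF assms(2)] by blast
  obtain b where b: "\<And>\<xi>. norm \<xi> > b \<Longrightarrow> \<phi> \<xi> = 0" using assms(2) by (auto simp: null_extended_tests_iff)
  show ?thesis
    by (rule integrable_bounded_support[OF assms(1) test_borel[OF assms(2)] B b])
qed

lemma test_mult: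
  assumes "\<phi> \<in> null_extended_tests \<Gamma>" "\<And>k. smooth_upto k (line_indices \<Gamma>) (dual_group \<Gamma>) f"
  shows "(\<lambda>\<xi>. f \<xi> * \<phi> \<xi>) \<in> null_extended_tests \<Gamma>"
proof -
  have "smooth_along (line_indices \<Gamma>) (dual_group \<Gamma>) (\<lambda>\<xi>. f \<xi> * \<phi> \<xi>)"
    using assms unfolding null_extended_tests_iff smooth_along_iff
    by (auto intro: smooth_upto_mult[OF translation_closed_dual_group])
  then show ?thesis using assms(1) unfolding null_extended_tests_iff by auto
qed

lemma test_cmult: "\<phi> \<in> null_extended_tests \<Gamma> \<Longrightarrow> (\<lambda>\<xi>. c * \<phi> \<xi>) \<in> null_extended_tests \<Gamma>"
  by (rule test_mult) simp_all

lemma test_mult_coordinate: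
  "\<phi> \<in> null_extended_tests \<Gamma> \<Longrightarrow> (\<lambda>\<xi>. of_real (\<xi> $ l) * \<phi> \<xi>) \<in> null_extended_tests \<Gamma>"
  by (intro test_mult smooth_upto_coordinate translation_closed_dual_group)

lemma test_cnj_reflect:
  assumes "\<phi> \<in> null_extended_tests \<Gamma>"
  shows "(\<lambda>\<xi>. cnj (\<phi> (- \<xi>))) \<in> null_extended_tests \<Gamma>"
proof -
  have "smooth_along (line_indices \<Gamma>) (dual_group \<Gamma>) (\<lambda>\<xi>. cnj (\<phi> (- \<xi>)))"
    using assms uminus_dual_group[of _ \<Gamma>] unfolding null_extended_tests_iff smooth_along_iff
    by (auto intro!: smooth_upto_cnj smooth_upto_reflect[where f = \<phi>] translation_closed_dual_group)
  moreover have "- \<xi> \<notin> dual_group \<Gamma>" if "\<xi> \<notin> dual_group \<Gamma>" for \<xi>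
    using that uminus_dual_group[of "- \<xi>" \<Gamma>] by auto
  moreover obtain b where "b > 0" "\<forall>\<xi>. norm \<xi> > b \<longrightarrow> \<phi> \<xi> = 0"
    using assms by (auto simp: null_extended_tests_iff)
  moreover from this have "\<forall>\<xi>. norm \<xi> > b \<longrightarrow> cnj (\<phi> (- \<xi>)) = 0" by simp
  ultimately show ?thesis
    using assms by (auto simp: null_extended_tests_iff)
qed

lemma test_partial_deriv:
  assumes "\<phi> \<in> null_extended_tests \<Gamma>" "i \<in> line_indices \<Gamma>"
  shows "partial_deriv i \<phi> \<in> null_extended_tests \<Gamma>"
proof -
  have "smooth_along (line_indices \<Gamma>) (dual_group \<Gamma>) (partial_deriv i \<phi>)"
    using assms by (auto simp: null_extended_tests_iff intro: smooth_along_partial_deriv)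
  moreover have "partial_deriv i \<phi> \<xi> = 0" if "\<xi> \<notin> dual_group \<Gamma>" for \<xi>
  proof -
    have "\<xi> + t *\<^sub>R axis i 1 \<notin> dual_group \<Gamma>" for t
      using that translation_closed_dual_group[of \<Gamma>] assms(2)
      unfolding translation_closed_def
      by (auto dest!: bspec[of _ _ i] bspec[of "dual_group \<Gamma>" _ "\<xi> + t *\<^sub>R axis i 1"] spec[of _ "- t"])
    then have "(\<lambda>t. \<phi> (\<xi> + t *\<^sub>R axis i 1)) = (\<lambda>_. 0)"
      using assms(1) by (auto simp: null_extended_tests_iff)
    then show ?thesis by (simp add: partial_deriv_def)
  qed
  moreover have "partial_deriv i \<phi> \<xi> = 0" if b: "\<forall>\<xi>. norm \<xi> > b \<longrightarrow> \<phi> \<xi> = 0" "norm \<xi> > b" for b \<xi>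
  proof (rule partial_deriv_eqI)
    have "((\<lambda>t. norm (\<xi> + t *\<^sub>R axis i 1)) \<longlongrightarrow> norm (\<xi> + 0 *\<^sub>R axis i 1)) (nhds 0)"
      by (intro tendsto_intros filterlim_ident)
    then have "\<forall>\<^sub>F t in nhds 0. norm (\<xi> + t *\<^sub>R axis i 1) > b"
      by (rule order_tendstoD) (use b in simp)
    then have "\<forall>\<^sub>F t in nhds 0. \<phi> (\<xi> + t *\<^sub>R axis i 1) = 0"
      by eventually_elim (use b in auto)
    then show "((\<lambda>t. \<phi> (\<xi> + t *\<^sub>R axis i 1)) has_vector_derivative 0) (at 0)"
      using has_vector_derivative_const[of 0 "at (0::real)"]
      by (subst has_vector_derivative_cong_ev[where g = "\<lambda>_. 0"]) (auto simp: eventually_mono b)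
  qed
  ultimately show ?thesis
    using assms(1) unfolding null_extended_tests_iff by fast
qed


lemma norm_cis_diff_le: "norm (cis a - cis b) \<le> \<bar>a - b\<bar>"
proof -
  have "cis a - cis b = cis b * (cis (a - b) - 1)"
    by (simp add: algebra_simps cis_mult)
  moreover have "norm (cis (a - b) - 1) \<le> \<bar>a - b\<bar>"
    using iexp_approx1[of "a - b" 0] by (simp add: cis_conv_exp)
  ultimately show ?thesis by (simp add: norm_mult)
qed

text \<open>
  This bound is uniform in \<open>a\<close>, which makes it possible to differentiate under the integral sign without
  a limit argument: the remainder integrates to \<open>O(t\<^sup>2)\<close>.
\<close>

lemma norm_cis_taylor: "norm (cis (a + b) - cis a - \<i> * of_real b * cis a) \<le> b\<^sup>2"
proof -
  have "cis (a + b) - cis a - \<i> * of_real b * cis a = cis a * (cis b - 1 - \<i> * of_real b)"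
    by (simp add: algebra_simps cis_mult)
  moreover have "norm (cis b - 1 - \<i> * of_real b) \<le> b\<^sup>2 / 2"
    using iexp_approx1[of b 1] by (simp add: cis_conv_exp power2_eq_square algebra_simps)
  ultimately have "norm (cis (a + b) - cis a - \<i> * of_real b * cis a) \<le> b\<^sup>2 / 2"
    by (simp add: norm_mult)
  also have "\<dots> \<le> b\<^sup>2" by simp
  finally show ?thesis .
qed

lemma has_vector_derivative_quadratic_error:
  fixes f :: "real \<Rightarrow> 'a::real_normed_vector"
  assumes "\<And>t. norm (f t - f 0 - t *\<^sub>R d) \<le> C * t\<^sup>2"
  shows "(f has_vector_derivative d) (at 0)"
  unfolding has_vector_derivative_def has_derivative_at
proof (intro conjI bounded_linear_scaleR_left)
  show "(\<lambda>h. norm (f (0 + h) - f 0 - h *\<^sub>R d) / norm h) \<midarrow>0\<rightarrow> 0"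
  proof (rule tendsto_sandwich[of "\<lambda>_. 0" _ _ "\<lambda>h. C * \<bar>h\<bar>"])
    show "\<forall>\<^sub>F h in at 0. norm (f (0 + h) - f 0 - h *\<^sub>R d) / norm h \<le> C * \<bar>h\<bar>"
    proof (rule eventually_at_filter[THEN iffD2], rule always_eventually, intro allI impI)
      fix h :: real assume "h \<noteq> 0"
      then show "norm (f (0 + h) - f 0 - h *\<^sub>R d) / norm h \<le> C * \<bar>h\<bar>"
        using assms[of h] by (simp add: divide_le_eq power2_eq_square mult.assoc)
    qed
    show "(\<lambda>h. C * \<bar>h\<bar>) \<midarrow>0\<rightarrow> 0" by (auto intro!: tendsto_eq_intros)
  qed auto
qed

lemma has_vector_derivative_character:
  "((\<lambda>t. cis (- 2 * pi * ((\<xi> + t *\<^sub>R axis i 1) \<bullet> x))) has_vector_derivative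
     - (2 * pi * \<i> * of_real (x $ i)) * cis (- 2 * pi * (\<xi> \<bullet> x))) (at 0)"
proof (rule has_vector_derivative_quadratic_error)
  fix t :: real
  define a b where "a = - 2 * pi * (\<xi> \<bullet> x)" and "b = - 2 * pi * (x $ i) * t"
  have "- 2 * pi * ((\<xi> + t *\<^sub>R axis i 1) \<bullet> x) = a + b" "- 2 * pi * ((\<xi> + 0 *\<^sub>R axis i 1) \<bullet> x) = a"
    by (simp_all add: a_def b_def inner_add_left inner_axis' algebra_simps)
  moreover have "t *\<^sub>R (- (2 * pi * \<i> * of_real (x $ i)) * cis (- 2 * pi * (\<xi> \<bullet> x))) = \<i> * of_real b * cis a"
    by (simp add: a_def b_def scaleR_conv_of_real)
  moreover have "b\<^sup>2 = (2 * pi * x $ i)\<^sup>2 * t\<^sup>2"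
    by (simp add: b_def power_mult_distrib)
  ultimately show "norm (cis (- 2 * pi * ((\<xi> + t *\<^sub>R axis i 1) \<bullet> x)) - cis (- 2 * pi * ((\<xi> + 0 *\<^sub>R axis i 1) \<bullet> x))
      - t *\<^sub>R (- (2 * pi * \<i> * of_real (x $ i)) * cis (- 2 * pi * (\<xi> \<bullet> x)))) \<le> (2 * pi * x $ i)\<^sup>2 * t\<^sup>2"
    using norm_cis_taylor[of a b] by simp
qed

lemma character_periodic:
  assumes "admissible \<Gamma>" "\<xi> \<in> dual_group \<Gamma>" "\<Gamma> i = Circle L"
  shows "cis (- 2 * pi * (\<xi> \<bullet> (x + L *\<^sub>R axis i 1))) = cis (- 2 * pi * (\<xi> \<bullet> x))"
proof -
  have "L > 0" using assms by (auto simp: admissible_def)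
  moreover have "\<xi> $ i \<in> dual_factor (\<Gamma> i)" using assms(2) by (simp add: dual_group_def)
  ultimately obtain k :: int where "\<xi> $ i * L = of_int k"
    using assms(3) by (auto simp: dual_factor_def)
  then have "- 2 * pi * (\<xi> \<bullet> (x + L *\<^sub>R axis i 1)) = - 2 * pi * (\<xi> \<bullet> x) + 2 * pi * of_int (- k)"
    by (simp add: inner_add_right inner_axis algebra_simps)
  moreover have "cis (2 * pi * of_int (- k)) = 1" by (rule cis_multiple_2pi) simp
  ultimately show ?thesis by (simp only: cis_mult[symmetric] mult_1_right)
qed

lemma cis_measurable [measurable]: "cis \<in> borel_measurable borel"
  by (intro borel_measurable_continuous_onI continuous_intros)

lemma integrable_mult_cis:
  fixes \<phi> :: "real ^ 'n::finite \<Rightarrow> complex"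
  assumes "integrable (dual_measure \<Gamma>) \<phi>"
  shows "integrable (dual_measure \<Gamma>) (\<lambda>\<xi>. \<phi> \<xi> * cis (- 2 * pi * (\<xi> \<bullet> x)))"
proof (rule Bochner_Integration.integrable_bound[OF assms])
  have [measurable]: "\<phi> \<in> borel_measurable borel"
    using borel_measurable_integrable[OF assms] by simp
  have "(\<lambda>\<xi>. \<phi> \<xi> * cis (- 2 * pi * (\<xi> \<bullet> x))) \<in> borel_measurable borel"
    by measurable
  then show "(\<lambda>\<xi>. \<phi> \<xi> * cis (- 2 * pi * (\<xi> \<bullet> x))) \<in> borel_measurable (dual_measure \<Gamma>)" by simp
qed (simp add: norm_mult)

lemma norm_fourier_dual_le:
  assumes "integrable (dual_measure \<Gamma>) \<phi>"
  shows "norm (fourier_dual \<Gamma> \<phi> x) \<le> \<bar>ft_const \<Gamma>\<bar> * (LINT \<xi>|dual_measure \<Gamma>. norm (\<phi> \<xi>))"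
proof -
  have "norm (LINT \<xi>|dual_measure \<Gamma>. \<phi> \<xi> * cis (- 2 * pi * (\<xi> \<bullet> x)))
      \<le> (LINT \<xi>|dual_measure \<Gamma>. norm (\<phi> \<xi> * cis (- 2 * pi * (\<xi> \<bullet> x))))"
    by (rule integral_norm_bound)
  also have "\<dots> = (LINT \<xi>|dual_measure \<Gamma>. norm (\<phi> \<xi>))" by (simp add: norm_mult)
  finally show ?thesis by (simp add: fourier_dual_def norm_mult mult_left_mono)
qed

lemma test_moment_integrable:
  assumes "admissible \<Gamma>" "\<phi> \<in> null_extended_tests \<Gamma>" "f \<in> borel_measurable borel"
    "\<And>b. \<exists>B. \<forall>\<xi>. norm \<xi> \<le> b \<longrightarrow> norm (f \<xi>) \<le> B"
  shows "integrable (dual_measure \<Gamma>) (\<lambda>\<xi>. f \<xi> * norm (\<phi> \<xi>) :: real)"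
proof -
  obtain B where B: "\<And>\<xi>. norm (\<phi> \<xi>) \<le> B" "B > 0" using test_bounded[OF assms(2)] by blast
  obtain b where b: "\<And>\<xi>. norm \<xi> > b \<Longrightarrow> \<phi> \<xi> = 0" using assms(2) by (auto simp: null_extended_tests_iff)
  obtain B' where B': "\<And>\<xi>. norm \<xi> \<le> b \<Longrightarrow> norm (f \<xi>) \<le> B'" using assms(4) by blast
  have "norm (f \<xi> * norm (\<phi> \<xi>)) \<le> \<bar>B'\<bar> * B" for \<xi>
  proof (cases "norm \<xi> > b")
    case False
    then have "\<bar>f \<xi>\<bar> \<le> \<bar>B'\<bar>" using B'[of \<xi>] by simp
    then show ?thesis using B by (simp add: abs_mult mult_mono)
  qed (use b B in auto)
  then show ?thesis
    using test_borel[OF assms(2)] assms(3) b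
    by (intro integrable_bounded_support[OF assms(1), of _ "\<bar>B'\<bar> * B" b]) auto
qed

lemma fourier_dual_differentiable:
  assumes "admissible \<Gamma>" "\<phi> \<in> null_extended_tests \<Gamma>"
  shows "((\<lambda>t. fourier_dual \<Gamma> \<phi> (x + t *\<^sub>R axis i 1)) has_vector_derivative
      fourier_dual \<Gamma> (\<lambda>\<xi>. (- 2 * pi * \<i>) * (of_real (\<xi> $ i) * \<phi> \<xi>)) x) (at 0)"
proof (rule has_vector_derivative_quadratic_error)
  fix t :: real
  define M where "M = dual_measure \<Gamma>"
  let ?\<psi> = "\<lambda>\<xi>. (- 2 * pi * \<i>) * (of_real (\<xi> $ i) * \<phi> \<xi>)"
  let ?e = "\<lambda>\<xi> x. cis (- 2 * pi * (\<xi> \<bullet> x))"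
  let ?C = "LINT \<xi>|M. (2 * pi * \<xi> $ i)\<^sup>2 * norm (\<phi> \<xi>)"
  have \<psi>: "?\<psi> \<in> null_extended_tests \<Gamma>" by (intro test_cmult test_mult_coordinate assms)
  note int = test_integrable[OF assms, folded M_def] test_integrable[OF assms(1) \<psi>, folded M_def]
  note int_cis = int[unfolded M_def, THEN integrable_mult_cis, folded M_def]
  let ?r = "\<lambda>\<xi>. \<phi> \<xi> * ?e \<xi> (x + t *\<^sub>R axis i 1) - \<phi> \<xi> * ?e \<xi> x - t *\<^sub>R (?\<psi> \<xi> * ?e \<xi> x)"
  have "norm (LINT \<xi>|M. ?r \<xi>) \<le> (LINT \<xi>|M. t\<^sup>2 * ((2 * pi * \<xi> $ i)\<^sup>2 * norm (\<phi> \<xi>)))"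
  proof (rule Bochner_Integration.integral_norm_bound_integral)
    show "integrable M ?r" using int_cis by (intro Bochner_Integration.integrable_diff integrable_scaleR_right)
    have "\<exists>B. \<forall>\<xi>::real^'a. norm \<xi> \<le> b \<longrightarrow> norm ((2 * pi * \<xi> $ i)\<^sup>2) \<le> B" for b
    proof (intro exI allI impI)
      fix \<xi> :: "real^'a" assume "norm \<xi> \<le> b"
      then have "\<bar>\<xi> $ i\<bar> \<le> b" using component_le_norm_cart[of \<xi> i] by simp
      then show "norm ((2 * pi * \<xi> $ i)\<^sup>2) \<le> (2 * pi * b)\<^sup>2"
        by (simp add: abs_mult power_mult_distrib mult_left_mono abs_le_square_iff[symmetric])
    qed
    then show "integrable M (\<lambda>\<xi>. t\<^sup>2 * ((2 * pi * \<xi> $ i)\<^sup>2 * norm (\<phi> \<xi>)))"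
      unfolding M_def by (intro integrable_mult_right test_moment_integrable assms) auto
    fix \<xi>
    define a b where "a = - 2 * pi * (\<xi> \<bullet> x)" and "b = - 2 * pi * (\<xi> $ i) * t"
    have "- 2 * pi * (\<xi> \<bullet> (x + t *\<^sub>R axis i 1)) = a + b"
      by (simp add: a_def b_def inner_add_right inner_axis algebra_simps)
    moreover have "t *\<^sub>R (?\<psi> \<xi> * ?e \<xi> x) = \<phi> \<xi> * (\<i> * of_real b * cis a)"
      by (simp add: a_def b_def scaleR_conv_of_real)
    ultimately have "?r \<xi> = \<phi> \<xi> * (cis (a + b) - cis a - \<i> * of_real b * cis a)"
      by (simp only: right_diff_distrib a_def)
    then have "norm (?r \<xi>) \<le> norm (\<phi> \<xi>) * b\<^sup>2"
      using norm_cis_taylor[of a b] by (simp add: norm_mult mult_left_mono)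
    then show "norm (?r \<xi>) \<le> t\<^sup>2 * ((2 * pi * \<xi> $ i)\<^sup>2 * norm (\<phi> \<xi>))"
      by (simp add: b_def power_mult_distrib mult_ac)
  qed
  also have "(LINT \<xi>|M. ?r \<xi>) = (LINT \<xi>|M. \<phi> \<xi> * ?e \<xi> (x + t *\<^sub>R axis i 1)) - (LINT \<xi>|M. \<phi> \<xi> * ?e \<xi> x)
      - t *\<^sub>R (LINT \<xi>|M. ?\<psi> \<xi> * ?e \<xi> x)"
    using int_cis by (subst Bochner_Integration.integral_diff, simp, simp,
        subst Bochner_Integration.integral_diff) (simp_all only: integral_scaleR_right)
  finally have "norm ((LINT \<xi>|M. \<phi> \<xi> * ?e \<xi> (x + t *\<^sub>R axis i 1)) - (LINT \<xi>|M. \<phi> \<xi> * ?e \<xi> x)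
      - t *\<^sub>R (LINT \<xi>|M. ?\<psi> \<xi> * ?e \<xi> x)) \<le> t\<^sup>2 * ?C" (is "norm ?d \<le> _") by simp
  then have "\<bar>ft_const \<Gamma>\<bar> * norm ?d \<le> \<bar>ft_const \<Gamma>\<bar> * (t\<^sup>2 * ?C)" by (rule mult_left_mono) simp
  moreover have "fourier_dual \<Gamma> \<phi> (x + t *\<^sub>R axis i 1) - fourier_dual \<Gamma> \<phi> (x + 0 *\<^sub>R axis i 1)
      - t *\<^sub>R fourier_dual \<Gamma> ?\<psi> x = of_real (ft_const \<Gamma>) * ?d"
    unfolding fourier_dual_def M_def[symmetric] by (simp add: algebra_simps scaleR_conv_of_real)
  ultimately show "norm (fourier_dual \<Gamma> \<phi> (x + t *\<^sub>R axis i 1) - fourier_dual \<Gamma> \<phi> (x + 0 *\<^sub>R axis i 1)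
      - t *\<^sub>R fourier_dual \<Gamma> ?\<psi> x) \<le> (\<bar>ft_const \<Gamma>\<bar> * ?C) * t\<^sup>2"
    by (simp add: norm_mult mult_ac)
qed

lemma fourier_dual_continuous:
  assumes "admissible \<Gamma>" "\<phi> \<in> null_extended_tests \<Gamma>"
  shows "continuous_on UNIV (fourier_dual \<Gamma> \<phi>)"
proof -
  define M where "M = dual_measure \<Gamma>"
  let ?e = "\<lambda>\<xi> x. cis (- 2 * pi * (\<xi> \<bullet> x))"
  let ?C = "LINT \<xi>|M. 2 * pi * norm \<xi> * norm (\<phi> \<xi>)"
  note int_cis = test_integrable[OF assms, THEN integrable_mult_cis, folded M_def]
  have int: "integrable M (\<lambda>\<xi>. 2 * pi * norm \<xi> * norm (\<phi> \<xi>))"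
    unfolding M_def by (intro test_moment_integrable assms)
      (auto intro!: exI[of _ "2 * pi * b" for b] simp: abs_mult)
  have "(\<bar>ft_const \<Gamma>\<bar> * ?C)-lipschitz_on UNIV (fourier_dual \<Gamma> \<phi>)"
  proof (rule lipschitz_onI)
    fix x y :: "real ^ 'a"
    have "norm (LINT \<xi>|M. \<phi> \<xi> * ?e \<xi> x - \<phi> \<xi> * ?e \<xi> y) \<le> (LINT \<xi>|M. (2 * pi * norm \<xi> * norm (\<phi> \<xi>)) * norm (x - y))"
    proof (rule Bochner_Integration.integral_norm_bound_integral)
      fix \<xi>
      have "norm (?e \<xi> x - ?e \<xi> y) \<le> \<bar>- 2 * pi * (\<xi> \<bullet> x) - - 2 * pi * (\<xi> \<bullet> y)\<bar>"
        by (rule norm_cis_diff_le)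
      also have "- 2 * pi * (\<xi> \<bullet> x) - - 2 * pi * (\<xi> \<bullet> y) = - 2 * pi * (\<xi> \<bullet> (x - y))"
        by (simp add: inner_diff_right algebra_simps)
      also have "\<bar>\<dots>\<bar> \<le> 2 * pi * (norm \<xi> * norm (x - y))"
        using Cauchy_Schwarz_ineq2[of \<xi> "x - y"] by (simp add: abs_mult)
      finally have "norm (\<phi> \<xi>) * norm (?e \<xi> x - ?e \<xi> y) \<le> norm (\<phi> \<xi>) * (2 * pi * (norm \<xi> * norm (x - y)))"
        by (rule mult_left_mono) simp
      then show "norm (\<phi> \<xi> * ?e \<xi> x - \<phi> \<xi> * ?e \<xi> y) \<le> (2 * pi * norm \<xi> * norm (\<phi> \<xi>)) * norm (x - y)"
        by (simp add: right_diff_distrib[symmetric] norm_mult mult_ac)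
    qed (use int_cis int in auto)
    also have "(LINT \<xi>|M. (2 * pi * norm \<xi> * norm (\<phi> \<xi>)) * norm (x - y)) = ?C * norm (x - y)"
      by (rule integral_mult_left_zero)
    also have "(LINT \<xi>|M. \<phi> \<xi> * ?e \<xi> x - \<phi> \<xi> * ?e \<xi> y) = (LINT \<xi>|M. \<phi> \<xi> * ?e \<xi> x) - (LINT \<xi>|M. \<phi> \<xi> * ?e \<xi> y)"
      using int_cis by (intro Bochner_Integration.integral_diff)
    finally have "\<bar>ft_const \<Gamma>\<bar> * norm ((LINT \<xi>|M. \<phi> \<xi> * ?e \<xi> x) - (LINT \<xi>|M. \<phi> \<xi> * ?e \<xi> y)) \<le> \<bar>ft_const \<Gamma>\<bar> * (?C * norm (x - y))"
      by (rule mult_left_mono) simp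
    then show "dist (fourier_dual \<Gamma> \<phi> x) (fourier_dual \<Gamma> \<phi> y) \<le> \<bar>ft_const \<Gamma>\<bar> * ?C * dist x y"
      unfolding fourier_dual_def M_def[symmetric] dist_norm right_diff_distrib[symmetric] norm_mult by (simp add: mult.assoc)
  qed (auto intro!: mult_nonneg_nonneg Bochner_Integration.integral_nonneg)
  then show ?thesis by (rule lipschitz_on_continuous_on)
qed

text \<open>
  A derivative in \<open>x\<^sub>i\<close> multiplies the test function by a multiple of \<open>\<xi>\<^sub>i\<close>, which yields another test
  function.
\<close>

lemma fourier_dual_smooth:
  assumes "admissible \<Gamma>" "\<phi> \<in> null_extended_tests \<Gamma>"
  shows "smooth_along UNIV UNIV (fourier_dual \<Gamma> \<phi>)"
    and "\<exists>\<psi>\<in>null_extended_tests \<Gamma>. partial_derivs is (fourier_dual \<Gamma> \<phi>) = fourier_dual \<Gamma> \<psi>"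
proof -
  let ?P = "\<lambda>f. \<exists>\<psi>\<in>null_extended_tests \<Gamma>. f = fourier_dual \<Gamma> \<psi>"
  have step: "?P (partial_deriv i f)" if f: "?P f" for f i
  proof -
    obtain \<psi> where \<psi>: "\<psi> \<in> null_extended_tests \<Gamma>" "f = fourier_dual \<Gamma> \<psi>" using f by blast
    then show ?thesis
      using partial_deriv_eqI[OF fourier_dual_differentiable[OF assms(1) \<psi>(1)]]
      by (intro bexI[of _ "\<lambda>\<xi>. (- 2 * pi * \<i>) * (of_real (\<xi> $ i) * \<psi> \<xi>)"] ext
          test_cmult test_mult_coordinate) auto
  qed
  show "smooth_along UNIV UNIV (fourier_dual \<Gamma> \<phi>)"
  proof (rule smooth_along_coinduct[of ?P])
    show "(\<lambda>t. f (x + t *\<^sub>R axis i 1)) differentiable at 0" if "?P f" for f x and i :: 'a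
      using that fourier_dual_differentiable[OF assms(1)]
      by (auto simp: has_vector_derivative_def differentiable_def)
  qed (use assms step fourier_dual_continuous in auto)
  show "\<exists>\<psi>\<in>null_extended_tests \<Gamma>. partial_derivs is (fourier_dual \<Gamma> \<phi>) = fourier_dual \<Gamma> \<psi>"
  proof (induction "is")
    case Nil then show ?case using assms by auto
  next
    case (Cons i "is") then show ?case using step[of "partial_derivs is (fourier_dual \<Gamma> \<phi>)" i]
      by (simp add: partial_derivs_Cons)
  qed
qed

text \<open>
  Multiplication by \<open>x\<^sub>i\<close> corresponds to differentiation of the test function, which makes sense in the
  line directions only.  These are the directions in which decay is needed.
\<close>

lemma fourier_dual_partial_deriv:
  assumes "admissible \<Gamma>" "\<phi> \<in> null_extended_tests \<Gamma>" "i \<in> line_indices \<Gamma>"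
  shows "fourier_dual \<Gamma> (partial_deriv i \<phi>) x = 2 * pi * \<i> * of_real (x $ i) * fourier_dual \<Gamma> \<phi> x"
proof -
  let ?e = "\<lambda>\<xi>. cis (- 2 * pi * (\<xi> \<bullet> x))"
  have d: "partial_deriv i \<phi> \<in> null_extended_tests \<Gamma>" by (rule test_partial_deriv[OF assms(2,3)])
  have sm: "smooth_along (line_indices \<Gamma>) (dual_group \<Gamma>) \<phi>" using assms by (simp add: null_extended_tests_iff)
  define c where "c = - (2 * pi * \<i> * of_real (x $ i))"
  note int = integrable_mult_cis[OF test_integrable[OF assms(1) d], of x]
     integrable_mult_cis[OF test_integrable[OF assms(1,2)], of x]
  obtain b where b: "\<And>\<xi>. norm \<xi> > b \<Longrightarrow> \<phi> \<xi> = 0" using assms(2) by (auto simp: null_extended_tests_iff)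
  have outside: "\<phi> (\<xi> + t *\<^sub>R axis i 1) = 0" if "\<bar>t\<bar> > b + norm \<xi>" for \<xi> t
  proof (rule b)
    have "\<bar>t\<bar> = norm (t *\<^sub>R axis i (1::real) :: real^'a)" by simp
    also have "\<dots> \<le> norm (\<xi> + t *\<^sub>R axis i 1) + norm \<xi>"
      using norm_triangle_ineq4[of "\<xi> + t *\<^sub>R axis i 1" \<xi>] by simp
    finally show "norm (\<xi> + t *\<^sub>R axis i 1) > b" using that by simp
  qed
  have "(LINT \<xi>|dual_measure \<Gamma>. partial_deriv i \<phi> \<xi> * ?e \<xi> + c * (\<phi> \<xi> * ?e \<xi>)) = 0"
  proof (rule dual_integral_partial_deriv[OF assms(3), where G = "\<lambda>\<xi>. \<phi> \<xi> * ?e \<xi>"])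
    show "integrable (dual_measure \<Gamma>) (\<lambda>\<xi>. partial_deriv i \<phi> \<xi> * ?e \<xi> + c * (\<phi> \<xi> * ?e \<xi>))"
      using int by auto
    show "((\<lambda>t. \<phi> (\<xi> + t *\<^sub>R axis i 1) * ?e (\<xi> + t *\<^sub>R axis i 1)) has_vector_derivative
        partial_deriv i \<phi> \<xi> * ?e \<xi> + c * (\<phi> \<xi> * ?e \<xi>)) (at 0)" if "\<xi> \<in> dual_group \<Gamma>" for \<xi>
    proof -
      have "((\<lambda>t. ?e (\<xi> + t *\<^sub>R axis i 1)) has_vector_derivative c * ?e \<xi>) (at 0)"
        using has_vector_derivative_character[of \<xi> i x] by (simp add: c_def)
      from has_vector_derivative_mult[OF has_partial_deriv[OF smooth_along_differentiable[OF sm assms(3) that]] this]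
      show ?thesis by (simp add: c_def scaleR_conv_of_real algebra_simps)
    qed
    show "continuous_on (dual_group \<Gamma>) (\<lambda>\<xi>. partial_deriv i \<phi> \<xi> * ?e \<xi> + c * (\<phi> \<xi> * ?e \<xi>))"
      using sm smooth_along_partial_deriv[OF sm assms(3)]
      by (intro continuous_intros smooth_along_continuous) auto
    have top: "\<forall>\<^sub>F t in at_top. \<phi> (\<xi> + t *\<^sub>R axis i 1) * ?e (\<xi> + t *\<^sub>R axis i 1) = 0" for \<xi>
      using eventually_gt_at_top[of "\<bar>b\<bar> + norm \<xi>"] by eventually_elim (simp add: outside)
    have bot: "\<forall>\<^sub>F t in at_bot. \<phi> (\<xi> + t *\<^sub>R axis i 1) * ?e (\<xi> + t *\<^sub>R axis i 1) = 0" for \<xi>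
      using eventually_gt_at_bot[of "- (\<bar>b\<bar> + norm \<xi>)"] by eventually_elim (simp add: outside)
    show "((\<lambda>t. \<phi> (\<xi> + t *\<^sub>R axis i 1) * ?e (\<xi> + t *\<^sub>R axis i 1)) \<longlongrightarrow> 0) at_top"
      "((\<lambda>t. \<phi> (\<xi> + t *\<^sub>R axis i 1) * ?e (\<xi> + t *\<^sub>R axis i 1)) \<longlongrightarrow> 0) at_bot" for \<xi>
      by (rule tendsto_eventually[OF top] tendsto_eventually[OF bot])+
  qed
  also have "(LINT \<xi>|dual_measure \<Gamma>. partial_deriv i \<phi> \<xi> * ?e \<xi> + c * (\<phi> \<xi> * ?e \<xi>))
      = (LINT \<xi>|dual_measure \<Gamma>. partial_deriv i \<phi> \<xi> * ?e \<xi>) + c * (LINT \<xi>|dual_measure \<Gamma>. \<phi> \<xi> * ?e \<xi>)"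
    using int by simp
  finally have "(LINT \<xi>|dual_measure \<Gamma>. partial_deriv i \<phi> \<xi> * ?e \<xi>) = - c * (LINT \<xi>|dual_measure \<Gamma>. \<phi> \<xi> * ?e \<xi>)"
    by (simp add: eq_neg_iff_add_eq_0)
  then show ?thesis by (simp add: fourier_dual_def c_def)
qed

lemma fourier_dual_periodic:
  assumes "admissible \<Gamma>" "\<phi> \<in> null_extended_tests \<Gamma>" shows "periodic \<Gamma> (fourier_dual \<Gamma> \<phi>)"
  unfolding periodic_def
proof (intro allI impI)
  fix i L x assume i: "\<Gamma> i = Circle L"
  have m: "(\<lambda>\<xi>. \<phi> \<xi> * cis (- 2 * pi * (\<xi> \<bullet> x))) \<in> borel_measurable (dual_measure \<Gamma>)" for x
    using integrable_mult_cis[OF test_integrable[OF assms]] by simp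
  have "(LINT \<xi>|dual_measure \<Gamma>. \<phi> \<xi> * cis (- 2 * pi * (\<xi> \<bullet> (x + L *\<^sub>R axis i 1))))
      = (LINT \<xi>|dual_measure \<Gamma>. \<phi> \<xi> * cis (- 2 * pi * (\<xi> \<bullet> x)))"
  proof (rule integral_cong_AE)
    show "AE \<xi> in dual_measure \<Gamma>. \<phi> \<xi> * cis (- 2 * pi * (\<xi> \<bullet> (x + L *\<^sub>R axis i 1))) = \<phi> \<xi> * cis (- 2 * pi * (\<xi> \<bullet> x))"
      using AE_dual_group by eventually_elim (simp only: character_periodic[OF assms(1) _ i])
  qed (rule m)+
  then show "fourier_dual \<Gamma> \<phi> (x + L *\<^sub>R axis i 1) = fourier_dual \<Gamma> \<phi> x"
    by (simp add: fourier_dual_def)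
qed

lemma line_part_component: "line_part \<Gamma> x $ i = (if i \<in> line_indices \<Gamma> then x $ i else 0)"
  by (simp add: line_part_def)

lemma finite_arg_max_abs:
  fixes f :: "'n::finite \<Rightarrow> real"
  obtains k where "\<And>i. \<bar>f i\<bar> \<le> \<bar>f k\<bar>"
proof -
  have "Max (range (\<lambda>i. \<bar>f i\<bar>)) \<in> range (\<lambda>i. \<bar>f i\<bar>)" by (rule Max_in) auto
  then obtain k where "Max (range (\<lambda>i. \<bar>f i\<bar>)) = \<bar>f k\<bar>"
    unfolding image_iff by blast
  then have "\<bar>f i\<bar> \<le> \<bar>f k\<bar>" for i using Max_ge[of "range (\<lambda>i. \<bar>f i\<bar>)" "\<bar>f i\<bar>"] by simp
  then show ?thesis by (rule that)
qed

text \<open>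
  Comparison with the largest coordinate reduces decay in \<open>\<bar>x\<bar>\<close> to decay in each coordinate separately.
\<close>

lemma weight_le_sum_coordinates:
  "(1 + norm (line_part \<Gamma> (x::real^'n::finite))) ^ N \<le> (1 + real CARD('n)) ^ N * (1 + (\<Sum>i\<in>line_indices \<Gamma>. \<bar>x $ i\<bar> ^ N))"
proof -
  let ?y = "line_part \<Gamma> x"
  obtain k where k: "\<And>i. \<bar>?y $ i\<bar> \<le> \<bar>?y $ k\<bar>"
    using finite_arg_max_abs[of "\<lambda>i. ?y $ i"] by metis
  define m where "m = max 1 \<bar>?y $ k\<bar>"
  have "norm ?y \<le> (\<Sum>i\<in>UNIV. \<bar>?y $ i\<bar>)" by (rule norm_le_l1_cart)
  also have "\<dots> \<le> (\<Sum>i\<in>(UNIV::'n set). m)" using k by (intro sum_mono) (auto simp: m_def le_max_iff_disj)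
  finally have "1 + norm ?y \<le> (1 + real CARD('n)) * m" by (simp add: m_def algebra_simps)
  then have "(1 + norm ?y) ^ N \<le> ((1 + real CARD('n)) * m) ^ N" by (intro power_mono) auto
  also have "\<dots> = (1 + real CARD('n)) ^ N * m ^ N" by (rule power_mult_distrib)
  also have "m ^ N \<le> 1 + (\<Sum>i\<in>line_indices \<Gamma>. \<bar>x $ i\<bar> ^ N)"
  proof (cases "\<bar>?y $ k\<bar> \<le> 1")
    case True
    then show ?thesis by (simp add: m_def sum_nonneg)
  next
    case False
    then have kl: "k \<in> line_indices \<Gamma>" and "m = \<bar>x $ k\<bar>"
      by (auto simp: m_def line_part_component split: if_splits)
    moreover have "\<bar>x $ k\<bar> ^ N \<le> (\<Sum>i\<in>line_indices \<Gamma>. \<bar>x $ i\<bar> ^ N)"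
      using kl by (intro member_le_sum) auto
    ultimately show ?thesis by simp
  qed
  finally show ?thesis by simp
qed

lemma fourier_dual_decay:
  assumes "admissible \<Gamma>" "i \<in> line_indices \<Gamma>"
  shows "\<phi> \<in> null_extended_tests \<Gamma> \<Longrightarrow> \<exists>C. \<forall>x. \<bar>x $ i\<bar> ^ N * norm (fourier_dual \<Gamma> \<phi> x) \<le> C"
proof (induction N arbitrary: \<phi>)
  case 0
  then show ?case using norm_fourier_dual_le[OF test_integrable[OF assms(1)]] by auto
next
  case (Suc N)
  obtain C where C: "\<And>x. \<bar>x $ i\<bar> ^ N * norm (fourier_dual \<Gamma> (partial_deriv i \<phi>) x) \<le> C"
    using Suc.IH[OF test_partial_deriv[OF Suc.prems assms(2)]] by blast
  have "\<bar>x $ i\<bar> ^ Suc N * norm (fourier_dual \<Gamma> \<phi> x) \<le> C" for x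
  proof -
    have "\<bar>x $ i\<bar> * norm (fourier_dual \<Gamma> \<phi> x) \<le> 2 * pi * (\<bar>x $ i\<bar> * norm (fourier_dual \<Gamma> \<phi> x))"
      using mult_right_mono[of 1 "2 * pi" "\<bar>x $ i\<bar> * norm (fourier_dual \<Gamma> \<phi> x)"] pi_ge_two by simp
    also have "\<dots> = norm (fourier_dual \<Gamma> (partial_deriv i \<phi>) x)"
      by (simp add: fourier_dual_partial_deriv[OF assms(1) Suc.prems assms(2)] norm_mult)
    finally have "\<bar>x $ i\<bar> ^ N * (\<bar>x $ i\<bar> * norm (fourier_dual \<Gamma> \<phi> x)) \<le> \<bar>x $ i\<bar> ^ N * norm (fourier_dual \<Gamma> (partial_deriv i \<phi>) x)"
      by (rule mult_left_mono) simp
    then show ?thesis using C[of x] by (simp add: mult_ac)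
  qed
  then show ?case by blast
qed

text \<open>
  Tempered distributions are zero by convention outside the Schwartz class, so the pairing with \<open>fourier_dual \<Gamma> \<phi>\<close>
  carries information only because of this theorem.
\<close>

theorem fourier_dual_schwartz:
  assumes "admissible \<Gamma>" "\<phi> \<in> null_extended_tests \<Gamma>"
  shows "fourier_dual \<Gamma> \<phi> \<in> schwartz \<Gamma>"
proof -
  have "bdd_above (range (weighted_deriv \<Gamma> N is (fourier_dual \<Gamma> \<phi>)))" for N "is"
  proof -
    obtain \<psi> where \<psi>: "\<psi> \<in> null_extended_tests \<Gamma>" "partial_derivs is (fourier_dual \<Gamma> \<phi>) = fourier_dual \<Gamma> \<psi>"
      using fourier_dual_smooth(2)[OF assms] by blast
    have "\<forall>i\<in>line_indices \<Gamma>. \<exists>C. \<forall>x. \<bar>x $ i\<bar> ^ N * norm (fourier_dual \<Gamma> \<psi> x) \<le> C"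
      using fourier_dual_decay[OF assms(1) _ \<psi>(1)] by blast
    then obtain C where C: "\<And>i x. i \<in> line_indices \<Gamma> \<Longrightarrow> \<bar>x $ i\<bar> ^ N * norm (fourier_dual \<Gamma> \<psi> x) \<le> C i"
      by metis
    obtain C0 where C0: "\<And>x. norm (fourier_dual \<Gamma> \<psi> x) \<le> C0"
      using norm_fourier_dual_le[OF test_integrable[OF assms(1) \<psi>(1)]] by blast
    have "weighted_deriv \<Gamma> N is (fourier_dual \<Gamma> \<phi>) x \<le> (1 + real CARD('a)) ^ N * (C0 + (\<Sum>i\<in>line_indices \<Gamma>. C i))" for x
    proof -
      have "weighted_deriv \<Gamma> N is (fourier_dual \<Gamma> \<phi>) x \<le>
          ((1 + real CARD('a)) ^ N * (1 + (\<Sum>i\<in>line_indices \<Gamma>. \<bar>x $ i\<bar> ^ N))) * norm (fourier_dual \<Gamma> \<psi> x)"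
        unfolding weighted_deriv_def \<psi>(2) by (intro mult_right_mono weight_le_sum_coordinates) simp
      also have "\<dots> = (1 + real CARD('a)) ^ N * (norm (fourier_dual \<Gamma> \<psi> x) +
          (\<Sum>i\<in>line_indices \<Gamma>. \<bar>x $ i\<bar> ^ N * norm (fourier_dual \<Gamma> \<psi> x)))"
        by (simp add: distrib_right sum_distrib_right mult.assoc)
      also have "\<dots> \<le> (1 + real CARD('a)) ^ N * (C0 + (\<Sum>i\<in>line_indices \<Gamma>. C i))"
        by (intro mult_left_mono add_mono sum_mono C C0) auto
      finally show ?thesis .
    qed
    then show ?thesis by (intro bdd_aboveI2)
  qed
  then show ?thesis
    using fourier_dual_periodic[OF assms] fourier_dual_smooth(1)[OF assms] by (simp add: schwartz_def)
qed


section \<open>The Schwartz class\<close>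

lemma schwartz_smooth: "\<psi> \<in> schwartz \<Gamma> \<Longrightarrow> smooth_along UNIV UNIV \<psi>"
  and schwartz_periodic: "\<psi> \<in> schwartz \<Gamma> \<Longrightarrow> periodic \<Gamma> \<psi>"
  and schwartz_bdd: "\<psi> \<in> schwartz \<Gamma> \<Longrightarrow> bdd_above (range (weighted_deriv \<Gamma> N is \<psi>))"
  by (auto simp: schwartz_def)

lemma smooth_along_partial_derivs: "smooth_along UNIV UNIV f \<Longrightarrow> smooth_along UNIV UNIV (partial_derivs is f)"
  by (induction "is") (simp_all add: partial_derivs_Cons smooth_along_partial_deriv)

lemma partial_derivs_append: "partial_derivs is (partial_derivs js f) = partial_derivs (is @ js) f"
  by (simp add: partial_derivs_def)

lemma partial_derivs_add_scaled:
  assumes "smooth_along UNIV UNIV f" "smooth_along UNIV UNIV g"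
  shows "partial_derivs is (\<lambda>x. f x + c * g x) = (\<lambda>x. partial_derivs is f x + c * partial_derivs is g x)"
proof (induction "is")
  case (Cons i "is")
  show ?case
    unfolding partial_derivs_Cons Cons
    by (intro ext partial_deriv_eqI has_vector_derivative_add has_vector_derivative_mult_right has_partial_deriv
        smooth_along_differentiable[of UNIV UNIV] smooth_along_partial_derivs assms UNIV_I)
qed simp

lemma partial_derivs_cnj:
  assumes "smooth_along UNIV UNIV f"
  shows "partial_derivs is (\<lambda>x. cnj (f x)) = (\<lambda>x. cnj (partial_derivs is f x))"
proof (induction "is")
  case (Cons i "is")
  show ?case
    unfolding partial_derivs_Cons Cons
    by (intro ext partial_deriv_eqI has_vector_derivative_cnj has_partial_deriv
        smooth_along_differentiable[of UNIV UNIV] smooth_along_partial_derivs assms UNIV_I)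
qed simp

lemma weighted_deriv_le_seminorm:
  "\<psi> \<in> schwartz \<Gamma> \<Longrightarrow> weighted_deriv \<Gamma> N is \<psi> x \<le> schwartz_seminorm \<Gamma> N is \<psi>"
  unfolding schwartz_seminorm_def by (intro cSUP_upper schwartz_bdd UNIV_I)

lemma weighted_deriv_nonneg: "0 \<le> weighted_deriv \<Gamma> N is \<psi> x"
  by (simp add: weighted_deriv_def)

lemma schwartz_seminorm_nonneg: "\<psi> \<in> schwartz \<Gamma> \<Longrightarrow> 0 \<le> schwartz_seminorm \<Gamma> N is \<psi>"
  using weighted_deriv_nonneg weighted_deriv_le_seminorm order_trans by metis

lemma schwartz_add_scaled:
  assumes "f \<in> schwartz \<Gamma>" "g \<in> schwartz \<Gamma>"
  shows "(\<lambda>x. f x + c * g x) \<in> schwartz \<Gamma>"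
proof -
  note sm = schwartz_smooth[OF assms(1)] schwartz_smooth[OF assms(2)]
  have "smooth_along UNIV UNIV (\<lambda>x. f x + c * g x)"
    using sm unfolding smooth_along_iff
    by (auto intro!: smooth_upto_add smooth_upto_mult)
  moreover have "periodic \<Gamma> (\<lambda>x. f x + c * g x)"
    using schwartz_periodic[OF assms(1)] schwartz_periodic[OF assms(2)] by (simp add: periodic_def)
  moreover have "bdd_above (range (weighted_deriv \<Gamma> N is (\<lambda>x. f x + c * g x)))" for N "is"
  proof (rule bdd_aboveI2)
    fix x
    have "norm (partial_derivs is f x + c * partial_derivs is g x) \<le>
        norm (partial_derivs is f x) + norm c * norm (partial_derivs is g x)"
      by (metis norm_mult norm_triangle_ineq)
    then have "weighted_deriv \<Gamma> N is (\<lambda>x. f x + c * g x) x \<le>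
        (1 + norm (line_part \<Gamma> x)) ^ N * (norm (partial_derivs is f x) + norm c * norm (partial_derivs is g x))"
      unfolding weighted_deriv_def partial_derivs_add_scaled[OF sm] by (intro mult_left_mono) auto
    also have "\<dots> = weighted_deriv \<Gamma> N is f x + norm c * weighted_deriv \<Gamma> N is g x"
      by (simp add: weighted_deriv_def algebra_simps)
    also have "\<dots> \<le> schwartz_seminorm \<Gamma> N is f + norm c * schwartz_seminorm \<Gamma> N is g"
      by (intro add_mono mult_left_mono weighted_deriv_le_seminorm assms norm_ge_zero)
    finally show "weighted_deriv \<Gamma> N is (\<lambda>x. f x + c * g x) x \<le> schwartz_seminorm \<Gamma> N is f + norm c * schwartz_seminorm \<Gamma> N is g" .
  qed
  ultimately show ?thesis by (simp add: schwartz_def)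
qed

lemma partial_derivs_zero: "partial_derivs is (\<lambda>_. 0) = (\<lambda>_. 0)"
  by (induction "is") (auto simp: partial_derivs_Cons partial_deriv_def)

lemma zero_schwartz: "(\<lambda>_. 0) \<in> schwartz \<Gamma>"
  by (auto simp: schwartz_def periodic_def smooth_along_iff weighted_deriv_def partial_derivs_zero)

lemma schwartz_diff: "f \<in> schwartz \<Gamma> \<Longrightarrow> g \<in> schwartz \<Gamma> \<Longrightarrow> (\<lambda>x. f x - g x) \<in> schwartz \<Gamma>"
  using schwartz_add_scaled[of f \<Gamma> g "-1"] by simp

lemma schwartz_cnj:
  assumes "f \<in> schwartz \<Gamma>" shows "(\<lambda>x. cnj (f x)) \<in> schwartz \<Gamma>"
proof -
  note sm = schwartz_smooth[OF assms]
  have "smooth_along UNIV UNIV (\<lambda>x. cnj (f x))"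
    using sm unfolding smooth_along_iff by (auto intro!: smooth_upto_cnj)
  moreover have "weighted_deriv \<Gamma> N is (\<lambda>x. cnj (f x)) = weighted_deriv \<Gamma> N is f" for N "is"
    by (simp add: fun_eq_iff weighted_deriv_def partial_derivs_cnj[OF sm])
  ultimately show ?thesis
    using assms by (simp add: schwartz_def periodic_def)
qed

lemma schwartz_cnj_iff: "(\<lambda>x. cnj (f x)) \<in> schwartz \<Gamma> \<longleftrightarrow> f \<in> schwartz \<Gamma>"
  using schwartz_cnj[of f \<Gamma>] schwartz_cnj[of "\<lambda>x. cnj (f x)" \<Gamma>] by auto

lemma weighted_deriv_partial_derivs:
  "weighted_deriv \<Gamma> N is (partial_derivs js f) = weighted_deriv \<Gamma> N (is @ js) f"
  by (simp add: fun_eq_iff weighted_deriv_def partial_derivs_append)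

lemma schwartz_seminorm_partial_derivs:
  "schwartz_seminorm \<Gamma> N is (partial_derivs js f) = schwartz_seminorm \<Gamma> N (is @ js) f"
  by (simp add: schwartz_seminorm_def weighted_deriv_partial_derivs)

lemma schwartz_partial_derivs:
  assumes "f \<in> schwartz \<Gamma>" shows "partial_derivs js f \<in> schwartz \<Gamma>"
proof -
  have "periodic \<Gamma> (partial_derivs js f)"
  proof (induction js)
    case (Cons j js)
    then have *: "partial_derivs js f (x + L *\<^sub>R axis i 1) = partial_derivs js f x" if "\<Gamma> i = Circle L" for i L x
      using that by (auto simp: periodic_def)
    show ?case
      unfolding periodic_def partial_derivs_Cons
    proof (intro allI impI)
      fix i L x assume i: "\<Gamma> i = Circle L"
      have "partial_derivs js f (x + L *\<^sub>R axis i 1 + t *\<^sub>R axis j 1) = partial_derivs js f (x + t *\<^sub>R axis j 1)" for t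
        using *[OF i, of "x + t *\<^sub>R axis j 1"] by (simp add: algebra_simps)
      then show "partial_deriv j (partial_derivs js f) (x + L *\<^sub>R axis i 1) = partial_deriv j (partial_derivs js f) x"
        by (simp add: partial_deriv_def)
    qed
  qed (use assms schwartz_periodic in auto)
  then show ?thesis
    using assms unfolding schwartz_def by (simp add: smooth_along_partial_derivs weighted_deriv_partial_derivs)
qed

lemma schwartz_continuous: "f \<in> schwartz \<Gamma> \<Longrightarrow> continuous_on UNIV f"
  using schwartz_smooth smooth_along_continuous by blast

lemma schwartz_borel: "f \<in> schwartz \<Gamma> \<Longrightarrow> f \<in> borel_measurable borel"
  using schwartz_continuous borel_measurable_continuous_onI by blast


section \<open>Decay of the Fourier transform of a Schwartz function\<close>

lemma integrable_inverse_1_plus_square_line: "integrable lborel (\<lambda>t::real. 1 / (1 + t\<^sup>2))"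
  using integrable_inverse_1_plus_square by (simp add: set_integrable_def einterval_def inverse_eq_divide)

text \<open>
  An integrable function on the cell that dominates a negative power of the Schwartz weight.
\<close>

definition cell_decay :: "('n::finite \<Rightarrow> factor) \<Rightarrow> real ^ 'n \<Rightarrow> real" where
  "cell_decay \<Gamma> x = (\<Prod>i\<in>UNIV. if \<Gamma> i = Line then 1 / (1 + (x $ i)\<^sup>2) else 1)"

lemma cell_decay_integrable: "set_integrable lborel (fundamental_cell \<Gamma>) (cell_decay \<Gamma>)"
  unfolding cell_decay_def
proof (rule integrable_cell_prod[where f = "\<lambda>i t. if \<Gamma> i = Line then 1 / (1 + t\<^sup>2) else 1"])
  fix i
  show "set_integrable lborel (cell_factor (\<Gamma> i)) (\<lambda>t. if \<Gamma> i = Line then 1 / (1 + t\<^sup>2) else 1)"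
  proof (cases "\<Gamma> i")
    case Line
    then show ?thesis using integrable_inverse_1_plus_square_line
      by (simp add: set_integrable_def cell_factor_def)
  next
    case (Circle L)
    then show ?thesis
      by (cases "L \<ge> 0") (auto simp: set_integrable_def cell_factor_def integrable_indicator_iff)
  qed
qed auto

lemma cell_decay_pos: "0 < cell_decay \<Gamma> x"
  unfolding cell_decay_def by (intro prod_pos) (auto simp: add_pos_nonneg)

text \<open>
  Each of the at most \<open>CARD('n)\<close> factors \<open>1 + x\<^sub>i\<^sup>2\<close> that occur is bounded by \<open>(1 + norm (line_part \<Gamma> x))\<^sup>2\<close>,
  whence the exponent.
\<close>

lemma weight_times_cell_decay_ge_1:
  fixes x :: "real ^ 'n::finite"
  shows "1 \<le> (1 + norm (line_part \<Gamma> x)) ^ (2 * CARD('n)) * cell_decay \<Gamma> x"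
proof -
  let ?y = "line_part \<Gamma> x"
  have "(\<Prod>i\<in>UNIV. 1 + (?y $ i)\<^sup>2) \<le> (\<Prod>i\<in>(UNIV::'n set). (1 + norm ?y)\<^sup>2)"
  proof (rule prod_mono, safe)
    fix i
    have "(?y $ i)\<^sup>2 \<le> (norm ?y)\<^sup>2"
      using component_le_norm_cart[of ?y i] by (simp add: abs_le_square_iff[symmetric])
    then show "1 + (?y $ i)\<^sup>2 \<le> (1 + norm ?y)\<^sup>2"
      by (simp add: power2_sum add_increasing2)
  qed auto
  also have "\<dots> = (1 + norm ?y) ^ (2 * CARD('n))" by (simp add: power_mult)
  finally have 1: "(\<Prod>i\<in>UNIV. 1 + (?y $ i)\<^sup>2) \<le> (1 + norm ?y) ^ (2 * CARD('n))" .
  have "cell_decay \<Gamma> x = (\<Prod>i\<in>UNIV. 1 / (1 + (?y $ i)\<^sup>2))"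
    unfolding cell_decay_def by (intro prod.cong) (auto simp: line_part_component line_indices_def)
  then have "cell_decay \<Gamma> x * (\<Prod>i\<in>UNIV. 1 + (?y $ i)\<^sup>2) = 1"
    by (simp add: prod.distrib[symmetric] add_nonneg_eq_0_iff)
  then show ?thesis
    using mult_left_mono[OF 1 less_imp_le[OF cell_decay_pos[of \<Gamma> x]]] by (simp add: mult.commute)
qed

lemma schwartz_le_cell_decay:
  fixes \<psi> :: "real ^ 'n::finite \<Rightarrow> complex"
  assumes "\<psi> \<in> schwartz \<Gamma>"
  shows "norm (\<psi> x) \<le> schwartz_seminorm \<Gamma> (2 * CARD('n)) [] \<psi> * cell_decay \<Gamma> x"
proof -
  have "norm (\<psi> x) \<le> ((1 + norm (line_part \<Gamma> x)) ^ (2 * CARD('n)) * cell_decay \<Gamma> x) * norm (\<psi> x)"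
    using mult_right_mono[OF weight_times_cell_decay_ge_1, of "norm (\<psi> x)" \<Gamma> x] by simp
  also have "\<dots> = weighted_deriv \<Gamma> (2 * CARD('n)) [] \<psi> x * cell_decay \<Gamma> x"
    by (simp add: weighted_deriv_def mult_ac)
  also have "\<dots> \<le> schwartz_seminorm \<Gamma> (2 * CARD('n)) [] \<psi> * cell_decay \<Gamma> x"
    by (intro mult_right_mono weighted_deriv_le_seminorm assms less_imp_le cell_decay_pos)
  finally show ?thesis .
qed

lemma schwartz_cell_integrable:
  assumes "\<psi> \<in> schwartz \<Gamma>" and [measurable]: "h \<in> borel_measurable borel" and "\<And>x. norm (h x) \<le> 1"
  shows "set_integrable lborel (fundamental_cell \<Gamma>) (\<lambda>x. \<psi> x * h x)"
proof (rule set_integrable_bound)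
  have [measurable]: "\<psi> \<in> borel_measurable borel" by (rule schwartz_borel[OF assms(1)])
  show "set_integrable lborel (fundamental_cell \<Gamma>) (\<lambda>x. schwartz_seminorm \<Gamma> (2 * CARD('a)) [] \<psi> * cell_decay \<Gamma> x)"
    by (intro set_integrable_mult_right cell_decay_integrable)
  show "set_borel_measurable lborel (fundamental_cell \<Gamma>) (\<lambda>x. \<psi> x * h x)"
    unfolding set_borel_measurable_def by measurable
  have "norm (\<psi> x * h x) \<le> norm (schwartz_seminorm \<Gamma> (2 * CARD('a)) [] \<psi> * cell_decay \<Gamma> x)" for x
  proof -
    have "norm (\<psi> x * h x) \<le> norm (\<psi> x) * 1"
      unfolding norm_mult by (intro mult_left_mono assms) simp
    then show ?thesis using schwartz_le_cell_decay[OF assms(1), of x] by simp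
  qed
  then show "AE x in lborel. x \<in> fundamental_cell \<Gamma> \<longrightarrow> norm (\<psi> x * h x) \<le>
      norm (schwartz_seminorm \<Gamma> (2 * CARD('a)) [] \<psi> * cell_decay \<Gamma> x)" by simp
qed

lemma norm_fourier_le:
  fixes \<psi> :: "real ^ 'n::finite \<Rightarrow> complex"
  assumes "\<psi> \<in> schwartz \<Gamma>"
  shows "norm (fourier \<Gamma> \<psi> \<xi>) \<le> \<bar>ft_const \<Gamma>\<bar> * (LINT x:fundamental_cell \<Gamma>|lborel. cell_decay \<Gamma> x) *
     schwartz_seminorm \<Gamma> (2 * CARD('n)) [] \<psi>"
proof -
  let ?e = "\<lambda>x. cis (- 2 * pi * (\<xi> \<bullet> x))"
  let ?s = "schwartz_seminorm \<Gamma> (2 * CARD('n)) [] \<psi>"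
  have "norm (LINT x:fundamental_cell \<Gamma>|lborel. \<psi> x * ?e x) \<le> (LINT x:fundamental_cell \<Gamma>|lborel. ?s * cell_decay \<Gamma> x)"
    unfolding set_lebesgue_integral_def
  proof (rule Bochner_Integration.integral_norm_bound_integral)
    show "integrable lborel (\<lambda>x. indicator (fundamental_cell \<Gamma>) x *\<^sub>R (\<psi> x * ?e x))"
      using schwartz_cell_integrable[OF assms, of ?e] by (simp add: set_integrable_def)
    show "integrable lborel (\<lambda>x. indicator (fundamental_cell \<Gamma>) x *\<^sub>R (?s * cell_decay \<Gamma> x))"
      using set_integrable_mult_right[of ?s, OF cell_decay_integrable] unfolding set_integrable_def by blast
    show "norm (indicator (fundamental_cell \<Gamma>) x *\<^sub>R (\<psi> x * ?e x)) \<le> indicator (fundamental_cell \<Gamma>) x *\<^sub>R (?s * cell_decay \<Gamma> x)" for x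
      using schwartz_le_cell_decay[OF assms, of x] by (auto simp: indicator_def norm_mult)
  qed
  then show ?thesis
    by (simp add: fourier_def norm_mult mult_left_mono mult.assoc mult.commute[of ?s])
qed

text \<open>
  The character has to be periodic on the cell for the boundary terms to cancel, so that \<open>\<xi>\<close> is confined
  to the dual group.
\<close>

lemma fourier_partial_deriv:
  assumes "admissible \<Gamma>" "\<psi> \<in> schwartz \<Gamma>" "\<xi> \<in> dual_group \<Gamma>"
  shows "fourier \<Gamma> (partial_deriv i \<psi>) \<xi> = 2 * pi * \<i> * of_real (\<xi> $ i) * fourier \<Gamma> \<psi> \<xi>"
proof -
  let ?e = "\<lambda>x. cis (- 2 * pi * (\<xi> \<bullet> x))"
  have d: "partial_deriv i \<psi> \<in> schwartz \<Gamma>"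
    using schwartz_partial_derivs[OF assms(2), of "[i]"] by (simp add: partial_derivs_Cons)
  define c where "c = - (2 * pi * \<i> * of_real (\<xi> $ i))"
  have int: "set_integrable lborel (fundamental_cell \<Gamma>) (\<lambda>x. partial_deriv i \<psi> x * ?e x)"
     "set_integrable lborel (fundamental_cell \<Gamma>) (\<lambda>x. \<psi> x * ?e x)"
    using schwartz_cell_integrable[OF d, of ?e] schwartz_cell_integrable[OF assms(2), of ?e] by auto
  have lim: "((\<lambda>t. \<psi> (x + t *\<^sub>R axis i 1) * ?e (x + t *\<^sub>R axis i 1)) \<longlongrightarrow> 0) F"
    if i: "\<Gamma> i = Line" and F: "filterlim (\<lambda>t. \<bar>x $ i + t\<bar>) at_top F" for x F
  proof (rule Lim_null_comparison)
    let ?s = "schwartz_seminorm \<Gamma> 1 [] \<psi>"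
    show "\<forall>\<^sub>F t in F. norm (\<psi> (x + t *\<^sub>R axis i 1) * ?e (x + t *\<^sub>R axis i 1)) \<le> ?s / (1 + \<bar>x $ i + t\<bar>)"
    proof (rule always_eventually, rule allI)
      fix t
      let ?x = "x + t *\<^sub>R axis i 1"
      have "\<bar>x $ i + t\<bar> = \<bar>line_part \<Gamma> ?x $ i\<bar>" using i by (simp add: line_part_component line_indices_def)
      then have "1 + \<bar>x $ i + t\<bar> \<le> 1 + norm (line_part \<Gamma> ?x)" using component_le_norm_cart by simp
      then have "(1 + \<bar>x $ i + t\<bar>) * norm (\<psi> ?x) \<le> (1 + norm (line_part \<Gamma> ?x)) * norm (\<psi> ?x)"
        by (rule mult_right_mono) simp
      also have "\<dots> \<le> ?s" using weighted_deriv_le_seminorm[OF assms(2), of 1 "[]" ?x] by (simp add: weighted_deriv_def)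
      finally show "norm (\<psi> ?x * ?e ?x) \<le> ?s / (1 + \<bar>x $ i + t\<bar>)"
        by (simp add: norm_mult pos_le_divide_eq mult.commute add_pos_nonneg)
    qed
    show "((\<lambda>t. ?s / (1 + \<bar>x $ i + t\<bar>)) \<longlongrightarrow> 0) F"
      by (intro tendsto_divide_0[OF tendsto_const] filterlim_at_top_imp_at_infinity
          filterlim_tendsto_add_at_top[OF tendsto_const] F)
  qed
  have "(LINT x:fundamental_cell \<Gamma>|lborel. partial_deriv i \<psi> x * ?e x + c * (\<psi> x * ?e x)) = 0"
  proof (rule cell_integral_partial_deriv[OF assms(1), where G = "\<lambda>x. \<psi> x * ?e x"])
    show "set_integrable lborel (fundamental_cell \<Gamma>) (\<lambda>x. partial_deriv i \<psi> x * ?e x + c * (\<psi> x * ?e x))"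
      by (intro set_integral_add set_integrable_mult_right int)
    show "((\<lambda>t. \<psi> (x + t *\<^sub>R axis i 1) * ?e (x + t *\<^sub>R axis i 1)) has_vector_derivative
        partial_deriv i \<psi> x * ?e x + c * (\<psi> x * ?e x)) (at 0)" for x
    proof -
      have "((\<lambda>t. ?e (x + t *\<^sub>R axis i 1)) has_vector_derivative c * ?e x) (at 0)"
        using has_vector_derivative_character[of x i \<xi>] by (simp add: c_def inner_commute)
      from has_vector_derivative_mult[OF has_partial_deriv[OF
            smooth_along_differentiable[OF schwartz_smooth[OF assms(2)]]] this]
      show ?thesis by (simp add: algebra_simps)
    qed
    show "continuous_on UNIV (\<lambda>x. partial_deriv i \<psi> x * ?e x + c * (\<psi> x * ?e x))"
      using schwartz_continuous[OF d] schwartz_continuous[OF assms(2)]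
      by (intro continuous_intros)
    show "((\<lambda>t. \<psi> (x + t *\<^sub>R axis i 1) * ?e (x + t *\<^sub>R axis i 1)) \<longlongrightarrow> 0) at_top"
      "((\<lambda>t. \<psi> (x + t *\<^sub>R axis i 1) * ?e (x + t *\<^sub>R axis i 1)) \<longlongrightarrow> 0) at_bot" if "\<Gamma> i = Line" for x
      by ((rule lim[OF that]), real_asymp)+
    show "\<psi> (x + L *\<^sub>R axis i 1) * ?e (x + L *\<^sub>R axis i 1) = \<psi> x * ?e x" if "\<Gamma> i = Circle L" for L x
      unfolding character_periodic[OF assms(1,3) that]
      using schwartz_periodic[OF assms(2)] that by (simp add: periodic_def)
  qed
  also have "(LINT x:fundamental_cell \<Gamma>|lborel. partial_deriv i \<psi> x * ?e x + c * (\<psi> x * ?e x))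
      = (LINT x:fundamental_cell \<Gamma>|lborel. partial_deriv i \<psi> x * ?e x) + c * (LINT x:fundamental_cell \<Gamma>|lborel. \<psi> x * ?e x)"
    using int by (subst set_integral_add) (auto intro: set_integrable_mult_right)
  finally have "(LINT x:fundamental_cell \<Gamma>|lborel. partial_deriv i \<psi> x * ?e x) = - c * (LINT x:fundamental_cell \<Gamma>|lborel. \<psi> x * ?e x)"
    by (simp add: eq_neg_iff_add_eq_0)
  then show ?thesis by (simp add: fourier_def c_def)
qed

lemma power_times_fourier_le:
  assumes "admissible \<Gamma>" "\<psi> \<in> schwartz \<Gamma>" "\<xi> \<in> dual_group \<Gamma>"
  shows "\<bar>\<xi> $ i\<bar> ^ N * norm (fourier \<Gamma> \<psi> \<xi>) \<le> norm (fourier \<Gamma> (partial_derivs (replicate N i) \<psi>) \<xi>)"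
proof (induction N)
  case (Suc N)
  let ?g = "partial_derivs (replicate N i) \<psi>"
  have "\<bar>\<xi> $ i\<bar> ^ Suc N * norm (fourier \<Gamma> \<psi> \<xi>) \<le> \<bar>\<xi> $ i\<bar> * norm (fourier \<Gamma> ?g \<xi>)"
    using mult_left_mono[OF Suc, of "\<bar>\<xi> $ i\<bar>"] by (simp add: mult_ac)
  also have "\<dots> \<le> 2 * pi * (\<bar>\<xi> $ i\<bar> * norm (fourier \<Gamma> ?g \<xi>))"
    using mult_right_mono[of 1 "2 * pi" "\<bar>\<xi> $ i\<bar> * norm (fourier \<Gamma> ?g \<xi>)"] pi_ge_two by simp
  also have "\<dots> = norm (fourier \<Gamma> (partial_derivs (replicate (Suc N) i) \<psi>) \<xi>)"
    using fourier_partial_deriv[OF assms(1) schwartz_partial_derivs[OF assms(2)] assms(3)]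
    by (simp add: partial_derivs_Cons norm_mult)
  finally show ?case .
qed simp

definition dual_decay :: "real ^ 'n::finite \<Rightarrow> real" where
  "dual_decay \<xi> = (\<Prod>i\<in>UNIV. 1 / (1 + (\<xi> $ i)\<^sup>2))"

lemma dual_decay_pos: "0 < dual_decay \<xi>"
  unfolding dual_decay_def by (intro prod_pos) (auto simp: add_pos_nonneg)

lemma dual_decay_le_1: "dual_decay \<xi> \<le> 1"
  unfolding dual_decay_def by (intro prod_le_1) (auto simp: add_pos_nonneg divide_le_eq)

lemma dual_decay_continuous: "continuous_on S dual_decay"
  unfolding dual_decay_def by (intro continuous_intros) (auto simp: add_nonneg_eq_0_iff)

lemma dual_decay_borel [measurable]: "dual_decay \<in> borel_measurable borel"
  by (intro borel_measurable_continuous_onI dual_decay_continuous)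

text \<open>
  The order of the derivatives is dictated by the \<open>CARD('n)\<close> quadratic factors of \<open>dual_decay\<close>, the weight
  by the integrability of \<open>cell_decay\<close>.
\<close>

definition decay_seminorm :: "('n::finite \<Rightarrow> factor) \<Rightarrow> (real ^ 'n \<Rightarrow> complex) \<Rightarrow> real" where
  "decay_seminorm \<Gamma> \<psi> = (\<Sum>is\<in>insert [] (range (replicate (2 * CARD('n)))). schwartz_seminorm \<Gamma> (2 * CARD('n)) is \<psi>)"

lemma schwartz_seminorm_le_decay_seminorm:
  fixes \<psi> :: "real ^ 'n::finite \<Rightarrow> complex"
  assumes "\<psi> \<in> schwartz \<Gamma>" "is \<in> insert [] (range (replicate (2 * CARD('n))))"
  shows "schwartz_seminorm \<Gamma> (2 * CARD('n)) is \<psi> \<le> decay_seminorm \<Gamma> \<psi>"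
  unfolding decay_seminorm_def using assms
  by (intro member_le_sum schwartz_seminorm_nonneg) auto

text \<open>
  The largest coordinate of \<open>\<xi>\<close> controls the whole product in \<open>dual_decay\<close>, so that pure
  derivatives of one fixed order suffice.
\<close>

lemma fourier_decay:
  assumes "admissible (\<Gamma> :: 'n::finite \<Rightarrow> factor)"
  obtains A where "A \<ge> 0" "\<And>\<psi> \<xi>. \<psi> \<in> schwartz \<Gamma> \<Longrightarrow> \<xi> \<in> dual_group \<Gamma> \<Longrightarrow>
    norm (fourier \<Gamma> \<psi> \<xi>) \<le> A * decay_seminorm \<Gamma> \<psi> * dual_decay \<xi>"
proof
  let ?d = "CARD('n)"
  let ?K = "\<bar>ft_const \<Gamma>\<bar> * (LINT x:fundamental_cell \<Gamma>|lborel. cell_decay \<Gamma> x)"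
  have K: "?K \<ge> 0"
    using cell_decay_pos[of \<Gamma>] by (auto simp: set_lebesgue_integral_def less_imp_le
        intro!: mult_nonneg_nonneg Bochner_Integration.integral_nonneg)
  show "2 ^ ?d * (2 * ?K) \<ge> 0" using K by simp
  fix \<psi> \<xi> assume \<psi>: "\<psi> \<in> schwartz \<Gamma>" and \<xi>: "\<xi> \<in> dual_group \<Gamma>"
  let ?n = "norm (fourier \<Gamma> \<psi> \<xi>)"
  obtain k where k: "\<And>i. \<bar>\<xi> $ i\<bar> \<le> \<bar>\<xi> $ k\<bar>" using finite_arg_max_abs[of "\<lambda>i. \<xi> $ i"] by metis
  have "(\<Prod>i\<in>UNIV. 1 + (\<xi> $ i)\<^sup>2) \<le> (\<Prod>i\<in>(UNIV::'n set). 1 + (\<xi> $ k)\<^sup>2)"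
    using k by (intro prod_mono) (auto simp: abs_le_square_iff)
  also have "\<dots> = (1 + (\<xi> $ k)\<^sup>2) ^ ?d" by simp
  also have "\<dots> \<le> (2 * max 1 ((\<xi> $ k)\<^sup>2)) ^ ?d" by (intro power_mono) auto
  also have "\<dots> = 2 ^ ?d * max 1 ((\<xi> $ k)\<^sup>2) ^ ?d" by (rule power_mult_distrib)
  also have "max 1 ((\<xi> $ k)\<^sup>2) ^ ?d \<le> 1 + \<bar>\<xi> $ k\<bar> ^ (2 * ?d)"
    by (auto simp: max_def power_mult)
  finally have "(\<Prod>i\<in>UNIV. 1 + (\<xi> $ i)\<^sup>2) * ?n \<le> (2 ^ ?d * (1 + \<bar>\<xi> $ k\<bar> ^ (2 * ?d))) * ?n"
    by (intro mult_right_mono) auto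
  also have "\<dots> = 2 ^ ?d * (?n + \<bar>\<xi> $ k\<bar> ^ (2 * ?d) * ?n)" by (simp add: algebra_simps)
  also have "\<dots> \<le> 2 ^ ?d * (?K * decay_seminorm \<Gamma> \<psi> + ?K * decay_seminorm \<Gamma> \<psi>)"
  proof (intro mult_left_mono add_mono)
    show "?n \<le> ?K * decay_seminorm \<Gamma> \<psi>"
      using norm_fourier_le[OF \<psi>, of \<xi>] mult_left_mono[OF schwartz_seminorm_le_decay_seminorm[OF \<psi>, of "[]"] K]
      by simp
    have "\<bar>\<xi> $ k\<bar> ^ (2 * ?d) * ?n \<le> norm (fourier \<Gamma> (partial_derivs (replicate (2 * ?d) k) \<psi>) \<xi>)"
      by (rule power_times_fourier_le[OF assms \<psi> \<xi>])
    also have "\<dots> \<le> ?K * schwartz_seminorm \<Gamma> (2 * ?d) (replicate (2 * ?d) k) \<psi>"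
      using norm_fourier_le[OF schwartz_partial_derivs[OF \<psi>], of "replicate (2 * ?d) k" \<xi>]
      by (simp add: schwartz_seminorm_partial_derivs)
    also have "\<dots> \<le> ?K * decay_seminorm \<Gamma> \<psi>"
      by (intro mult_left_mono schwartz_seminorm_le_decay_seminorm \<psi> K) auto
    finally show "\<bar>\<xi> $ k\<bar> ^ (2 * ?d) * ?n \<le> ?K * decay_seminorm \<Gamma> \<psi>" .
  qed auto
  finally have "(\<Prod>i\<in>UNIV. 1 + (\<xi> $ i)\<^sup>2) * ?n \<le> 2 ^ ?d * (2 * ?K) * decay_seminorm \<Gamma> \<psi>" by (simp add: mult_ac)
  then have "dual_decay \<xi> * ((\<Prod>i\<in>UNIV. 1 + (\<xi> $ i)\<^sup>2) * ?n) \<le> dual_decay \<xi> * (2 ^ ?d * (2 * ?K) * decay_seminorm \<Gamma> \<psi>)"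
    by (intro mult_left_mono less_imp_le[OF dual_decay_pos])
  moreover have "dual_decay \<xi> * (\<Prod>i\<in>UNIV. 1 + (\<xi> $ i)\<^sup>2) = 1"
    by (simp add: dual_decay_def prod.distrib[symmetric] add_nonneg_eq_0_iff)
  then have "dual_decay \<xi> * ((\<Prod>i\<in>UNIV. 1 + (\<xi> $ i)\<^sup>2) * ?n) = ?n"
    by (simp only: mult.assoc[symmetric] mult_1_left)
  ultimately show "?n \<le> 2 ^ ?d * (2 * ?K) * decay_seminorm \<Gamma> \<psi> * dual_decay \<xi>"
    by (subst mult.commute[of _ "dual_decay \<xi>"]) (simp only:)
qed


section \<open>Fourier inversion for test functions\<close>

lemma integral_norm_bound_integral_AE:
  fixes f :: "'a \<Rightarrow> 'b::{banach, second_countable_topology}"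
  assumes "integrable M f" "integrable M g" "AE x in M. norm (f x) \<le> g x"
  shows "norm (integral\<^sup>L M f) \<le> integral\<^sup>L M g"
  by (rule order_trans[OF integral_norm_bound integral_mono_AE[OF integrable_norm[OF assms(1)] assms(2,3)]])

lemma cis_sum: "finite A \<Longrightarrow> cis (\<Sum>a\<in>A. f a) = (\<Prod>a\<in>A. cis (f a))"
  by (induction A rule: finite_induct) (simp_all add: cis_mult[symmetric])

text \<open>
  The inversion integral is regularised by a Gaussian in each line variable.  In a circle variable the
  cell is bounded, and the orthogonality of the characters gives the inversion formula at once.
\<close>

definition cutoff :: "real \<Rightarrow> factor \<Rightarrow> real \<Rightarrow> real" where
  "cutoff \<sigma> F t = (case F of Line \<Rightarrow> exp (- (2 * pi * \<sigma> * t)\<^sup>2 / 2) | Circle L \<Rightarrow> 1)"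

text \<open>
  The Fourier transform of the cutoff, normalised to total mass one, as a function of the dual variable \<open>t\<close>
  and centred at \<open>a\<close>: a normal density in the line directions, a point mass in the circle directions.
\<close>

definition summation_kernel :: "real \<Rightarrow> factor \<Rightarrow> real \<Rightarrow> real \<Rightarrow> real" where
  "summation_kernel \<sigma> F a t = (case F of Line \<Rightarrow> normal_density a \<sigma> t | Circle L \<Rightarrow> indicator {a} t)"

lemma cutoff_borel [measurable]: "cutoff \<sigma> F \<in> borel_measurable borel"
  by (cases F) (simp_all add: cutoff_def[abs_def])

lemma summation_kernel_borel [measurable]: "summation_kernel \<sigma> F a \<in> borel_measurable borel"
  by (cases F) (simp_all add: summation_kernel_def[abs_def])

lemma
  assumes "\<sigma> > 0"
  shows integrable_gaussian: "integrable lborel (\<lambda>t. exp (- (2 * pi * \<sigma> * t)\<^sup>2 / 2))"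
    and gaussian_transform: "(LINT t|lborel. exp (- (2 * pi * \<sigma> * t)\<^sup>2 / 2) *\<^sub>R cis (2 * pi * b * t)) = normal_density 0 \<sigma> b"
proof -
  \<comment> \<open>The substitution \<open>x = c * t\<close> in the characteristic function of the standard normal distribution.\<close>
  define c where "c = 2 * pi * \<sigma>"
  have c: "c > 0" using assms by (simp add: c_def)
  have dens: "std_normal_density x = exp (- x\<^sup>2 / 2) / sqrt (2 * pi)" for x
    by (simp add: std_normal_density_def)
  have "integrable lborel (\<lambda>t. std_normal_density (0 + c * t))"
    using c by (subst lborel_integrable_real_affine_iff) auto
  then have "integrable lborel (\<lambda>t. sqrt (2 * pi) * std_normal_density (0 + c * t))"
    by (rule integrable_mult_right)
  then show "integrable lborel (\<lambda>t. exp (- (2 * pi * \<sigma> * t)\<^sup>2 / 2))"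
    by (simp add: dens c_def)
  have "exp (- (b / \<sigma>)\<^sup>2 / 2) = char std_normal_distribution (b / \<sigma>)"
    by (simp add: char_std_normal_distribution)
  also have "\<dots> = (LINT x|lborel. std_normal_density x *\<^sub>R iexp (b / \<sigma> * x))"
    by (simp add: char_def integral_density normal_density_nonneg)
  also have "\<dots> = \<bar>c\<bar> *\<^sub>R (LINT t|lborel. std_normal_density (0 + c * t) *\<^sub>R iexp (b / \<sigma> * (0 + c * t)))"
    using c by (subst lborel_integral_real_affine[of c _ 0]) auto
  also have "(\<lambda>t. std_normal_density (0 + c * t) *\<^sub>R iexp (b / \<sigma> * (0 + c * t)))
      = (\<lambda>t. (1 / sqrt (2 * pi)) *\<^sub>R (exp (- (2 * pi * \<sigma> * t)\<^sup>2 / 2) *\<^sub>R cis (2 * pi * b * t)))"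
  proof
    fix t
    have "b / \<sigma> * (0 + c * t) = 2 * pi * b * t" using assms by (simp add: c_def)
    then have "iexp (b / \<sigma> * (0 + c * t)) = cis (2 * pi * b * t)" by (simp only: cis_conv_exp)
    then show "std_normal_density (0 + c * t) *\<^sub>R iexp (b / \<sigma> * (0 + c * t))
      = (1 / sqrt (2 * pi)) *\<^sub>R (exp (- (2 * pi * \<sigma> * t)\<^sup>2 / 2) *\<^sub>R cis (2 * pi * b * t))"
      by (simp only: dens c_def scaleR_scaleR add_0_left) simp
  qed
  also have "(LINT t|lborel. (1 / sqrt (2 * pi)) *\<^sub>R (exp (- (2 * pi * \<sigma> * t)\<^sup>2 / 2) *\<^sub>R cis (2 * pi * b * t)))
      = (1 / sqrt (2 * pi)) *\<^sub>R (LINT t|lborel. exp (- (2 * pi * \<sigma> * t)\<^sup>2 / 2) *\<^sub>R cis (2 * pi * b * t))"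
    by (rule integral_scaleR_right)
  finally have "complex_of_real (exp (- (b / \<sigma>)\<^sup>2 / 2)) =
      (c / sqrt (2 * pi)) *\<^sub>R (LINT t|lborel. exp (- (2 * pi * \<sigma> * t)\<^sup>2 / 2) *\<^sub>R cis (2 * pi * b * t))"
    using c by (simp only: scaleR_scaleR abs_of_pos times_divide_eq_right mult_1_right)
  moreover have "normal_density 0 \<sigma> b = sqrt (2 * pi) / c * exp (- (b / \<sigma>)\<^sup>2 / 2)"
  proof -
    have "sqrt (2 * pi) * sqrt (2 * pi) = 2 * pi" by simp
    then have "sqrt (2 * pi) / c = 1 / (sqrt (2 * pi) * \<sigma>)"
      using assms by (simp add: c_def field_simps)
    moreover have "sqrt (2 * pi * \<sigma>\<^sup>2) = sqrt (2 * pi) * \<sigma>"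
      using assms by (simp add: real_sqrt_mult)
    ultimately show ?thesis by (simp add: normal_density_def power_divide)
  qed
  ultimately show "(LINT t|lborel. exp (- (2 * pi * \<sigma> * t)\<^sup>2 / 2) *\<^sub>R cis (2 * pi * b * t)) = normal_density 0 \<sigma> b"
    using c by (simp add: scaleR_conv_of_real)
qed

lemma circle_transform:
  assumes "L > 0"
  shows "(LINT t|lborel. indicator {0..<L} t *\<^sub>R cis (2 * pi * (of_int n / L) * t)) = (if n = 0 then of_real L else 0)"
proof (cases "n = 0")
  case True
  then show ?thesis using assms by (simp add: scaleR_conv_of_real)
next
  case False
  define b where "b = 2 * pi * (of_int n / L)"
  have b: "b \<noteq> 0" using False assms by (simp add: b_def)
  have "(LINT t|lborel. indicator {0..<L} t *\<^sub>R cis (b * t)) = 0"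
  proof (rule integral_deriv_circle[where F = "\<lambda>t. exp (\<i> * b * of_real t) / (\<i> * b)"])
    show "((\<lambda>t. exp (\<i> * b * of_real t) / (\<i> * b)) has_vector_derivative cis (b * t)) (at t)" for t
      using b by (auto intro!: has_vector_derivative_real_field derivative_eq_intros simp: cis_conv_exp mult.assoc)
    have "cis (2 * pi * of_int n) = 1" by (rule cis_multiple_2pi) simp
    then have "exp (\<i> * b * of_real L) = 1"
      using assms by (simp add: b_def cis_conv_exp mult_ac)
    then show "exp (\<i> * b * of_real L) / (\<i> * b) = exp (\<i> * b * of_real 0) / (\<i> * b)" by simp
  qed (use assms in \<open>auto intro!: continuous_intros\<close>)
  then show ?thesis using False by (simp add: b_def)
qed

text \<open>
  The factor by which the transform of the cutoff differs from a kernel of total mass one; the product of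
  these factors is \<open>(ft_const \<Gamma>) powr (- 2)\<close>.
\<close>

definition circle_length :: "factor \<Rightarrow> real" where
  "circle_length F = (case F of Line \<Rightarrow> 1 | Circle L \<Rightarrow> L)"

lemma cutoff_cell_integrable:
  assumes "\<sigma> > 0"
  shows "set_integrable lborel (cell_factor F) (\<lambda>t. cutoff \<sigma> F t *\<^sub>R cis (b * t))"
proof (rule set_integrable_bound[where f = "cutoff \<sigma> F"])
  show "set_integrable lborel (cell_factor F) (cutoff \<sigma> F)"
  proof (cases F)
    case Line
    then show ?thesis using integrable_gaussian[OF assms]
      by (simp add: set_integrable_def cell_factor_def cutoff_def[abs_def])
  next
    case (Circle L)
    then show ?thesis
      by (cases "L \<ge> 0") (auto simp: set_integrable_def cell_factor_def cutoff_def[abs_def] integrable_indicator_iff)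
  qed
  show "set_borel_measurable lborel (cell_factor F) (\<lambda>t. cutoff \<sigma> F t *\<^sub>R cis (b * t))"
    unfolding set_borel_measurable_def by measurable
qed auto

lemma cutoff_transform:
  assumes "\<sigma> > 0" "a \<in> dual_factor F" "b \<in> dual_factor F" "\<And>L. F = Circle L \<Longrightarrow> L > 0"
  shows "(LINT t:cell_factor F|lborel. cutoff \<sigma> F t *\<^sub>R cis (2 * pi * (a - b) * t)) =
    of_real (circle_length F * summation_kernel \<sigma> F a b)"
proof (cases F)
  case Line
  have "normal_density 0 \<sigma> (a - b) = normal_density a \<sigma> b"
    by (simp add: normal_density_def power2_commute)
  then show ?thesis using gaussian_transform[OF assms(1), of "a - b"]
    by (simp add: Line set_lebesgue_integral_def cell_factor_def cutoff_def circle_length_def summation_kernel_def)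
next
  case (Circle L)
  then obtain k l :: int where kl: "a = of_int k / L" "b = of_int l / L" and L: "L > 0"
    using assms by (auto simp: dual_factor_def)
  then have "a - b = of_int (k - l) / L" by (simp add: diff_divide_distrib)
  then show ?thesis
    using circle_transform[OF L, of "k - l"] L kl
    by (auto simp: Circle set_lebesgue_integral_def cell_factor_def cutoff_def circle_length_def summation_kernel_def)
qed

lemma
  assumes \<sigma>: "\<sigma> > 0" and a: "a \<in> dual_factor F"
  shows summation_kernel_integrable: "integrable (dual_factor_measure F) (summation_kernel \<sigma> F a)"
    and summation_kernel_integral: "(LINT t|dual_factor_measure F. summation_kernel \<sigma> F a t) = 1"
    and summation_kernel_var_integrable: "integrable (dual_factor_measure F) (\<lambda>t. (t - a)\<^sup>2 * summation_kernel \<sigma> F a t)"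
    and summation_kernel_var: "(LINT t|dual_factor_measure F. (t - a)\<^sup>2 * summation_kernel \<sigma> F a t) \<le> \<sigma>\<^sup>2"
    and summation_kernel_nonneg: "summation_kernel \<sigma> F a t \<ge> 0"
proof -
  have "integrable (dual_factor_measure F) (summation_kernel \<sigma> F a) \<and>
      (LINT t|dual_factor_measure F. summation_kernel \<sigma> F a t) = 1 \<and>
      integrable (dual_factor_measure F) (\<lambda>t. (t - a)\<^sup>2 * summation_kernel \<sigma> F a t) \<and>
      (LINT t|dual_factor_measure F. (t - a)\<^sup>2 * summation_kernel \<sigma> F a t) \<le> \<sigma>\<^sup>2"
  proof (cases F)
    case Line
    have "has_bochner_integral lborel (\<lambda>x. normal_density a \<sigma> x * (x - a) ^ (2 * 1)) (fact (2 * 1) / ((2 / \<sigma>\<^sup>2) ^ 1 * fact 1))"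
      by (rule normal_moment_even[OF \<sigma>])
    then have "has_bochner_integral lborel (\<lambda>x. (x - a)\<^sup>2 * normal_density a \<sigma> x) (\<sigma>\<^sup>2)"
      by (simp add: mult.commute numeral_2_eq_2)
    then show ?thesis
      using \<sigma> by (simp add: Line dual_factor_measure_def summation_kernel_def[abs_def] has_bochner_integral_iff)
  next
    case (Circle L)
    have "integrable (count_space (dual_factor F)) (indicator {a} :: real \<Rightarrow> real)"
      using a by (simp add: integrable_indicator_iff)
    moreover have "(\<lambda>t. (t - a)\<^sup>2 * indicator {a} t) = (\<lambda>_. 0 :: real)"
      by (auto simp: indicator_def)
    moreover have "measure (count_space (dual_factor F)) ({a} \<inter> dual_factor F) = 1"
      using a by (simp add: measure_count_space)
    ultimately show ?thesis
      by (simp add: Circle dual_factor_measure_def summation_kernel_def[abs_def])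
  qed
  then show "integrable (dual_factor_measure F) (summation_kernel \<sigma> F a)"
    and "(LINT t|dual_factor_measure F. summation_kernel \<sigma> F a t) = 1"
    and "integrable (dual_factor_measure F) (\<lambda>t. (t - a)\<^sup>2 * summation_kernel \<sigma> F a t)"
    and "(LINT t|dual_factor_measure F. (t - a)\<^sup>2 * summation_kernel \<sigma> F a t) \<le> \<sigma>\<^sup>2" by auto
  show "summation_kernel \<sigma> F a t \<ge> 0"
    by (cases F) (simp_all add: summation_kernel_def normal_density_nonneg)
qed

lemma power2_norm_vec: "(norm (x :: real ^ 'n::finite))\<^sup>2 = (\<Sum>i\<in>UNIV. (x $ i)\<^sup>2)"
  by (simp only: power2_norm_eq_inner inner_vec_def) (simp add: power2_eq_square)

text \<open>
  A kernel concentrates at \<open>\<xi>\<close> as soon as its variance tends to zero, because a bounded function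
  that is continuous at \<open>\<xi>\<close> satisfies \<open>\<bar>\<phi> \<eta> - \<phi> \<xi>\<bar> \<le> e + C * \<bar>\<eta> - \<xi>\<bar>\<^sup>2\<close>.
\<close>

lemma summation_kernel_limit:
  fixes \<Gamma> :: "'n::finite \<Rightarrow> factor"
  assumes "admissible \<Gamma>" and \<phi>: "\<phi> \<in> null_extended_tests \<Gamma>" and \<xi>: "\<xi> \<in> dual_group \<Gamma>"
    and \<sigma>: "\<And>n. \<sigma> n > 0" "\<sigma> \<longlonglongrightarrow> 0"
  shows "(\<lambda>n. LINT \<eta>|dual_measure \<Gamma>. of_real (\<Prod>i\<in>UNIV. summation_kernel (\<sigma> n) (\<Gamma> i) (\<xi> $ i) (\<eta> $ i)) * \<phi> \<eta>) \<longlonglongrightarrow> \<phi> \<xi>"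
proof -
  define M where "M = dual_measure \<Gamma>"
  define k where "k n \<eta> = (\<Prod>i\<in>UNIV. summation_kernel (\<sigma> n) (\<Gamma> i) (\<xi> $ i) (\<eta> $ i))" for n and \<eta> :: "real ^ 'n"
  have \<xi>i: "\<xi> $ i \<in> dual_factor (\<Gamma> i)" for i using \<xi> by (simp add: dual_group_def)
  note [measurable] = test_borel[OF \<phi>]
  have k_borel [measurable]: "k n \<in> borel_measurable borel" for n unfolding k_def[abs_def] by measurable
  have k_nonneg: "k n \<eta> \<ge> 0" for n \<eta>
    unfolding k_def by (intro prod_nonneg ballI summation_kernel_nonneg \<sigma> \<xi>i)
  have k_int: "integrable M (k n)" and k1: "(LINT \<eta>|M. k n \<eta>) = 1" for n
    using integrable_dual_prod[where f = "\<lambda>i. summation_kernel (\<sigma> n) (\<Gamma> i) (\<xi> $ i)" and \<Gamma> = \<Gamma>]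
      integral_dual_prod[where f = "\<lambda>i. summation_kernel (\<sigma> n) (\<Gamma> i) (\<xi> $ i)" and \<Gamma> = \<Gamma>]
    by (simp_all add: k_def[abs_def] M_def summation_kernel_integrable summation_kernel_integral \<sigma> \<xi>i)
  have var: "integrable M (\<lambda>\<eta>. (\<eta> $ l - \<xi> $ l)\<^sup>2 * k n \<eta>) \<and> (LINT \<eta>|M. (\<eta> $ l - \<xi> $ l)\<^sup>2 * k n \<eta>) \<le> (\<sigma> n)\<^sup>2" for n l
  proof -
    define f where "f i t = (if i = l then (t - \<xi> $ i)\<^sup>2 else 1) * summation_kernel (\<sigma> n) (\<Gamma> i) (\<xi> $ i) t" for i t
    have f_borel: "f i \<in> borel_measurable borel" for i
      by (cases "i = l") (simp_all add: f_def[abs_def])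
    have f_int: "integrable (dual_factor_measure (\<Gamma> i)) (f i)" for i
      by (cases "i = l") (simp_all add: f_def[abs_def] summation_kernel_integrable summation_kernel_var_integrable \<sigma> \<xi>i)
    have "(\<Prod>i\<in>UNIV. if i = l then (\<eta> $ i - \<xi> $ i)\<^sup>2 else 1) = (\<eta> $ l - \<xi> $ l)\<^sup>2" for \<eta> :: "real ^ 'n"
      by (simp add: prod.delta)
    then have f_prod: "(\<Prod>i\<in>UNIV. f i (\<eta> $ i)) = (\<eta> $ l - \<xi> $ l)\<^sup>2 * k n \<eta>" for \<eta> :: "real ^ 'n"
      by (simp add: f_def k_def prod.distrib)
    have "(\<Prod>i\<in>UNIV. LINT t|dual_factor_measure (\<Gamma> i). f i t)
        = (LINT t|dual_factor_measure (\<Gamma> l). f l t) * (\<Prod>i\<in>UNIV - {l}. LINT t|dual_factor_measure (\<Gamma> i). f i t)"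
      by (rule prod.remove) auto
    also have "(\<Prod>i\<in>UNIV - {l}. LINT t|dual_factor_measure (\<Gamma> i). f i t) = 1"
      by (intro prod.neutral) (simp add: f_def summation_kernel_integral \<sigma> \<xi>i)
    finally have "(\<Prod>i\<in>UNIV. LINT t|dual_factor_measure (\<Gamma> i). f i t) \<le> (\<sigma> n)\<^sup>2"
      using summation_kernel_var[OF \<sigma>(1)[of n] \<xi>i[of l]] by (simp add: f_def)
    then show ?thesis
      using integrable_dual_prod[of f \<Gamma>, OF f_borel f_int] integral_dual_prod[of f \<Gamma>, OF f_borel f_int]
      by (simp add: f_prod M_def)
  qed
  obtain B where B: "\<And>\<xi>. norm (\<phi> \<xi>) \<le> B" "B > 0" using test_bounded[OF \<phi>] by blast
  have \<phi>k_int: "integrable M (\<lambda>\<eta>. of_real (k n \<eta>) * \<phi> \<eta>)" for n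
  proof (rule Bochner_Integration.integrable_bound)
    show "integrable M (\<lambda>\<eta>. k n \<eta> * B)" using k_int by simp
    show "AE \<eta> in M. norm (of_real (k n \<eta>) * \<phi> \<eta>) \<le> norm (k n \<eta> * B)"
      using B k_nonneg by (auto simp: norm_mult abs_mult intro!: mult_left_mono)
    have "(\<lambda>\<eta>. of_real (k n \<eta>) * \<phi> \<eta>) \<in> borel_measurable borel" by measurable
    then show "(\<lambda>\<eta>. of_real (k n \<eta>) * \<phi> \<eta>) \<in> borel_measurable M" by (simp add: M_def)
  qed
  have main: "\<exists>C. \<forall>n. norm ((LINT \<eta>|M. of_real (k n \<eta>) * \<phi> \<eta>) - \<phi> \<xi>) \<le> e + C * (\<sigma> n)\<^sup>2" if "e > 0" for e
  proof -
    have "continuous_on (dual_group \<Gamma>) \<phi>"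
      using \<phi> smooth_along_continuous by (auto simp: null_extended_tests_iff)
    then obtain \<delta> where \<delta>: "\<delta> > 0" "\<And>\<eta>. \<eta> \<in> dual_group \<Gamma> \<Longrightarrow> norm (\<eta> - \<xi>) < \<delta> \<Longrightarrow> norm (\<phi> \<eta> - \<phi> \<xi>) < e"
      using \<xi> \<open>e > 0\<close> unfolding continuous_on_iff dist_norm by metis
    \<comment> \<open>At distance at least \<open>\<delta>\<close> from \<open>\<xi>\<close> the trivial bound \<open>2 * B\<close> is at most \<open>C\<close> times the squared distance.\<close>
    define C where "C = 2 * B / \<delta>\<^sup>2"
    have C: "C \<ge> 0" using B by (simp add: C_def)
    have bound: "norm (\<phi> \<eta> - \<phi> \<xi>) \<le> e + C * (\<Sum>l\<in>UNIV. (\<eta> $ l - \<xi> $ l)\<^sup>2)" if "\<eta> \<in> dual_group \<Gamma>" for \<eta>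
    proof (cases "norm (\<eta> - \<xi>) < \<delta>")
      case True
      then show ?thesis using \<delta>(2)[OF that] C by (simp add: sum_nonneg add_increasing2 less_imp_le)
    next
      case False
      have "norm (\<phi> \<eta> - \<phi> \<xi>) \<le> 2 * B" using norm_triangle_ineq4[of "\<phi> \<eta>" "\<phi> \<xi>"] B(1)[of \<eta>] B(1)[of \<xi>] by simp
      also have "\<dots> = C * \<delta>\<^sup>2" using \<delta> by (simp add: C_def)
      also have "\<dots> \<le> C * (norm (\<eta> - \<xi>))\<^sup>2" using False \<delta> C by (intro mult_left_mono power_mono) auto
      finally show ?thesis using \<open>e > 0\<close> by (simp add: power2_norm_vec)
    qed
    have "norm ((LINT \<eta>|M. of_real (k n \<eta>) * \<phi> \<eta>) - \<phi> \<xi>) \<le> e + C * real CARD('n) * (\<sigma> n)\<^sup>2" for n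
    proof -
      have "(LINT \<eta>|M. of_real (k n \<eta>) * \<phi> \<eta>) - \<phi> \<xi> = (LINT \<eta>|M. of_real (k n \<eta>) * \<phi> \<eta>) - (LINT \<eta>|M. of_real (k n \<eta>) * \<phi> \<xi>)"
        using k1[of n] by (simp add: integral_complex_of_real)
      also have "\<dots> = (LINT \<eta>|M. of_real (k n \<eta>) * \<phi> \<eta> - of_real (k n \<eta>) * \<phi> \<xi>)"
        using \<phi>k_int k_int by (intro Bochner_Integration.integral_diff[symmetric]) auto
      also have "norm \<dots> \<le> (LINT \<eta>|M. e * k n \<eta> + C * (\<Sum>l\<in>UNIV. (\<eta> $ l - \<xi> $ l)\<^sup>2 * k n \<eta>))"
      proof (rule integral_norm_bound_integral_AE)
        show "AE \<eta> in M. norm (of_real (k n \<eta>) * \<phi> \<eta> - of_real (k n \<eta>) * \<phi> \<xi>) \<le> e * k n \<eta> + C * (\<Sum>l\<in>UNIV. (\<eta> $ l - \<xi> $ l)\<^sup>2 * k n \<eta>)"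
          using AE_dual_group[of \<Gamma>] unfolding M_def[symmetric]
        proof eventually_elim
          case (elim \<eta>)
          have "norm (of_real (k n \<eta>) * \<phi> \<eta> - of_real (k n \<eta>) * \<phi> \<xi>) = norm (\<phi> \<eta> - \<phi> \<xi>) * k n \<eta>"
            using k_nonneg by (simp add: right_diff_distrib[symmetric] norm_mult)
          also have "\<dots> \<le> (e + C * (\<Sum>l\<in>UNIV. (\<eta> $ l - \<xi> $ l)\<^sup>2)) * k n \<eta>"
            by (intro mult_right_mono bound elim k_nonneg)
          finally show ?case by (simp add: distrib_right sum_distrib_right mult.assoc)
        qed
      qed (use \<phi>k_int k_int var in auto)
      also have "\<dots> = e + C * (\<Sum>l\<in>UNIV. (LINT \<eta>|M. (\<eta> $ l - \<xi> $ l)\<^sup>2 * k n \<eta>))"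
        using k_int var k1 by simp
      also have "\<dots> \<le> e + C * (\<Sum>l\<in>(UNIV::'n set). (\<sigma> n)\<^sup>2)"
        using C var by (intro add_left_mono mult_left_mono sum_mono) auto
      finally show ?thesis by simp
    qed
    then show ?thesis by blast
  qed
  have "(\<lambda>n. LINT \<eta>|M. of_real (k n \<eta>) * \<phi> \<eta>) \<longlonglongrightarrow> \<phi> \<xi>"
  proof (rule LIMSEQ_I)
    fix r :: real assume "r > 0"
    then obtain C where C: "\<And>n. norm ((LINT \<eta>|M. of_real (k n \<eta>) * \<phi> \<eta>) - \<phi> \<xi>) \<le> r / 2 + C * (\<sigma> n)\<^sup>2"
      using main[of "r / 2"] by auto
    have "(\<lambda>n. C * (\<sigma> n)\<^sup>2) \<longlonglongrightarrow> 0" using \<sigma>(2) by (auto intro!: tendsto_eq_intros)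
    then have "\<forall>\<^sub>F n in sequentially. C * (\<sigma> n)\<^sup>2 < r / 2" using \<open>r > 0\<close> by (intro order_tendstoD) auto
    then obtain N where N: "\<And>n. n \<ge> N \<Longrightarrow> C * (\<sigma> n)\<^sup>2 < r / 2" by (auto simp: eventually_sequentially)
    show "\<exists>N. \<forall>n\<ge>N. norm ((LINT \<eta>|M. of_real (k n \<eta>) * \<phi> \<eta>) - \<phi> \<xi>) < r"
    proof (intro exI[of _ N] allI impI)
      fix n assume "n \<ge> N"
      then show "norm ((LINT \<eta>|M. of_real (k n \<eta>) * \<phi> \<eta>) - \<phi> \<xi>) < r"
        using C[of n] N[of n] by linarith
    qed
  qed
  then show ?thesis by (simp add: M_def k_def)
qed

text \<open>
  By the transposition formula, the regularised inversion integral is the pairing of \<open>\<phi>\<close> with the kernel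
  centred at \<open>\<xi>\<close>.  As \<open>\<sigma> \<rightarrow> 0\<close>, the former converges by domination, since \<open>fourier_dual \<Gamma> \<phi>\<close> is integrable over the
  cell, and the latter tends to \<open>\<phi> \<xi>\<close>.
\<close>

theorem fourier_inversion:
  fixes \<Gamma> :: "'n::finite \<Rightarrow> factor"
  assumes adm: "admissible \<Gamma>" and \<phi>: "\<phi> \<in> null_extended_tests \<Gamma>" and \<xi>: "\<xi> \<in> dual_group \<Gamma>"
  shows "fourier \<Gamma> (fourier_dual \<Gamma> \<phi>) (- \<xi>) = \<phi> \<xi>"
proof -
  define \<sigma> where "\<sigma> n = 1 / real (Suc n)" for n
  have \<sigma>: "\<sigma> n > 0" "\<sigma> \<longlonglongrightarrow> 0" for n unfolding \<sigma>_def by (simp, real_asymp)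
  define u where "u = fourier_dual \<Gamma> \<phi>"
  define e where "e x = cis (2 * pi * (\<xi> \<bullet> x))" for x
  define F where "F n x = (\<Prod>i\<in>UNIV. cutoff (\<sigma> n) (\<Gamma> i) (x $ i) *\<^sub>R cis (2 * pi * (\<xi> $ i) * x $ i))" for n and x :: "real ^ 'n"
  define P where "P = (\<Prod>i\<in>UNIV. circle_length (\<Gamma> i))"
  have u: "u \<in> schwartz \<Gamma>" unfolding u_def by (rule fourier_dual_schwartz[OF adm \<phi>])
  have F_eq: "F n x = of_real (\<Prod>i\<in>UNIV. cutoff (\<sigma> n) (\<Gamma> i) (x $ i)) * e x" for n x
    by (simp add: F_def e_def scaleR_conv_of_real prod.distrib cis_sum[symmetric] inner_vec_def sum_distrib_left mult.assoc)
  have F_int: "set_integrable lborel (fundamental_cell \<Gamma>) (F n)" for n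
    unfolding F_def
    by (rule integrable_cell_prod[where f = "\<lambda>i t. cutoff (\<sigma> n) (\<Gamma> i) t *\<^sub>R cis (2 * pi * (\<xi> $ i) * t)"])
      (measurable, rule cutoff_cell_integrable, rule \<sigma>)
  have F_fourier: "fourier \<Gamma> (F n) \<eta> = of_real (ft_const \<Gamma> * P) * of_real (\<Prod>i\<in>UNIV. summation_kernel (\<sigma> n) (\<Gamma> i) (\<xi> $ i) (\<eta> $ i))"
    if \<eta>: "\<eta> \<in> dual_group \<Gamma>" for n \<eta>
  proof -
    define f where "f i t = cutoff (\<sigma> n) (\<Gamma> i) t *\<^sub>R cis (2 * pi * (\<xi> $ i - \<eta> $ i) * t)" for i t
    have "F n x * cis (- 2 * pi * (\<eta> \<bullet> x)) = (\<Prod>i\<in>UNIV. f i (x $ i))" for x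
    proof -
      have "cis (- 2 * pi * (\<eta> \<bullet> x)) = (\<Prod>i\<in>UNIV. cis (- 2 * pi * (\<eta> $ i * x $ i)))"
        by (simp add: cis_sum[symmetric] inner_vec_def sum_distrib_left sum_negf)
      then show ?thesis
        unfolding F_def f_def by (simp add: prod.distrib[symmetric] cis_mult) (simp add: algebra_simps)
    qed
    then have "(LINT x:fundamental_cell \<Gamma>|lborel. F n x * cis (- 2 * pi * (\<eta> \<bullet> x)))
        = (LINT x:fundamental_cell \<Gamma>|lborel. (\<Prod>i\<in>UNIV. f i (x $ i)))" by simp
    also have "\<dots> = (\<Prod>i\<in>UNIV. LINT t:cell_factor (\<Gamma> i)|lborel. f i t)"
      by (rule integral_cell_prod) (auto simp: f_def[abs_def] cutoff_cell_integrable \<sigma>)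
    also have "\<dots> = (\<Prod>i\<in>UNIV. of_real (circle_length (\<Gamma> i) * summation_kernel (\<sigma> n) (\<Gamma> i) (\<xi> $ i) (\<eta> $ i)))"
      unfolding f_def using \<xi> \<eta> adm
      by (intro prod.cong refl cutoff_transform \<sigma>) (auto simp: dual_group_def admissible_def)
    finally show ?thesis
      by (simp add: fourier_def P_def prod.distrib)
  qed
  have lhs: "(\<lambda>n. LINT x:fundamental_cell \<Gamma>|lborel. F n x * u x) \<longlonglongrightarrow> of_real (ft_const \<Gamma> * P) * \<phi> \<xi>"
  proof -
    have "(LINT x:fundamental_cell \<Gamma>|lborel. F n x * u x)
        = of_real (ft_const \<Gamma> * P) * (LINT \<eta>|dual_measure \<Gamma>. of_real (\<Prod>i\<in>UNIV. summation_kernel (\<sigma> n) (\<Gamma> i) (\<xi> $ i) (\<eta> $ i)) * \<phi> \<eta>)" for n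
    proof -
      have [measurable]: "(\<lambda>x. indicator (fundamental_cell \<Gamma>) x *\<^sub>R F n x) \<in> borel_measurable borel"
        using F_int[of n] by (auto simp: set_integrable_def dest: borel_measurable_integrable)
      have [measurable]: "\<phi> \<in> borel_measurable borel" by (rule test_borel[OF \<phi>])
      have "(\<lambda>\<eta>. LINT x|lborel. (indicator (fundamental_cell \<Gamma>) x *\<^sub>R F n x) * cis (- 2 * pi * (\<eta> \<bullet> x))) \<in> borel_measurable borel"
        by measurable
      then have [measurable]: "fourier \<Gamma> (F n) \<in> borel_measurable borel"
        unfolding fourier_def[abs_def] set_lebesgue_integral_def by simp
      have "(LINT x:fundamental_cell \<Gamma>|lborel. F n x * u x) = (LINT \<eta>|dual_measure \<Gamma>. fourier \<Gamma> (F n) \<eta> * \<phi> \<eta>)"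
        unfolding u_def by (rule fourier_transpose[symmetric, OF F_int test_integrable[OF adm \<phi>]])
      also have "\<dots> = (LINT \<eta>|dual_measure \<Gamma>. of_real (ft_const \<Gamma> * P) *
          (of_real (\<Prod>i\<in>UNIV. summation_kernel (\<sigma> n) (\<Gamma> i) (\<xi> $ i) (\<eta> $ i)) * \<phi> \<eta>))"
      proof (rule integral_cong_AE)
        show "AE \<eta> in dual_measure \<Gamma>. fourier \<Gamma> (F n) \<eta> * \<phi> \<eta> = of_real (ft_const \<Gamma> * P) *
          (of_real (\<Prod>i\<in>UNIV. summation_kernel (\<sigma> n) (\<Gamma> i) (\<xi> $ i) (\<eta> $ i)) * \<phi> \<eta>)"
          using AE_dual_group by eventually_elim (simp only: F_fourier mult.assoc)
      qed measurable
      also have "\<dots> = of_real (ft_const \<Gamma> * P) * (LINT \<eta>|dual_measure \<Gamma>. of_real (\<Prod>i\<in>UNIV. summation_kernel (\<sigma> n) (\<Gamma> i) (\<xi> $ i) (\<eta> $ i)) * \<phi> \<eta>)"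
        by (rule integral_mult_right_zero)
      finally show ?thesis .
    qed
    then show ?thesis
      using summation_kernel_limit[OF adm \<phi> \<xi> \<sigma>] by (simp only:) (intro tendsto_intros)
  qed
  have rhs: "(\<lambda>n. LINT x:fundamental_cell \<Gamma>|lborel. F n x * u x) \<longlonglongrightarrow> (LINT x:fundamental_cell \<Gamma>|lborel. e x * u x)"
    unfolding set_lebesgue_integral_def
  proof (rule integral_dominated_convergence)
    have [measurable]: "u \<in> borel_measurable borel" by (rule schwartz_borel[OF u])
    have [measurable]: "e \<in> borel_measurable borel" unfolding e_def[abs_def] by measurable
    have [measurable]: "F n \<in> borel_measurable borel" for n unfolding F_eq[abs_def] by measurable
    show "(\<lambda>x. indicator (fundamental_cell \<Gamma>) x *\<^sub>R (e x * u x)) \<in> borel_measurable lborel" by measurable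
    show "(\<lambda>x. indicator (fundamental_cell \<Gamma>) x *\<^sub>R (F n x * u x)) \<in> borel_measurable lborel" for n by measurable
    have "integrable lborel (\<lambda>x. indicator (fundamental_cell \<Gamma>) x *\<^sub>R u x)"
      using schwartz_cell_integrable[OF u, of "\<lambda>_. 1"] by (simp add: set_integrable_def)
    then show "integrable lborel (\<lambda>x. norm (indicator (fundamental_cell \<Gamma>) x *\<^sub>R u x))"
      by (rule integrable_norm)
    have c1: "0 \<le> cutoff s G t \<and> cutoff s G t \<le> 1" for s G t by (cases G) (simp_all add: cutoff_def)
    have "norm (F n x) \<le> 1" for n x
      unfolding F_eq e_def norm_mult norm_of_real using c1
      by (simp add: abs_prod abs_of_nonneg prod_le_1 del: of_real_prod)
    then have "norm (F n x * u x) \<le> norm (u x)" for n x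
      unfolding norm_mult by (intro mult_left_le_one_le) auto
    then show "AE x in lborel. norm (indicator (fundamental_cell \<Gamma>) x *\<^sub>R (F n x * u x)) \<le> norm (indicator (fundamental_cell \<Gamma>) x *\<^sub>R u x)" for n
      by (intro AE_I2) (simp add: mult_left_mono)
    have "(\<lambda>n. cutoff (\<sigma> n) G t) \<longlonglongrightarrow> 1" for G t
      using \<sigma>(2) by (cases G) (auto simp: cutoff_def intro!: tendsto_eq_intros)
    then have "(\<lambda>n. \<Prod>i\<in>UNIV. cutoff (\<sigma> n) (\<Gamma> i) (x $ i)) \<longlonglongrightarrow> (\<Prod>i\<in>(UNIV::'n set). 1)" for x :: "real ^ 'n"
      by (intro tendsto_prod)
    then have "(\<lambda>n. F n x) \<longlonglongrightarrow> of_real 1 * e x" for x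
      unfolding F_eq by (intro tendsto_intros tendsto_of_real) simp
    then have "(\<lambda>n. indicator (fundamental_cell \<Gamma>) x *\<^sub>R (F n x * u x)) \<longlonglongrightarrow> indicator (fundamental_cell \<Gamma>) x *\<^sub>R (e x * u x)" for x
      by (intro tendsto_intros) simp
    then show "AE x in lborel. (\<lambda>n. indicator (fundamental_cell \<Gamma>) x *\<^sub>R (F n x * u x)) \<longlonglongrightarrow> indicator (fundamental_cell \<Gamma>) x *\<^sub>R (e x * u x)"
      by simp
  qed
  have eq: "(LINT x:fundamental_cell \<Gamma>|lborel. e x * u x) = of_real (ft_const \<Gamma> * P) * \<phi> \<xi>"
    by (rule LIMSEQ_unique[OF rhs lhs])
  have P: "P > 0"
    unfolding P_def using adm by (intro prod_pos) (auto simp: circle_length_def admissible_def split: factor.split)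
  have "ft_const \<Gamma> = P powr (- 1 / 2)" by (simp add: ft_const_def P_def circle_length_def)
  then have "ft_const \<Gamma> * ft_const \<Gamma> = P powr (- 1)" by (simp add: powr_add[symmetric])
  then have one: "ft_const \<Gamma> * ft_const \<Gamma> * P = 1" using P by (simp add: powr_minus)
  have "fourier \<Gamma> u (- \<xi>) = of_real (ft_const \<Gamma>) * (LINT x:fundamental_cell \<Gamma>|lborel. e x * u x)"
    by (simp add: fourier_def e_def mult.commute)
  also have "\<dots> = of_real (ft_const \<Gamma> * ft_const \<Gamma> * P) * \<phi> \<xi>"
    unfolding eq by simp
  finally show ?thesis by (simp add: one u_def)
qed


section \<open>Test functions separate locally integrable functions\<close>

text \<open>
  The functions \<open>t \<mapsto> p (1/t) exp (-1/t)\<close> on the positive half-line, continued by zero, form a class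
  that is closed under differentiation.
\<close>

definition flat_profile :: "real poly \<Rightarrow> real \<Rightarrow> real" where
  "flat_profile p t = (if t > 0 then poly p (1 / t) * exp (- (1 / t)) else 0)"

lemma power_poly_exp_tendsto_0: "((\<lambda>u::real. u ^ k * poly p u * exp (- u)) \<longlongrightarrow> 0) at_top"
proof (induction p arbitrary: k)
  case (pCons a p)
  have "((\<lambda>u. a * (u ^ k / exp u) + u ^ Suc k * poly p u * exp (- u)) \<longlongrightarrow> a * 0 + 0) at_top"
    by (intro tendsto_intros tendsto_power_div_exp_0 pCons.IH)
  then show ?case by (simp add: algebra_simps exp_minus divide_inverse)
qed simp

lemma poly_exp_tendsto_0_at_right: "((\<lambda>t. poly p (1 / t) * exp (- (1 / t))) \<longlongrightarrow> (0::real)) (at_right 0)"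
proof -
  have "filterlim (\<lambda>t::real. 1 / t) at_top (at_right 0)" by real_asymp
  from filterlim_compose[OF power_poly_exp_tendsto_0[of 0 p] this] show ?thesis by simp
qed

lemma flat_profile_deriv:
  "(flat_profile p has_real_derivative flat_profile ([:0, 0, 1:] * (p - pderiv p)) t) (at t)"
proof -
  consider "t > 0" | "t < 0" | "t = 0" by linarith
  then show ?thesis
  proof cases
    case 1
    have d: "((\<lambda>t. poly p (1 / t) * exp (- (1 / t))) has_real_derivative
        flat_profile ([:0, 0, 1:] * (p - pderiv p)) t) (at t)"
      using 1 by (auto intro!: derivative_eq_intros DERIV_chain2[OF poly_DERIV]
          simp: flat_profile_def power2_eq_square field_simps)
    have ev: "\<forall>\<^sub>F t in nhds t. flat_profile p t = poly p (1 / t) * exp (- (1 / t))"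
      using eventually_nhds_in_open[of "{0<..}" t] 1 by (auto simp: flat_profile_def elim!: eventually_mono)
    show ?thesis by (rule DERIV_cong_ev[OF refl ev refl, THEN iffD2, OF d])
  next
    case 2
    have ev: "\<forall>\<^sub>F t in nhds t. flat_profile p t = 0"
      using eventually_nhds_in_open[of "{..<0}" t] 2 by (auto simp: flat_profile_def elim!: eventually_mono)
    have d: "((\<lambda>_. 0) has_real_derivative flat_profile ([:0, 0, 1:] * (p - pderiv p)) t) (at t)"
      using 2 by (simp add: flat_profile_def)
    show ?thesis by (rule DERIV_cong_ev[OF refl ev refl, THEN iffD2, OF d])
  next
    case 3
    have "((\<lambda>h. flat_profile p h / h) \<longlongrightarrow> 0) (at 0)"
      unfolding filterlim_at_split
    proof
      show "((\<lambda>h. flat_profile p h / h) \<longlongrightarrow> 0) (at_left 0)"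
        by (rule tendsto_eventually) (auto simp: eventually_at_filter flat_profile_def)
      have "\<forall>\<^sub>F h in at_right 0. poly ([:0, 1:] * p) (1 / h) * exp (- (1 / h)) = flat_profile p h / h"
        by (auto simp: eventually_at_filter flat_profile_def)
      then show "((\<lambda>h. flat_profile p h / h) \<longlongrightarrow> 0) (at_right 0)"
        by (rule Lim_transform_eventually[OF poly_exp_tendsto_0_at_right, rotated])
    qed
    then show ?thesis using 3 by (simp add: DERIV_def flat_profile_def)
  qed
qed

lemma flat_profile_continuous: "continuous_on S (flat_profile p)"
  using flat_profile_deriv DERIV_continuous by (blast intro: continuous_at_imp_continuous_on)

lemma smooth_upto_flat_profile:
  assumes "translation_closed D S"
  shows "smooth_upto k D S (\<lambda>\<xi>. of_real (d * flat_profile p (c * (\<xi> $ i - a))))"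
proof (induction k arbitrary: d p)
  case 0
  then show ?case by (auto intro!: continuous_intros continuous_on_compose2[OF flat_profile_continuous[of UNIV]])
next
  case (Suc k)
  let ?q = "[:0, 0, 1:] * (p - pderiv p)"
  show ?case
  proof (rule smooth_upto_SucI[OF assms, where
        f' = "\<lambda>l \<xi>. of_real ((if l = i then d * c else 0) * flat_profile ?q (c * (\<xi> $ i - a)))"])
    fix l and x :: "real ^ 'a"
    have "((\<lambda>t. d * flat_profile p (c * ((x + t *\<^sub>R axis l 1) $ i - a))) has_real_derivative
        (if l = i then d * c else 0) * flat_profile ?q (c * (x $ i - a))) (at 0)"
      by (cases "l = i") (auto simp: axis_def intro!: derivative_eq_intros DERIV_chain2[OF flat_profile_deriv])
    then show "((\<lambda>t. complex_of_real (d * flat_profile p (c * ((x + t *\<^sub>R axis l 1) $ i - a)))) has_vector_derivative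
        of_real ((if l = i then d * c else 0) * flat_profile ?q (c * (x $ i - a)))) (at 0)"
      by (rule has_vector_derivative_of_real)
    show "smooth_upto k D S (\<lambda>\<xi>. of_real ((if l = i then d * c else 0) * flat_profile ?q (c * (\<xi> $ i - a))))" for l
      by (rule Suc)
  qed (auto intro!: continuous_intros continuous_on_compose2[OF flat_profile_continuous[of UNIV]])
qed

lemma dual_factor_isolated:
  assumes "L > 0" "a \<in> dual_factor (Circle L)" "b \<in> dual_factor (Circle L)" "\<bar>a - b\<bar> < 1 / L"
  shows "a = b"
proof -
  obtain k l :: int where kl: "a = of_int k / L" "b = of_int l / L"
    using assms by (auto simp: dual_factor_def)
  then have "\<bar>a - b\<bar> = \<bar>of_int (k - l)\<bar> / L" using assms(1) by (simp add: diff_divide_distrib[symmetric] abs_divide)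
  then have "\<bar>of_int (k - l) :: real\<bar> < 1" using assms(1,4) by (simp add: divide_less_cancel)
  then have "k = l" by (simp only: of_int_abs[symmetric] of_int_less_1_iff)
  then show ?thesis using kl by simp
qed

lemma dual_groupD: "\<xi> \<in> dual_group \<Gamma> \<Longrightarrow> \<xi> $ i \<in> dual_factor (\<Gamma> i)"
  by (simp add: dual_group_def)

text \<open>A circle coordinate takes only isolated values on the dual group.\<close>

lemma smooth_upto_circle_coordinate:
  assumes "admissible \<Gamma>" "i \<notin> line_indices \<Gamma>"
  shows "smooth_upto k (line_indices \<Gamma>) (dual_group \<Gamma>) (\<lambda>\<xi>. h (\<xi> $ i))"
proof -
  obtain L where L: "\<Gamma> i = Circle L" "L > 0"
    using assms by (cases "\<Gamma> i") (auto simp: admissible_def line_indices_def)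
  have "continuous_on (dual_group \<Gamma>) (\<lambda>\<xi>. h (\<xi> $ i))"
    unfolding continuous_on_iff
  proof (intro ballI allI impI)
    fix \<xi> and e :: real assume \<xi>: "\<xi> \<in> dual_group \<Gamma>" and e: "e > 0"
    have "\<eta> $ i = \<xi> $ i" if "\<eta> \<in> dual_group \<Gamma>" "dist \<eta> \<xi> < 1 / L" for \<eta>
    proof (rule dual_factor_isolated[OF L(2)])
      show "\<eta> $ i \<in> dual_factor (Circle L)" "\<xi> $ i \<in> dual_factor (Circle L)"
        using dual_groupD[OF that(1), of i] dual_groupD[OF \<xi>, of i] L(1) by simp_all
      show "\<bar>\<eta> $ i - \<xi> $ i\<bar> < 1 / L"
        using component_le_norm_cart[of "\<eta> - \<xi>" i] that(2) by (simp add: dist_norm)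
    qed
    then show "\<exists>d>0. \<forall>\<eta>\<in>dual_group \<Gamma>. dist \<eta> \<xi> < d \<longrightarrow> dist (h (\<eta> $ i)) (h (\<xi> $ i)) < e"
      using L e by (intro exI[of _ "1 / L"]) auto
  qed
  then show ?thesis
  proof (cases k)
    case (Suc m)
    show ?thesis unfolding Suc
    proof (rule smooth_upto_SucI[where f' = "\<lambda>_ _. 0", OF translation_closed_dual_group])
      show "((\<lambda>t. h ((x + t *\<^sub>R axis l 1) $ i)) has_vector_derivative 0) (at 0)"
        if "l \<in> line_indices \<Gamma>" for l x
        using that assms(2) by (cases "l = i") (auto simp: axis_def)
    qed (simp_all add: \<open>continuous_on _ _\<close>)
  qed simp
qed

text \<open>
  The functions \<open>t \<mapsto> flat_profile 1 (n t)\<close> are smooth and converge to the indicator of the positive half-line.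
  The product of two of them approximates the indicator of an interval; on a circle coordinate the
  indicator itself is smooth on the dual group.
\<close>

definition bump_factor ::
    "('n::finite \<Rightarrow> factor) \<Rightarrow> real ^ 'n \<Rightarrow> real ^ 'n \<Rightarrow> nat \<Rightarrow> 'n \<Rightarrow> real ^ 'n \<Rightarrow> real" where
  "bump_factor \<Gamma> a b n i \<xi> = (if i \<in> line_indices \<Gamma>
     then flat_profile 1 (real n * (\<xi> $ i - a $ i)) * flat_profile 1 (- real n * (\<xi> $ i - b $ i))
     else indicator {a $ i<..<b $ i} (\<xi> $ i))"

definition box_bump :: "('n::finite \<Rightarrow> factor) \<Rightarrow> real ^ 'n \<Rightarrow> real ^ 'n \<Rightarrow> nat \<Rightarrow> real ^ 'n \<Rightarrow> real" where
  "box_bump \<Gamma> a b n \<xi> = indicator (dual_group \<Gamma>) \<xi> *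
     (\<Prod>i\<in>UNIV. bump_factor \<Gamma> a b n i \<xi>)"

lemma flat_profile_1_bounds: "0 \<le> flat_profile 1 t" "flat_profile 1 t \<le> 1"
  by (auto simp: flat_profile_def)

lemma flat_profile_1_limit: "(\<lambda>n. flat_profile 1 (real n * t)) \<longlonglongrightarrow> indicator {0<..} t"
proof (cases "t > 0")
  case True
  have "(\<lambda>n. exp (- (1 / (real n * t)))) \<longlonglongrightarrow> 1" using True by real_asymp
  moreover have "\<forall>\<^sub>F n in sequentially. exp (- (1 / (real n * t))) = flat_profile 1 (real n * t)"
    using eventually_gt_at_top[of 0] by eventually_elim (use True in \<open>auto simp: flat_profile_def\<close>)
  ultimately show ?thesis using True by (auto intro: Lim_transform_eventually)
next
  case False
  then have "flat_profile 1 (real n * t) = 0" for n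
    by (simp add: flat_profile_def not_less mult_nonneg_nonpos)
  then show ?thesis using False by simp
qed

lemma bump_factor_bounds: "0 \<le> bump_factor \<Gamma> a b n i \<xi>" "bump_factor \<Gamma> a b n i \<xi> \<le> 1"
  by (auto simp: bump_factor_def flat_profile_1_bounds intro!: mult_le_one)

lemma box_bump_bounds: "0 \<le> box_bump \<Gamma> a b n \<xi>" "box_bump \<Gamma> a b n \<xi> \<le> 1"
  unfolding box_bump_def
  by (auto intro!: mult_nonneg_nonneg prod_nonneg mult_le_one prod_le_1 simp: bump_factor_bounds)

lemma box_bump_support: "\<xi> \<notin> box a b \<Longrightarrow> box_bump \<Gamma> a b n \<xi> = 0"
proof -
  assume "\<xi> \<notin> box a b"
  then obtain i where "\<not> (a $ i < \<xi> $ i \<and> \<xi> $ i < b $ i)" by (auto simp: mem_box_cart)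
  then have "bump_factor \<Gamma> a b n i \<xi> = 0"
    by (auto simp: bump_factor_def flat_profile_def indicator_def zero_less_mult_iff mult_less_0_iff)
  then have "(\<Prod>i\<in>UNIV. bump_factor \<Gamma> a b n i \<xi>) = 0"
    by (intro prod_zero bexI[of _ i]) auto
  then show ?thesis by (simp add: box_bump_def)
qed

lemma box_bump_limit:
  assumes "\<xi> \<in> dual_group \<Gamma>"
  shows "(\<lambda>n. box_bump \<Gamma> a b n \<xi>) \<longlonglongrightarrow> indicator (box a b) \<xi>"
proof -
  have "(\<lambda>n. bump_factor \<Gamma> a b n i \<xi>) \<longlonglongrightarrow> indicator {a $ i<..<b $ i} (\<xi> $ i)" for i
  proof (cases "i \<in> line_indices \<Gamma>")
    case True
    have "(\<lambda>n. flat_profile 1 (real n * (\<xi> $ i - a $ i)) * flat_profile 1 (real n * (b $ i - \<xi> $ i)))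
        \<longlonglongrightarrow> indicator {0<..} (\<xi> $ i - a $ i) * indicator {0<..} (b $ i - \<xi> $ i)"
      by (intro tendsto_mult flat_profile_1_limit)
    moreover have "indicator {0<..} (\<xi> $ i - a $ i) * indicator {0<..} (b $ i - \<xi> $ i) = (indicator {a $ i<..<b $ i} (\<xi> $ i) :: real)"
      by (auto simp: indicator_def)
    moreover have "- real n * (\<xi> $ i - b $ i) = real n * (b $ i - \<xi> $ i)" for n by (simp add: algebra_simps)
    ultimately show ?thesis using True by (simp add: bump_factor_def)
  qed (simp add: bump_factor_def)
  then have "(\<lambda>n. \<Prod>i\<in>UNIV. bump_factor \<Gamma> a b n i \<xi>) \<longlonglongrightarrow> (\<Prod>i\<in>UNIV. indicator {a $ i<..<b $ i} (\<xi> $ i))"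
    by (rule tendsto_prod)
  moreover have "(\<Prod>i\<in>UNIV. indicator {a $ i<..<b $ i} (\<xi> $ i)) = (indicator (box a b) \<xi> :: real)"
  proof (cases "\<xi> \<in> box a b")
    case False
    then obtain i where "\<not> (a $ i < \<xi> $ i \<and> \<xi> $ i < b $ i)" by (auto simp: mem_box_cart)
    then have "(\<Prod>i\<in>UNIV. indicator {a $ i<..<b $ i} (\<xi> $ i)) = (0 :: real)"
      by (intro prod_zero bexI[of _ i]) auto
    then show ?thesis using False by simp
  qed (auto simp: mem_box_cart)
  ultimately show ?thesis using assms by (simp add: box_bump_def)
qed

lemma box_bump_test:
  assumes "admissible \<Gamma>"
  shows "(\<lambda>\<xi>. of_real (box_bump \<Gamma> a b n \<xi>)) \<in> null_extended_tests \<Gamma>"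
proof -
  note tc = translation_closed_dual_group[of \<Gamma>]
  have "smooth_upto k (line_indices \<Gamma>) (dual_group \<Gamma>) (\<lambda>\<xi>. of_real (bump_factor \<Gamma> a b n i \<xi>))" for k i
  proof (cases "i \<in> line_indices \<Gamma>")
    case True
    have "smooth_upto k (line_indices \<Gamma>) (dual_group \<Gamma>) (\<lambda>\<xi>. of_real (1 * flat_profile 1 (real n * (\<xi> $ i - a $ i))) *
        of_real (1 * flat_profile 1 (- real n * (\<xi> $ i - b $ i))))"
      by (intro smooth_upto_mult smooth_upto_flat_profile tc)
    then show ?thesis using True by (simp add: bump_factor_def)
  next
    case False
    then show ?thesis
      using smooth_upto_circle_coordinate[OF assms False, of k "\<lambda>t. of_real (indicator {a $ i<..<b $ i} t)"]
      by (simp add: bump_factor_def)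
  qed
  then have "smooth_upto k (line_indices \<Gamma>) (dual_group \<Gamma>) (\<lambda>\<xi>. \<Prod>i\<in>UNIV. of_real (bump_factor \<Gamma> a b n i \<xi>))" for k
    by (intro smooth_upto_prod[OF tc]) simp_all
  then have "smooth_upto k (line_indices \<Gamma>) (dual_group \<Gamma>) (\<lambda>\<xi>. of_real (box_bump \<Gamma> a b n \<xi>))" for k
    by (rule smooth_upto_cong[OF tc, rotated]) (simp add: box_bump_def)
  then have "smooth_along (line_indices \<Gamma>) (dual_group \<Gamma>) (\<lambda>\<xi>. of_real (box_bump \<Gamma> a b n \<xi>))"
    by (simp add: smooth_along_iff)
  moreover obtain B where "B > 0" "\<And>\<xi>. \<xi> \<in> box a b \<Longrightarrow> norm \<xi> \<le> B"
    using bounded_box[of a b] unfolding bounded_pos by blast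
  then have "\<exists>B>0. \<forall>\<xi>. norm \<xi> > B \<longrightarrow> complex_of_real (box_bump \<Gamma> a b n \<xi>) = 0"
    using box_bump_support by (metis not_less of_real_0)
  ultimately show ?thesis
    by (auto simp: null_extended_tests_iff box_bump_def)
qed

text \<open>
  The boxes are stable under intersection and generate the Borel sets.
\<close>

lemma set_integral_zero_of_boxes:
  fixes g :: "real ^ 'n::finite \<Rightarrow> complex"
  assumes "sets M = sets borel" "integrable M g" "integral\<^sup>L M g = 0" "\<And>a b. (LINT x:box a b|M. g x) = 0"
    "A \<in> sets borel"
  shows "(LINT x:A|M. g x) = 0"
proof -
  have sp: "space M = UNIV" using sets_eq_imp_space_eq[OF assms(1)] by simp
  have si: "set_integrable M A g" if "A \<in> sets borel" for A
    using that assms(1,2) by (auto intro: integrable_mult_indicator simp: set_integrable_def)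
  have gen: "sets borel = sigma_sets UNIV (range (\<lambda>(a, b). box a b :: (real ^ 'n) set))"
    unfolding borel_eq_box by simp
  have "Int_stable (range (\<lambda>(a, b). box a b :: (real ^ 'n) set))"
    by (auto simp: Int_stable_def box_Int_box)
  moreover have "range (\<lambda>(a, b). box a b :: (real ^ 'n) set) \<subseteq> Pow UNIV" by simp
  moreover have "A \<in> sigma_sets UNIV (range (\<lambda>(a, b). box a b :: (real ^ 'n) set))"
    using assms(5) gen by simp
  ultimately show ?thesis
  proof (induct rule: sigma_sets_induct_disjoint)
    case (basic A)
    then show ?case using assms(4) by auto
  next
    case empty
    show ?case by (simp add: set_lebesgue_integral_def)
  next
    case (compl A)
    have A: "A \<in> sets borel" using compl gen by simp
    have "(LINT x:A \<union> (UNIV - A)|M. g x) = (LINT x:A|M. g x) + (LINT x:UNIV - A|M. g x)"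
      using A by (intro set_integral_Un si) auto
    then show ?case using compl(2) assms(3) by (simp add: set_lebesgue_integral_def)
  next
    case (union A)
    have A: "A i \<in> sets borel" for i using union(2) gen by auto
    have "(LINT x:(\<Union>i. A i)|M. g x) = (\<Sum>i. (LINT x:A i|M. g x))"
      using A union(1) assms(1)
      by (intro lebesgue_integral_countable_add si) (auto simp: disjoint_family_on_def)
    then show ?case using union(3) by simp
  qed
qed

lemma AE_zero_of_set_integrals_real:
  fixes h :: "'a \<Rightarrow> real"
  assumes int: "integrable M h" and zero: "\<And>A. A \<in> sets M \<Longrightarrow> (LINT x:A|M. h x) = 0"
  shows "AE x in M. h x = 0"
proof -
  have [measurable]: "h \<in> borel_measurable M" using int by simp
  have pos: "AE x in M. f x \<le> 0"
    if int: "integrable M f" and zero: "\<And>A. A \<in> sets M \<Longrightarrow> (LINT x:A|M. f x) = 0" for f :: "'a \<Rightarrow> real"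
  proof -
    have [measurable]: "f \<in> borel_measurable M" using int by simp
    let ?A = "{x \<in> space M. f x > 0}"
    have A: "?A \<in> sets M" by measurable
    have "(LINT x|M. indicator ?A x *\<^sub>R f x) = 0" using zero[OF A] by (simp add: set_lebesgue_integral_def)
    moreover have "integrable M (\<lambda>x. indicator ?A x *\<^sub>R f x)" using int A by (intro integrable_mult_indicator)
    moreover have "AE x in M. 0 \<le> indicator ?A x *\<^sub>R f x" by (auto simp: indicator_def)
    ultimately have "AE x in M. indicator ?A x *\<^sub>R f x = 0"
      using integral_nonneg_eq_0_iff_AE by blast
    then show ?thesis by (rule AE_mp) (auto simp: indicator_def not_less intro!: AE_I2)
  qed
  have "AE x in M. h x \<le> 0" by (rule pos[OF assms])
  moreover have "AE x in M. - h x \<le> 0"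
    using int zero by (intro pos) (auto simp: set_lebesgue_integral_def)
  ultimately show ?thesis by eventually_elim simp
qed

lemma AE_zero_of_set_integrals:
  fixes g :: "'a \<Rightarrow> complex"
  assumes int: "integrable M g" and zero: "\<And>A. A \<in> sets M \<Longrightarrow> (LINT x:A|M. g x) = 0"
  shows "AE x in M. g x = 0"
proof -
  have si: "integrable M (\<lambda>x. indicator A x *\<^sub>R g x)" if "A \<in> sets M" for A
    using that int by (intro integrable_mult_indicator)
  have "(LINT x:A|M. Re (g x)) = Re (LINT x:A|M. g x)" "(LINT x:A|M. Im (g x)) = Im (LINT x:A|M. g x)"
    if "A \<in> sets M" for A
    using integral_Re[OF si[OF that]] integral_Im[OF si[OF that]] by (simp_all add: set_lebesgue_integral_def)
  then have "AE x in M. Re (g x) = 0" "AE x in M. Im (g x) = 0"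
    using int zero by (intro AE_zero_of_set_integrals_real; simp)+
  then show ?thesis by eventually_elim (simp add: complex_eq_iff)
qed

lemma locally_integrable_borel: "locally_integrable \<Gamma> g \<Longrightarrow> g \<in> borel_measurable borel"
  using measurable_cong_sets[OF sets_dual_measure refl] by (auto simp: locally_integrable_def)

lemma locally_integrable_test_mult:
  assumes "locally_integrable \<Gamma> g" "\<phi> \<in> null_extended_tests \<Gamma>"
  shows "integrable (dual_measure \<Gamma>) (\<lambda>\<xi>. g \<xi> * \<phi> \<xi>)"
proof -
  have [measurable]: "g \<in> borel_measurable borel" "\<phi> \<in> borel_measurable borel"
    by (rule locally_integrable_borel[OF assms(1)], rule test_borel[OF assms(2)])
  obtain B where B: "\<And>\<xi>. norm (\<phi> \<xi>) \<le> B" "B > 0" using test_bounded[OF assms(2)] by blast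
  obtain b where b: "\<And>\<xi>. norm \<xi> > b \<Longrightarrow> \<phi> \<xi> = 0" using assms(2) by (auto simp: null_extended_tests_iff)
  show ?thesis
  proof (rule Bochner_Integration.integrable_bound)
    show "integrable (dual_measure \<Gamma>) (\<lambda>\<xi>. B *\<^sub>R (indicator (cball 0 b) \<xi> *\<^sub>R g \<xi>))"
      using assms(1) by (intro integrable_scaleR_right) (auto simp: locally_integrable_def set_integrable_def)
    show "AE \<xi> in dual_measure \<Gamma>. norm (g \<xi> * \<phi> \<xi>) \<le> norm (B *\<^sub>R (indicator (cball 0 b) \<xi> *\<^sub>R g \<xi>))"
    proof (rule AE_I2)
      fix \<xi>
      show "norm (g \<xi> * \<phi> \<xi>) \<le> norm (B *\<^sub>R (indicator (cball 0 b) \<xi> *\<^sub>R g \<xi>))"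
        using B b[of \<xi>] by (cases "norm \<xi> > b") (auto simp: norm_mult mult.commute[of "norm (g \<xi>)"] mult_right_mono)
    qed
    show "(\<lambda>\<xi>. g \<xi> * \<phi> \<xi>) \<in> borel_measurable (dual_measure \<Gamma>)" by measurable
  qed
qed

text \<open>
  The smooth bumps converge to the indicators of boxes, and the integrals over boxes determine the
  function up to null sets.
\<close>

theorem AE_zero_of_tests:
  fixes \<Gamma> :: "'n::finite \<Rightarrow> factor"
  assumes adm: "admissible \<Gamma>" and g: "locally_integrable \<Gamma> g"
    and zero: "\<And>\<phi>. \<phi> \<in> null_extended_tests \<Gamma> \<Longrightarrow> (LINT \<xi>|dual_measure \<Gamma>. g \<xi> * \<phi> \<xi>) = 0"
  shows "AE \<xi> in dual_measure \<Gamma>. g \<xi> = 0"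
proof -
  define M where "M = dual_measure \<Gamma>"
  have M: "sets M = sets borel" "space M = UNIV" by (simp_all add: M_def)
  have [measurable]: "g \<in> borel_measurable borel" by (rule locally_integrable_borel[OF g])
  have box_int: "integrable M (\<lambda>\<xi>. indicator (cbox a b) \<xi> *\<^sub>R g \<xi>)" for a b
    using g by (simp add: locally_integrable_def set_integrable_def M_def)
  have box_zero: "(LINT \<xi>|M. indicator (box a b) \<xi> *\<^sub>R g \<xi>) = 0" for a b
  proof -
    have "(\<lambda>n. LINT \<xi>|M. g \<xi> * of_real (box_bump \<Gamma> a b n \<xi>)) \<longlonglongrightarrow> (LINT \<xi>|M. indicator (box a b) \<xi> *\<^sub>R g \<xi>)"
    proof (rule integral_dominated_convergence)
      show "integrable M (\<lambda>\<xi>. norm (indicator (cbox a b) \<xi> *\<^sub>R g \<xi>))" using box_int by (rule integrable_norm)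
      show "AE \<xi> in M. norm (g \<xi> * of_real (box_bump \<Gamma> a b n \<xi>)) \<le> norm (indicator (cbox a b) \<xi> *\<^sub>R g \<xi>)" for n
      proof (rule AE_I2)
        fix \<xi>
        show "norm (g \<xi> * of_real (box_bump \<Gamma> a b n \<xi>)) \<le> norm (indicator (cbox a b) \<xi> *\<^sub>R g \<xi>)"
          using box_bump_bounds[of \<Gamma> a b n \<xi>] box_bump_support[of \<xi> a b \<Gamma> n] box_subset_cbox[of a b]
          by (cases "\<xi> \<in> box a b") (auto simp: norm_mult mult_left_le)
      qed
      show "AE \<xi> in M. (\<lambda>n. g \<xi> * of_real (box_bump \<Gamma> a b n \<xi>)) \<longlonglongrightarrow> indicator (box a b) \<xi> *\<^sub>R g \<xi>"
        using AE_dual_group[of \<Gamma>] unfolding M_def[symmetric]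
      proof eventually_elim
        case (elim \<xi>)
        have "(\<lambda>n. g \<xi> * of_real (box_bump \<Gamma> a b n \<xi>)) \<longlonglongrightarrow> g \<xi> * of_real (indicator (box a b) \<xi>)"
          by (intro tendsto_intros tendsto_of_real box_bump_limit elim)
        then show ?case by (simp add: scaleR_conv_of_real mult.commute)
      qed
      have "(\<lambda>\<xi>. indicator (box a b) \<xi> *\<^sub>R g \<xi>) \<in> borel_measurable borel" by measurable
      then show "(\<lambda>\<xi>. indicator (box a b) \<xi> *\<^sub>R g \<xi>) \<in> borel_measurable M" by (simp add: M_def)
      show "(\<lambda>\<xi>. g \<xi> * of_real (box_bump \<Gamma> a b n \<xi>)) \<in> borel_measurable M" for n
        using locally_integrable_test_mult[OF g box_bump_test[OF adm]] by (simp add: M_def)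
    qed
    moreover have "(LINT \<xi>|M. g \<xi> * of_real (box_bump \<Gamma> a b n \<xi>)) = 0" for n
      unfolding M_def by (rule zero[OF box_bump_test[OF adm]])
    ultimately show ?thesis by (simp add: LIMSEQ_const_iff)
  qed
  have "AE \<xi> in M. indicator (box a b) \<xi> *\<^sub>R g \<xi> = 0" for a b
  proof (rule AE_zero_of_set_integrals)
    let ?g = "\<lambda>\<xi>. indicator (box a b) \<xi> *\<^sub>R g \<xi>"
    have "integrable M (\<lambda>\<xi>. indicator (box a b) \<xi> *\<^sub>R (indicator (cbox a b) \<xi> *\<^sub>R g \<xi>))"
      by (intro integrable_mult_indicator box_int) (simp add: M)
    also have "(\<lambda>\<xi>. indicator (box a b) \<xi> *\<^sub>R (indicator (cbox a b) \<xi> *\<^sub>R g \<xi>)) = ?g"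
      using box_subset_cbox[of a b] by (auto simp: fun_eq_iff indicator_def)
    finally show int: "integrable M ?g" .
    fix A assume A: "A \<in> sets M"
    show "(LINT x:A|M. ?g x) = 0"
    proof (rule set_integral_zero_of_boxes[OF M(1) int])
      show "integral\<^sup>L M ?g = 0" by (rule box_zero)
      fix a' b' :: "real ^ 'n"
      obtain a'' b'' where "box a' b' \<inter> box a b = box a'' b''"
        by (rule that) (rule box_Int_box)
      then have "indicator (box a' b') \<xi> *\<^sub>R ?g \<xi> = indicator (box a'' b'') \<xi> *\<^sub>R g \<xi>" for \<xi>
        by (simp add: indicator_inter_arith[symmetric])
      then show "(LINT x:box a' b'|M. ?g x) = 0" by (simp only: set_lebesgue_integral_def box_zero)
    qed (use A M in simp)
  qed
  then have "AE \<xi> in M. \<forall>n::nat. indicator (box (\<chi> i. - real n) (\<chi> i. real n)) \<xi> *\<^sub>R g \<xi> = 0"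
    by (subst AE_all_countable) simp
  then show ?thesis
    unfolding M_def[symmetric]
  proof eventually_elim
    case (elim \<xi>)
    obtain n :: nat where "norm \<xi> < real n" using reals_Archimedean2 by blast
    then have "\<bar>\<xi> $ i\<bar> < real n" for i using component_le_norm_cart[of \<xi> i] by simp
    then have "\<xi> \<in> box (\<chi> i. - real n) (\<chi> i. real n)" by (auto simp: mem_box_cart abs_less_iff minus_less_iff)
    then show ?case using elim by (metis indicator_simps(1) scaleR_one)
  qed
qed


section \<open>Tempered distributions with a prescribed Fourier transform\<close>

lemma cnj_borel [measurable]: "cnj \<in> borel_measurable borel"
  by (intro borel_measurable_continuous_onI continuous_intros)


lemma topspace_schwartz_topology: "topspace (schwartz_topology \<Gamma>) = schwartz \<Gamma>"
proof
  show "topspace (schwartz_topology \<Gamma>) \<subseteq> schwartz \<Gamma>"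
    unfolding schwartz_topology_def topology_generated_by_topspace by blast
  show "schwartz \<Gamma> \<subseteq> topspace (schwartz_topology \<Gamma>)"
  proof
    fix \<psi> assume \<psi>: "\<psi> \<in> schwartz \<Gamma>"
    let ?V = "{\<theta> \<in> schwartz \<Gamma>. schwartz_seminorm \<Gamma> 0 [] (\<lambda>x. \<theta> x - \<psi> x) < 1}"
    have "\<psi> \<in> ?V" using \<psi> by (simp add: schwartz_seminorm_def weighted_deriv_def)
    moreover have "?V \<in> {{\<theta> \<in> schwartz \<Gamma>. schwartz_seminorm \<Gamma> N is (\<lambda>x. \<theta> x - \<phi> x) < \<epsilon>} | N is \<phi> \<epsilon>.
        \<phi> \<in> schwartz \<Gamma> \<and> 0 < \<epsilon>}"
      using \<psi> by (intro CollectI exI[of _ 0] exI[of _ "[]"] exI[of _ \<psi>] exI[of _ "1::real"]) simp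
    ultimately show "\<psi> \<in> topspace (schwartz_topology \<Gamma>)"
      unfolding schwartz_topology_def topology_generated_by_topspace by (rule UnionI[rotated])
  qed
qed

text \<open>
  For a linear functional, a bound by finitely many seminorms gives around each point a basic
  neighbourhood that is mapped into a prescribed ball.
\<close>

lemma schwartz_functional_continuous:
  fixes f :: "'n::finite functional"
  assumes diff: "\<And>\<phi> \<psi>. \<phi> \<in> schwartz \<Gamma> \<Longrightarrow> \<psi> \<in> schwartz \<Gamma> \<Longrightarrow> f (\<lambda>x. \<phi> x - \<psi> x) = f \<phi> - f \<psi>"
    and bound: "\<And>\<psi>. \<psi> \<in> schwartz \<Gamma> \<Longrightarrow> norm (f \<psi>) \<le> C * decay_seminorm \<Gamma> \<psi>"
  shows "continuous_map (schwartz_topology \<Gamma>) euclidean f"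
proof -
  have "openin (schwartz_topology \<Gamma>) {\<psi> \<in> schwartz \<Gamma>. f \<psi> \<in> U}" if U: "open U" for U
  proof (subst openin_subopen, safe)
    fix \<psi> assume \<psi>: "\<psi> \<in> schwartz \<Gamma>" "f \<psi> \<in> U"
    obtain e where e: "e > 0" "ball (f \<psi>) e \<subseteq> U" using U \<psi>(2) open_contains_ball by blast
    let ?I = "insert [] (range (replicate (2 * CARD('n)))) :: 'n list set"
    \<comment> \<open>The summand \<open>1\<close> makes the final estimate strict and the denominator positive.\<close>
    define \<epsilon> where "\<epsilon> = e / (\<bar>C\<bar> * real (card ?I) + 1)"
    have pos: "\<bar>C\<bar> * real (card ?I) + 1 > 0" by (simp add: add_nonneg_pos)
    then have \<epsilon>: "\<epsilon> > 0" using e by (simp add: \<epsilon>_def)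
    define V where "V is = {\<theta> \<in> schwartz \<Gamma>. schwartz_seminorm \<Gamma> (2 * CARD('n)) is (\<lambda>x. \<theta> x - \<psi> x) < \<epsilon>}" for "is"
    have V_open: "openin (schwartz_topology \<Gamma>) (V is)" for "is"
      unfolding schwartz_topology_def V_def
      by (rule topology_generated_by_Basis) (use \<psi> \<epsilon> in blast)
    have "openin (schwartz_topology \<Gamma>) (\<Inter>(V ` ?I))"
      by (rule openin_Inter) (use V_open in auto)
    moreover have "\<psi> \<in> \<Inter>(V ` ?I)"
      using \<psi> \<epsilon> by (auto simp: V_def schwartz_seminorm_def weighted_deriv_def partial_derivs_zero)
    moreover have "\<Inter>(V ` ?I) \<subseteq> {\<psi> \<in> schwartz \<Gamma>. f \<psi> \<in> U}"
    proof
      fix \<theta> assume \<theta>: "\<theta> \<in> \<Inter>(V ` ?I)"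
      then have sch: "\<theta> \<in> schwartz \<Gamma>" by (auto simp: V_def)
      have d: "(\<lambda>x. \<theta> x - \<psi> x) \<in> schwartz \<Gamma>" by (rule schwartz_diff[OF sch \<psi>(1)])
      have "decay_seminorm \<Gamma> (\<lambda>x. \<theta> x - \<psi> x) \<le> (\<Sum>is\<in>?I. \<epsilon>)"
        unfolding decay_seminorm_def using \<theta> by (intro sum_mono) (auto simp: V_def less_imp_le)
      then have le: "decay_seminorm \<Gamma> (\<lambda>x. \<theta> x - \<psi> x) \<le> real (card ?I) * \<epsilon>" by simp
      have nn: "0 \<le> decay_seminorm \<Gamma> (\<lambda>x. \<theta> x - \<psi> x)"
        unfolding decay_seminorm_def by (intro sum_nonneg schwartz_seminorm_nonneg d)
      have "norm (f \<theta> - f \<psi>) \<le> C * decay_seminorm \<Gamma> (\<lambda>x. \<theta> x - \<psi> x)"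
        using bound[OF d] diff[OF sch \<psi>(1)] by simp
      also have "\<dots> \<le> \<bar>C\<bar> * (real (card ?I) * \<epsilon>)"
        using le nn by (intro mult_mono) auto
      also have "\<dots> < (\<bar>C\<bar> * real (card ?I) + 1) * \<epsilon>" using \<epsilon> by (simp add: algebra_simps)
      also have "\<dots> = e" using pos by (simp add: \<epsilon>_def)
      finally have "f \<theta> \<in> ball (f \<psi>) e" by (simp add: dist_norm norm_minus_commute)
      then show "\<theta> \<in> {\<psi> \<in> schwartz \<Gamma>. f \<psi> \<in> U}" using sch e by auto
    qed
    ultimately show "\<exists>T. openin (schwartz_topology \<Gamma>) T \<and> \<psi> \<in> T \<and> T \<subseteq> {\<psi> \<in> schwartz \<Gamma>. f \<psi> \<in> U}" by blast
  qed
  then show ?thesis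
    by (simp add: continuous_map topspace_schwartz_topology image_subset_iff)
qed

lemma fourier_borel:
  assumes "\<psi> \<in> schwartz \<Gamma>"
  shows "fourier \<Gamma> \<psi> \<in> borel_measurable borel"
proof -
  have [measurable]: "\<psi> \<in> borel_measurable borel" by (rule schwartz_borel[OF assms])
  have "(\<lambda>\<eta>. LINT x|lborel. indicator (fundamental_cell \<Gamma>) x *\<^sub>R (\<psi> x * cis (- 2 * pi * (\<eta> \<bullet> x)))) \<in> borel_measurable borel"
    by measurable
  then show ?thesis
    unfolding fourier_def[abs_def] set_lebesgue_integral_def by simp
qed

lemma fourier_add_scaled:
  assumes "\<phi> \<in> schwartz \<Gamma>" "\<psi> \<in> schwartz \<Gamma>"
  shows "fourier \<Gamma> (\<lambda>x. \<phi> x + c * \<psi> x) \<xi> = fourier \<Gamma> \<phi> \<xi> + c * fourier \<Gamma> \<psi> \<xi>"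
proof -
  let ?e = "\<lambda>x. cis (- 2 * pi * (\<xi> \<bullet> x))"
  have int: "set_integrable lborel (fundamental_cell \<Gamma>) (\<lambda>x. \<phi> x * ?e x)"
     "set_integrable lborel (fundamental_cell \<Gamma>) (\<lambda>x. \<psi> x * ?e x)"
    using schwartz_cell_integrable[OF assms(1), of ?e] schwartz_cell_integrable[OF assms(2), of ?e] by auto
  have "(LINT x:fundamental_cell \<Gamma>|lborel. (\<phi> x + c * \<psi> x) * ?e x)
      = (LINT x:fundamental_cell \<Gamma>|lborel. \<phi> x * ?e x + c * (\<psi> x * ?e x))"
    by (simp add: algebra_simps)
  also have "\<dots> = (LINT x:fundamental_cell \<Gamma>|lborel. \<phi> x * ?e x) + c * (LINT x:fundamental_cell \<Gamma>|lborel. \<psi> x * ?e x)"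
    using int by (subst set_integral_add) (auto intro: set_integrable_mult_right)
  finally show ?thesis by (simp add: fourier_def algebra_simps)
qed

lemma fourier_cnj: "fourier \<Gamma> (\<lambda>x. cnj (\<psi> x)) \<xi> = cnj (fourier \<Gamma> \<psi> (- \<xi>))"
proof -
  have "(LINT x:fundamental_cell \<Gamma>|lborel. cnj (\<psi> x) * cis (- 2 * pi * (\<xi> \<bullet> x)))
      = (LINT x|lborel. cnj (indicator (fundamental_cell \<Gamma>) x *\<^sub>R (\<psi> x * cis (- 2 * pi * (- \<xi> \<bullet> x)))))"
    unfolding set_lebesgue_integral_def by (simp add: cis_cnj)
  also have "\<dots> = cnj (LINT x:fundamental_cell \<Gamma>|lborel. \<psi> x * cis (- 2 * pi * (- \<xi> \<bullet> x)))"
    unfolding set_lebesgue_integral_def by (rule Bochner_Integration.integral_cnj)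
  finally show ?thesis by (simp add: fourier_def)
qed

text \<open>
  The distribution with Fourier transform \<open>g\<close>, defined by duality: \<open>\<xi> \<mapsto> fourier \<Gamma> \<psi> (- \<xi>)\<close> is the inverse
  transform of \<open>\<psi>\<close> on the dual group.
\<close>

definition inverse_fourier_dist :: "('n::finite \<Rightarrow> factor) \<Rightarrow> (real ^ 'n \<Rightarrow> complex) \<Rightarrow> 'n functional" where
  "inverse_fourier_dist \<Gamma> g \<psi> = (if \<psi> \<in> schwartz \<Gamma> then LINT \<xi>|dual_measure \<Gamma>. g \<xi> * fourier \<Gamma> \<psi> (- \<xi>) else 0)"

text \<open>Integrability against the decay of the Fourier transforms of Schwartz functions.\<close>

definition moderate :: "('n::finite \<Rightarrow> factor) \<Rightarrow> (real ^ 'n \<Rightarrow> complex) \<Rightarrow> bool" where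
  "moderate \<Gamma> g \<longleftrightarrow> g \<in> borel_measurable borel \<and> integrable (dual_measure \<Gamma>) (\<lambda>\<xi>. norm (g \<xi>) * dual_decay \<xi>)"

lemma dual_decay_uminus [simp]: "dual_decay (- \<xi>) = dual_decay \<xi>"
  by (simp add: dual_decay_def)

lemma moderate_pairing_integrable:
  assumes "admissible \<Gamma>" "moderate \<Gamma> g" "\<psi> \<in> schwartz \<Gamma>"
  shows "integrable (dual_measure \<Gamma>) (\<lambda>\<xi>. g \<xi> * fourier \<Gamma> \<psi> (- \<xi>))"
proof -
  obtain A where A: "A \<ge> 0" "\<And>\<psi> \<xi>. \<psi> \<in> schwartz \<Gamma> \<Longrightarrow> \<xi> \<in> dual_group \<Gamma> \<Longrightarrow>
    norm (fourier \<Gamma> \<psi> \<xi>) \<le> A * decay_seminorm \<Gamma> \<psi> * dual_decay \<xi>"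
    using fourier_decay[OF assms(1)] by blast
  have [measurable]: "g \<in> borel_measurable borel" "fourier \<Gamma> \<psi> \<in> borel_measurable borel"
    using assms fourier_borel by (auto simp: moderate_def)
  show ?thesis
  proof (rule Bochner_Integration.integrable_bound)
    show "integrable (dual_measure \<Gamma>) (\<lambda>\<xi>. (A * decay_seminorm \<Gamma> \<psi>) * (norm (g \<xi>) * dual_decay \<xi>))"
      using assms(2) by (intro integrable_mult_right) (simp add: moderate_def)
    show "AE \<xi> in dual_measure \<Gamma>. norm (g \<xi> * fourier \<Gamma> \<psi> (- \<xi>)) \<le>
        norm ((A * decay_seminorm \<Gamma> \<psi>) * (norm (g \<xi>) * dual_decay \<xi>))"
      using AE_dual_group
    proof eventually_elim
      case (elim \<xi>)
      have "norm (g \<xi> * fourier \<Gamma> \<psi> (- \<xi>)) \<le> norm (g \<xi>) * (A * decay_seminorm \<Gamma> \<psi> * dual_decay (- \<xi>))"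
        unfolding norm_mult by (intro mult_left_mono A(2) assms uminus_dual_group elim) simp
      then show ?case by (simp add: mult_ac)
    qed
    show "(\<lambda>\<xi>. g \<xi> * fourier \<Gamma> \<psi> (- \<xi>)) \<in> borel_measurable (dual_measure \<Gamma>)" by measurable
  qed
qed

theorem inverse_fourier_dist_tempered:
  assumes "admissible \<Gamma>" "moderate \<Gamma> g"
  shows "inverse_fourier_dist \<Gamma> g \<in> tempered \<Gamma>"
proof -
  let ?f = "inverse_fourier_dist \<Gamma> g"
  note int = moderate_pairing_integrable[OF assms]
  have add: "?f (\<lambda>x. \<phi> x + c * \<psi> x) = ?f \<phi> + c * ?f \<psi>" if "\<phi> \<in> schwartz \<Gamma>" "\<psi> \<in> schwartz \<Gamma>" for \<phi> \<psi> c
  proof -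
    have "(LINT \<xi>|dual_measure \<Gamma>. g \<xi> * fourier \<Gamma> (\<lambda>x. \<phi> x + c * \<psi> x) (- \<xi>))
        = (LINT \<xi>|dual_measure \<Gamma>. g \<xi> * fourier \<Gamma> \<phi> (- \<xi>) + c * (g \<xi> * fourier \<Gamma> \<psi> (- \<xi>)))"
      by (simp add: fourier_add_scaled[OF that] algebra_simps)
    also have "\<dots> = (LINT \<xi>|dual_measure \<Gamma>. g \<xi> * fourier \<Gamma> \<phi> (- \<xi>)) + c * (LINT \<xi>|dual_measure \<Gamma>. g \<xi> * fourier \<Gamma> \<psi> (- \<xi>))"
      using int[OF that(1)] int[OF that(2)] by simp
    finally show ?thesis
      using that by (simp add: inverse_fourier_dist_def schwartz_add_scaled)
  qed
  have zero: "?f (\<lambda>_. 0) = 0"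
    using add[OF zero_schwartz zero_schwartz, of 1] by simp
  obtain A where A: "A \<ge> 0" "\<And>\<psi> \<xi>. \<psi> \<in> schwartz \<Gamma> \<Longrightarrow> \<xi> \<in> dual_group \<Gamma> \<Longrightarrow>
    norm (fourier \<Gamma> \<psi> \<xi>) \<le> A * decay_seminorm \<Gamma> \<psi> * dual_decay \<xi>"
    using fourier_decay[OF assms(1)] by blast
  have "continuous_map (schwartz_topology \<Gamma>) euclidean ?f"
  proof (rule schwartz_functional_continuous)
    show "?f (\<lambda>x. \<phi> x - \<psi> x) = ?f \<phi> - ?f \<psi>" if "\<phi> \<in> schwartz \<Gamma>" "\<psi> \<in> schwartz \<Gamma>" for \<phi> \<psi>
      using add[OF that, of "-1"] by simp
    fix \<psi> assume \<psi>: "\<psi> \<in> schwartz \<Gamma>"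
    have "norm (?f \<psi>) \<le> (LINT \<xi>|dual_measure \<Gamma>. (A * decay_seminorm \<Gamma> \<psi>) * (norm (g \<xi>) * dual_decay \<xi>))"
      using \<psi> unfolding inverse_fourier_dist_def
    proof (simp only: if_True, intro integral_norm_bound_integral_AE int)
      show "integrable (dual_measure \<Gamma>) (\<lambda>\<xi>. (A * decay_seminorm \<Gamma> \<psi>) * (norm (g \<xi>) * dual_decay \<xi>))"
        using assms(2) by (intro integrable_mult_right) (simp add: moderate_def)
      show "AE \<xi> in dual_measure \<Gamma>. norm (g \<xi> * fourier \<Gamma> \<psi> (- \<xi>)) \<le>
          (A * decay_seminorm \<Gamma> \<psi>) * (norm (g \<xi>) * dual_decay \<xi>)"
        using AE_dual_group
      proof eventually_elim
        case (elim \<xi>)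
        have "norm (g \<xi> * fourier \<Gamma> \<psi> (- \<xi>)) \<le> norm (g \<xi>) * (A * decay_seminorm \<Gamma> \<psi> * dual_decay (- \<xi>))"
          unfolding norm_mult by (intro mult_left_mono A(2) \<psi> uminus_dual_group elim) simp
        then show ?case by (simp add: mult_ac)
      qed
    qed
    also have "\<dots> = (A * (LINT \<xi>|dual_measure \<Gamma>. norm (g \<xi>) * dual_decay \<xi>)) * decay_seminorm \<Gamma> \<psi>"
      by (subst integral_mult_right_zero) (simp add: mult_ac)
    finally show "norm (?f \<psi>) \<le> (A * (LINT \<xi>|dual_measure \<Gamma>. norm (g \<xi>) * dual_decay \<xi>)) * decay_seminorm \<Gamma> \<psi>" .
  qed
  moreover have "?f (\<lambda>x. c * \<phi> x) = c * ?f \<phi>" if "\<phi> \<in> schwartz \<Gamma>" for \<phi> c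
    using add[OF zero_schwartz that, of c] zero by simp
  moreover have "?f (\<lambda>x. \<phi> x + \<psi> x) = ?f \<phi> + ?f \<psi>" if "\<phi> \<in> schwartz \<Gamma>" "\<psi> \<in> schwartz \<Gamma>" for \<phi> \<psi>
    using add[OF that, of 1] by simp
  moreover have "?f \<phi> = 0" if "\<phi> \<notin> schwartz \<Gamma>" for \<phi>
    using that by (simp add: inverse_fourier_dist_def)
  ultimately show ?thesis
    by (simp add: tempered_def)
qed

lemma moderate_locally_integrable:
  assumes "moderate \<Gamma> g" shows "locally_integrable \<Gamma> g"
proof -
  have [measurable]: "g \<in> borel_measurable borel" using assms by (simp add: moderate_def)
  have "set_integrable (dual_measure \<Gamma>) K g" if K: "compact K" for K
  proof (cases "K = {}")
    case False
    obtain \<eta> where \<eta>: "\<eta> \<in> K" "\<And>\<xi>. \<xi> \<in> K \<Longrightarrow> dual_decay \<eta> \<le> dual_decay \<xi>"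
      using continuous_attains_inf[OF K False dual_decay_continuous] by blast
    have [measurable]: "K \<in> sets borel" using K by (simp add: borel_compact)
    show ?thesis
      unfolding set_integrable_def
    proof (rule Bochner_Integration.integrable_bound)
      show "integrable (dual_measure \<Gamma>) (\<lambda>\<xi>. (1 / dual_decay \<eta>) * (norm (g \<xi>) * dual_decay \<xi>))"
        using assms by (intro integrable_mult_right) (simp add: moderate_def)
      show "AE \<xi> in dual_measure \<Gamma>. norm (indicator K \<xi> *\<^sub>R g \<xi>) \<le> norm ((1 / dual_decay \<eta>) * (norm (g \<xi>) * dual_decay \<xi>))"
      proof (rule AE_I2)
        fix \<xi>
        show "norm (indicator K \<xi> *\<^sub>R g \<xi>) \<le> norm ((1 / dual_decay \<eta>) * (norm (g \<xi>) * dual_decay \<xi>))"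
          using \<eta>(2)[of \<xi>] dual_decay_pos[of \<eta>] dual_decay_pos[of \<xi>]
          by (cases "\<xi> \<in> K") (auto simp: abs_mult pos_le_divide_eq mult_left_mono)
      qed
      show "(\<lambda>\<xi>. indicator K \<xi> *\<^sub>R g \<xi>) \<in> borel_measurable (dual_measure \<Gamma>)" by measurable
    qed
  qed (simp add: set_integrable_def)
  then show ?thesis
    by (auto simp: locally_integrable_def)
qed

lemma null_extended_tests_subset: "\<phi> \<in> null_extended_tests \<Gamma> \<Longrightarrow> \<phi> \<in> dual_test_functions \<Gamma>"
  by (simp add: null_extended_tests_def)

lemma locally_integrable_cong_AE:
  assumes "locally_integrable \<Gamma> g" "h \<in> borel_measurable borel" "AE \<xi> in dual_measure \<Gamma>. g \<xi> = h \<xi>"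
  shows "locally_integrable \<Gamma> h"
  unfolding locally_integrable_def
proof (intro conjI allI impI)
  show "h \<in> borel_measurable (dual_measure \<Gamma>)" using assms(2) by simp
  have [measurable]: "h \<in> borel_measurable borel" by fact
  fix K :: "(real ^ 'a) set" assume K: "compact K"
  then have [measurable]: "K \<in> sets borel" by (simp add: borel_compact)
  show "set_integrable (dual_measure \<Gamma>) K h"
    unfolding set_integrable_def
  proof (rule Bochner_Integration.integrable_cong_AE_imp)
    show "integrable (dual_measure \<Gamma>) (\<lambda>\<xi>. indicator K \<xi> *\<^sub>R g \<xi>)"
      using assms(1) K by (simp add: locally_integrable_def set_integrable_def)
    show "(\<lambda>\<xi>. indicator K \<xi> *\<^sub>R h \<xi>) \<in> borel_measurable (dual_measure \<Gamma>)" by measurable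
  qed (use assms(3) in \<open>auto elim!: eventually_mono\<close>)
qed

text \<open>
  If a test function is not measurable, because of its values off the dual group, then its Fourier
  transform is the zero function by the convention for integrals of non-integrable functions.  The
  pairing with \<open>g\<close> also vanishes provided that \<open>g\<close> has no zeros off the dual group; this is why the
  representative below takes the value \<open>1\<close> there.
\<close>

lemma fourier_is_funI:
  assumes "admissible \<Gamma>" and zero: "f (\<lambda>_. 0) = 0" and g: "locally_integrable \<Gamma> g"
    and eq: "\<And>\<phi>. \<phi> \<in> null_extended_tests \<Gamma> \<Longrightarrow> f (fourier_dual \<Gamma> \<phi>) = (LINT \<xi>|dual_measure \<Gamma>. g \<xi> * \<phi> \<xi>)"
  shows "fourier_is_fun \<Gamma> f (\<lambda>\<xi>. if \<xi> \<in> dual_group \<Gamma> then g \<xi> else 1)" (is "fourier_is_fun \<Gamma> f ?g")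
  unfolding fourier_is_fun_def fourier_dist_def
proof (intro conjI ballI)
  have [measurable]: "g \<in> borel_measurable borel" by (rule locally_integrable_borel[OF g])
  have [measurable]: "?g \<in> borel_measurable borel" by measurable
  show "locally_integrable \<Gamma> ?g"
    by (rule locally_integrable_cong_AE[OF g]) (use AE_dual_group[of \<Gamma>] in \<open>auto elim!: eventually_mono\<close>)
  fix \<phi> assume \<phi>: "\<phi> \<in> dual_test_functions \<Gamma>"
  let ?\<phi> = "\<lambda>\<xi>. indicator (dual_group \<Gamma>) \<xi> * \<phi> \<xi>"
  have \<phi>': "?\<phi> \<in> null_extended_tests \<Gamma>" by (rule null_extension_in_tests[OF \<phi>])
  then have [measurable]: "?\<phi> \<in> borel_measurable borel" by (rule test_borel)
  show "f (fourier_dual \<Gamma> \<phi>) = (LINT \<xi>|dual_measure \<Gamma>. ?g \<xi> * \<phi> \<xi>)"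
  proof (cases "\<phi> \<in> borel_measurable borel")
    case True
    then have [measurable]: "\<phi> \<in> borel_measurable borel" .
    have "(LINT \<xi>|dual_measure \<Gamma>. \<phi> \<xi> * cis (- 2 * pi * (\<xi> \<bullet> x))) = (LINT \<xi>|dual_measure \<Gamma>. ?\<phi> \<xi> * cis (- 2 * pi * (\<xi> \<bullet> x)))" for x
    proof (rule integral_cong_AE)
      show "(\<lambda>\<xi>. \<phi> \<xi> * cis (- 2 * pi * (\<xi> \<bullet> x))) \<in> borel_measurable (dual_measure \<Gamma>)" by measurable
      show "(\<lambda>\<xi>. ?\<phi> \<xi> * cis (- 2 * pi * (\<xi> \<bullet> x))) \<in> borel_measurable (dual_measure \<Gamma>)" by measurable
    qed (use AE_dual_group[of \<Gamma>] in \<open>auto elim!: eventually_mono\<close>)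
    then have "fourier_dual \<Gamma> \<phi> = fourier_dual \<Gamma> ?\<phi>" by (simp add: fun_eq_iff fourier_dual_def)
    moreover have "(LINT \<xi>|dual_measure \<Gamma>. ?g \<xi> * \<phi> \<xi>) = (LINT \<xi>|dual_measure \<Gamma>. g \<xi> * ?\<phi> \<xi>)"
    proof (rule integral_cong_AE)
      show "(\<lambda>\<xi>. ?g \<xi> * \<phi> \<xi>) \<in> borel_measurable (dual_measure \<Gamma>)" by measurable
      show "(\<lambda>\<xi>. g \<xi> * ?\<phi> \<xi>) \<in> borel_measurable (dual_measure \<Gamma>)" by measurable
    qed (use AE_dual_group[of \<Gamma>] in \<open>auto elim!: eventually_mono\<close>)
    ultimately show ?thesis using eq[OF \<phi>'] by simp
  next
    case False
    have "(LINT \<xi>|dual_measure \<Gamma>. \<phi> \<xi> * cis (- 2 * pi * (\<xi> \<bullet> x))) = 0" for x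
    proof (rule not_integrable_integral_eq, rule notI)
      assume "integrable (dual_measure \<Gamma>) (\<lambda>\<xi>. \<phi> \<xi> * cis (- 2 * pi * (\<xi> \<bullet> x)))"
      then have [measurable]: "(\<lambda>\<xi>. \<phi> \<xi> * cis (- 2 * pi * (\<xi> \<bullet> x))) \<in> borel_measurable borel"
        using borel_measurable_integrable measurable_cong_sets[OF sets_dual_measure refl] by blast
      have "(\<lambda>\<xi>. (\<phi> \<xi> * cis (- 2 * pi * (\<xi> \<bullet> x))) * cis (2 * pi * (\<xi> \<bullet> x))) \<in> borel_measurable borel" by measurable
      with False show False by (simp add: mult.assoc cis_mult)
    qed
    then have "f (fourier_dual \<Gamma> \<phi>) = 0" using zero by (simp add: fourier_dual_def[abs_def])
    moreover have "(LINT \<xi>|dual_measure \<Gamma>. ?g \<xi> * \<phi> \<xi>) = 0"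
    proof (rule not_integrable_integral_eq, rule notI)
      assume "integrable (dual_measure \<Gamma>) (\<lambda>\<xi>. ?g \<xi> * \<phi> \<xi>)"
      then have [measurable]: "(\<lambda>\<xi>. ?g \<xi> * \<phi> \<xi>) \<in> borel_measurable borel"
        using borel_measurable_integrable measurable_cong_sets[OF sets_dual_measure refl] by blast
      have "(\<lambda>\<xi>. if \<xi> \<in> dual_group \<Gamma> then ?\<phi> \<xi> else ?g \<xi> * \<phi> \<xi>) \<in> borel_measurable borel" by measurable
      moreover have "(\<lambda>\<xi>. if \<xi> \<in> dual_group \<Gamma> then ?\<phi> \<xi> else ?g \<xi> * \<phi> \<xi>) = \<phi>" by auto
      ultimately show False using False by simp
    qed
    ultimately show ?thesis by simp
  qed
qed

lemma fourier_is_fun_test: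
  "fourier_is_fun \<Gamma> f g \<Longrightarrow> \<phi> \<in> null_extended_tests \<Gamma> \<Longrightarrow> f (fourier_dual \<Gamma> \<phi>) = (LINT \<xi>|dual_measure \<Gamma>. g \<xi> * \<phi> \<xi>)"
  unfolding fourier_is_fun_def fourier_dist_def using null_extended_tests_subset by blast

lemma fourier_is_fun_inverse_fourier_dist:
  assumes "admissible \<Gamma>" "moderate \<Gamma> g"
  shows "fourier_is_fun \<Gamma> (inverse_fourier_dist \<Gamma> g) (\<lambda>\<xi>. if \<xi> \<in> dual_group \<Gamma> then g \<xi> else 1)"
proof (rule fourier_is_funI[OF assms(1)])
  show "inverse_fourier_dist \<Gamma> g (\<lambda>_. 0) = 0"
    by (simp add: inverse_fourier_dist_def fourier_def set_lebesgue_integral_def)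
  show "locally_integrable \<Gamma> g" by (rule moderate_locally_integrable[OF assms(2)])
  have [measurable]: "g \<in> borel_measurable borel" using assms(2) by (simp add: moderate_def)
  fix \<phi> assume \<phi>: "\<phi> \<in> null_extended_tests \<Gamma>"
  have sch: "fourier_dual \<Gamma> \<phi> \<in> schwartz \<Gamma>" by (rule fourier_dual_schwartz[OF assms(1) \<phi>])
  have [measurable]: "\<phi> \<in> borel_measurable borel" by (rule test_borel[OF \<phi>])
  have "(LINT \<xi>|dual_measure \<Gamma>. g \<xi> * fourier \<Gamma> (fourier_dual \<Gamma> \<phi>) (- \<xi>)) = (LINT \<xi>|dual_measure \<Gamma>. g \<xi> * \<phi> \<xi>)"
  proof (rule integral_cong_AE)
    show "(\<lambda>\<xi>. g \<xi> * \<phi> \<xi>) \<in> borel_measurable (dual_measure \<Gamma>)" by measurable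
    show "(\<lambda>\<xi>. g \<xi> * fourier \<Gamma> (fourier_dual \<Gamma> \<phi>) (- \<xi>)) \<in> borel_measurable (dual_measure \<Gamma>)"
      using moderate_pairing_integrable[OF assms sch] by simp
    show "AE \<xi> in dual_measure \<Gamma>. g \<xi> * fourier \<Gamma> (fourier_dual \<Gamma> \<phi>) (- \<xi>) = g \<xi> * \<phi> \<xi>"
      using AE_dual_group by eventually_elim (simp add: fourier_inversion[OF assms(1) \<phi>])
  qed
  then show "inverse_fourier_dist \<Gamma> g (fourier_dual \<Gamma> \<phi>) = (LINT \<xi>|dual_measure \<Gamma>. g \<xi> * \<phi> \<xi>)"
    using sch by (simp add: inverse_fourier_dist_def)
qed

lemma locally_integrable_diff:
  assumes "locally_integrable \<Gamma> g" "locally_integrable \<Gamma> h"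
  shows "locally_integrable \<Gamma> (\<lambda>\<xi>. g \<xi> - h \<xi>)"
  using assms unfolding locally_integrable_def by (auto intro: set_integral_diff)

lemma fourier_is_fun_unique:
  assumes "admissible \<Gamma>" "fourier_is_fun \<Gamma> f g" "fourier_is_fun \<Gamma> f h"
  shows "AE \<xi> in dual_measure \<Gamma>. g \<xi> = h \<xi>"
proof -
  have li: "locally_integrable \<Gamma> g" "locally_integrable \<Gamma> h"
    using assms by (simp_all add: fourier_is_fun_def)
  have "AE \<xi> in dual_measure \<Gamma>. g \<xi> - h \<xi> = 0"
  proof (rule AE_zero_of_tests[OF assms(1) locally_integrable_diff[OF li]])
    fix \<phi> assume \<phi>: "\<phi> \<in> null_extended_tests \<Gamma>"
    show "(LINT \<xi>|dual_measure \<Gamma>. (g \<xi> - h \<xi>) * \<phi> \<xi>) = 0"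
      using locally_integrable_test_mult[OF li(1) \<phi>] locally_integrable_test_mult[OF li(2) \<phi>]
        fourier_is_fun_test[OF assms(2) \<phi>] fourier_is_fun_test[OF assms(3) \<phi>]
      by (simp add: left_diff_distrib)
  qed
  then show ?thesis by simp
qed

lemma fourier_is_fun_borel: "fourier_is_fun \<Gamma> f g \<Longrightarrow> g \<in> borel_measurable borel"
  unfolding fourier_is_fun_def by (blast intro: locally_integrable_borel)

lemma fourier_fun_AE:
  assumes "admissible \<Gamma>" "fourier_is_fun \<Gamma> f g"
  shows "AE \<xi> in dual_measure \<Gamma>. fourier_fun \<Gamma> f \<xi> = g \<xi>"
  unfolding fourier_fun_def
  by (rule fourier_is_fun_unique[OF assms(1) _ assms(2)]) (rule someI[of "fourier_is_fun \<Gamma> f", OF assms(2)])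

lemma tempered_zero:
  assumes "f \<in> tempered \<Gamma>" shows "f (\<lambda>_. 0) = 0"
proof -
  have "\<forall>\<phi>\<in>schwartz \<Gamma>. \<forall>c. f (\<lambda>x. c * \<phi> x) = c * f \<phi>"
    using assms by (simp add: tempered_def)
  from this[rule_format, OF zero_schwartz, of 0] show ?thesis by simp
qed

lemma fourier_is_fun_diff:
  assumes "admissible \<Gamma>" "f \<in> tempered \<Gamma>" "f' \<in> tempered \<Gamma>" "fourier_is_fun \<Gamma> f g" "fourier_is_fun \<Gamma> f' g'"
  shows "\<exists>h. fourier_is_fun \<Gamma> (\<lambda>\<phi>. f \<phi> - f' \<phi>) h \<and> (AE \<xi> in dual_measure \<Gamma>. h \<xi> = g \<xi> - g' \<xi>)"
proof (intro exI conjI)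
  have li: "locally_integrable \<Gamma> g" "locally_integrable \<Gamma> g'"
    using assms by (simp_all add: fourier_is_fun_def)
  show "fourier_is_fun \<Gamma> (\<lambda>\<phi>. f \<phi> - f' \<phi>) (\<lambda>\<xi>. if \<xi> \<in> dual_group \<Gamma> then g \<xi> - g' \<xi> else 1)"
  proof (rule fourier_is_funI[OF assms(1) _ locally_integrable_diff[OF li]])
    show "f (\<lambda>_. 0) - f' (\<lambda>_. 0) = 0" using assms(2,3) by (simp add: tempered_zero)
    fix \<phi> assume \<phi>: "\<phi> \<in> null_extended_tests \<Gamma>"
    show "f (fourier_dual \<Gamma> \<phi>) - f' (fourier_dual \<Gamma> \<phi>) = (LINT \<xi>|dual_measure \<Gamma>. (g \<xi> - g' \<xi>) * \<phi> \<xi>)"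
      using locally_integrable_test_mult[OF li(1) \<phi>] locally_integrable_test_mult[OF li(2) \<phi>]
        fourier_is_fun_test[OF assms(4) \<phi>] fourier_is_fun_test[OF assms(5) \<phi>]
      by (simp add: left_diff_distrib)
  qed
qed (use AE_dual_group[of \<Gamma>] in \<open>auto elim!: eventually_mono\<close>)


section \<open>Real distributions\<close>

lemma inverse_fourier_dist_real:
  assumes "admissible \<Gamma>" "moderate \<Gamma> g" and sym: "AE \<xi> in dual_measure \<Gamma>. g (- \<xi>) = cnj (g \<xi>)"
  shows "inverse_fourier_dist \<Gamma> g = cnj_dist (inverse_fourier_dist \<Gamma> g)"
proof
  fix \<psi>
  have [measurable]: "g \<in> borel_measurable borel" using assms(2) by (simp add: moderate_def)
  show "inverse_fourier_dist \<Gamma> g \<psi> = cnj_dist (inverse_fourier_dist \<Gamma> g) \<psi>"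
  proof (cases "\<psi> \<in> schwartz \<Gamma>")
    case True
    have [measurable]: "fourier \<Gamma> \<psi> \<in> borel_measurable borel" by (rule fourier_borel[OF True])
    have "(LINT \<xi>|dual_measure \<Gamma>. g \<xi> * fourier \<Gamma> (\<lambda>x. cnj (\<psi> x)) (- \<xi>))
        = (LINT \<xi>|dual_measure \<Gamma>. g \<xi> * cnj (fourier \<Gamma> \<psi> \<xi>))"
      by (simp add: fourier_cnj)
    also have "\<dots> = (LINT \<xi>|dual_measure \<Gamma>. g (- \<xi>) * cnj (fourier \<Gamma> \<psi> (- \<xi>)))"
      by (rule integral_dual_reflect[symmetric]) measurable
    also have "\<dots> = (LINT \<xi>|dual_measure \<Gamma>. cnj (g \<xi> * fourier \<Gamma> \<psi> (- \<xi>)))"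
    proof (rule integral_cong_AE)
      show "(\<lambda>\<xi>. g (- \<xi>) * cnj (fourier \<Gamma> \<psi> (- \<xi>))) \<in> borel_measurable (dual_measure \<Gamma>)" by measurable
      show "(\<lambda>\<xi>. cnj (g \<xi> * fourier \<Gamma> \<psi> (- \<xi>))) \<in> borel_measurable (dual_measure \<Gamma>)" by measurable
    qed (use sym in \<open>auto elim!: eventually_mono\<close>)
    also have "\<dots> = cnj (LINT \<xi>|dual_measure \<Gamma>. g \<xi> * fourier \<Gamma> \<psi> (- \<xi>))" by (rule Bochner_Integration.integral_cnj)
    finally show ?thesis
      using True by (simp add: cnj_dist_def inverse_fourier_dist_def schwartz_cnj)
  qed (simp add: cnj_dist_def inverse_fourier_dist_def schwartz_cnj_iff)
qed

lemma fourier_dual_cnj_reflect: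
  assumes "\<phi> \<in> null_extended_tests \<Gamma>"
  shows "fourier_dual \<Gamma> (\<lambda>\<xi>. cnj (\<phi> (- \<xi>))) x = cnj (fourier_dual \<Gamma> \<phi> x)"
proof -
  have [measurable]: "\<phi> \<in> borel_measurable borel" by (rule test_borel[OF assms])
  have "(LINT \<xi>|dual_measure \<Gamma>. cnj (\<phi> (- \<xi>)) * cis (- 2 * pi * (\<xi> \<bullet> x)))
      = (LINT \<xi>|dual_measure \<Gamma>. cnj (\<phi> (- (- \<xi>))) * cis (- 2 * pi * (- \<xi> \<bullet> x)))"
    by (rule integral_dual_reflect[symmetric]) measurable
  also have "\<dots> = (LINT \<xi>|dual_measure \<Gamma>. cnj (\<phi> \<xi> * cis (- 2 * pi * (\<xi> \<bullet> x))))"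
    by (simp add: cis_cnj)
  also have "\<dots> = cnj (LINT \<xi>|dual_measure \<Gamma>. \<phi> \<xi> * cis (- 2 * pi * (\<xi> \<bullet> x)))"
    by (rule Bochner_Integration.integral_cnj)
  finally show ?thesis by (simp add: fourier_dual_def)
qed

lemma locally_integrable_cnj_reflect:
  assumes "locally_integrable \<Gamma> g"
  shows "locally_integrable \<Gamma> (\<lambda>\<xi>. cnj (g (- \<xi>)))"
  unfolding locally_integrable_def
proof (intro conjI allI impI)
  have [measurable]: "g \<in> borel_measurable borel" by (rule locally_integrable_borel[OF assms])
  show "(\<lambda>\<xi>. cnj (g (- \<xi>))) \<in> borel_measurable (dual_measure \<Gamma>)" by measurable
  fix K :: "(real ^ 'a) set" assume "compact K"
  then have "compact (uminus ` K)" by (rule compact_negations[unfolded image_def, folded image_def])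
  then have "integrable (dual_measure \<Gamma>) (\<lambda>\<xi>. indicator (uminus ` K) \<xi> *\<^sub>R g \<xi>)"
    using assms by (simp add: locally_integrable_def set_integrable_def)
  then have "integrable (distr (dual_measure \<Gamma>) borel uminus) (\<lambda>\<xi>. indicator (uminus ` K) \<xi> *\<^sub>R g \<xi>)"
    by (simp add: dual_measure_reflect)
  then have "integrable (dual_measure \<Gamma>) (\<lambda>\<xi>. indicator (uminus ` K) (- \<xi>) *\<^sub>R g (- \<xi>))"
    by (rule integrable_distr[rotated]) simp
  then have "integrable (dual_measure \<Gamma>) (\<lambda>\<xi>. cnj (indicator (uminus ` K) (- \<xi>) *\<^sub>R g (- \<xi>)))"
    by (rule integrable_cnj)
  moreover have "indicator (uminus ` K) (- \<xi>) = (indicator K \<xi> :: real)" for \<xi>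
    by (auto simp: indicator_def)
  ultimately show "set_integrable (dual_measure \<Gamma>) K (\<lambda>\<xi>. cnj (g (- \<xi>)))"
    by (simp add: set_integrable_def)
qed

text \<open>
  If \<open>f\<close> equals its conjugate, then \<open>g\<close> and \<open>\<xi> \<mapsto> cnj (g (- \<xi>))\<close> have the same pairing with all test functions.
\<close>

lemma real_dist_fourier_symmetric:
  assumes "admissible \<Gamma>" "f = cnj_dist f" "fourier_is_fun \<Gamma> f g"
  shows "AE \<xi> in dual_measure \<Gamma>. g (- \<xi>) = cnj (g \<xi>)"
proof -
  have g: "locally_integrable \<Gamma> g" using assms(3) by (simp add: fourier_is_fun_def)
  have [measurable]: "g \<in> borel_measurable borel" by (rule locally_integrable_borel[OF g])
  note h = locally_integrable_cnj_reflect[OF g]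
  have "AE \<xi> in dual_measure \<Gamma>. g \<xi> - cnj (g (- \<xi>)) = 0"
  proof (rule AE_zero_of_tests[OF assms(1) locally_integrable_diff[OF g h]])
    fix \<phi> assume \<phi>: "\<phi> \<in> null_extended_tests \<Gamma>"
    have [measurable]: "\<phi> \<in> borel_measurable borel" by (rule test_borel[OF \<phi>])
    let ?\<phi> = "\<lambda>\<xi>. cnj (\<phi> (- \<xi>))"
    have \<phi>': "?\<phi> \<in> null_extended_tests \<Gamma>" by (rule test_cnj_reflect[OF \<phi>])
    have "(LINT \<xi>|dual_measure \<Gamma>. g \<xi> * \<phi> \<xi>) = f (fourier_dual \<Gamma> \<phi>)"
      using fourier_is_fun_test[OF assms(3) \<phi>] by simp
    also have "\<dots> = cnj_dist f (fourier_dual \<Gamma> \<phi>)" by (subst assms(2)) (rule refl)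
    also have "\<dots> = cnj (f (fourier_dual \<Gamma> ?\<phi>))"
      by (simp add: cnj_dist_def fourier_dual_cnj_reflect[OF \<phi>, symmetric])
    also have "\<dots> = cnj (LINT \<xi>|dual_measure \<Gamma>. g \<xi> * ?\<phi> \<xi>)"
      by (simp add: fourier_is_fun_test[OF assms(3) \<phi>'])
    also have "\<dots> = (LINT \<xi>|dual_measure \<Gamma>. cnj (g \<xi> * ?\<phi> \<xi>))" by (rule Bochner_Integration.integral_cnj[symmetric])
    also have "\<dots> = (LINT \<xi>|dual_measure \<Gamma>. cnj (g (- \<xi>) * cnj (\<phi> (- (- \<xi>)))))"
      by (rule integral_dual_reflect[symmetric]) measurable
    also have "\<dots> = (LINT \<xi>|dual_measure \<Gamma>. cnj (g (- \<xi>)) * \<phi> \<xi>)" by simp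
    finally show "(LINT \<xi>|dual_measure \<Gamma>. (g \<xi> - cnj (g (- \<xi>))) * \<phi> \<xi>) = 0"
      using locally_integrable_test_mult[OF g \<phi>] locally_integrable_test_mult[OF h \<phi>]
      by (simp add: left_diff_distrib)
  qed
  then show ?thesis
    by eventually_elim (metis complex_cnj_cnj eq_iff_diff_eq_0)
qed


section \<open>The weight\<close>

definition weight :: "'n::finite \<Rightarrow> real \<Rightarrow> real ^ 'n \<Rightarrow> real" where
  "weight j s \<xi> = mu j \<xi> * japanese \<xi> powr (s - 1)"

text \<open>
  By \<open>X_norm_sq_eq\<close> below this is the squared norm of the distribution with Fourier transform \<open>g\<close>.
\<close>

definition weighted_sq_norm :: "('n::finite \<Rightarrow> factor) \<Rightarrow> 'n \<Rightarrow> real \<Rightarrow> (real ^ 'n \<Rightarrow> complex) \<Rightarrow> ennreal" where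
  "weighted_sq_norm \<Gamma> j s g = (\<integral>\<^sup>+\<xi>. ennreal ((weight j s \<xi> * norm (g \<xi>))\<^sup>2) \<partial>dual_measure \<Gamma>)"

lemma japanese_ge_1: "japanese \<xi> \<ge> 1"
  by (simp add: japanese_def)

lemma mu_pos: "mu j \<xi> > 0"
  by (simp add: mu_def add_nonneg_pos)

lemma weight_pos: "weight j s \<xi> > 0"
  using mu_pos[of j \<xi>] japanese_ge_1[of \<xi>] by (simp add: weight_def)

lemma weight_borel [measurable]: "weight j s \<in> borel_measurable borel"
  unfolding weight_def[abs_def] mu_def[abs_def] japanese_def[abs_def] by measurable

text \<open>
  For \<open>s \<ge> 0\<close> the power \<open>japanese \<xi> powr (s - 1)\<close> is at least \<open>1 / japanese \<xi>\<close>, which is compensated at infinity by the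
  summand \<open>\<bar>\<xi>\<bar>\<close> of \<open>mu j \<xi>\<close>.  Only the singularity at the origin is left.
\<close>

lemma inverse_weight_sq_le:
  assumes "s \<ge> 0" "\<xi> \<noteq> 0"
  shows "1 / (weight j s \<xi>)\<^sup>2 \<le> 1 + 1 / (norm \<xi>)\<^sup>2"
proof -
  have "norm \<xi> / japanese \<xi> \<le> weight j s \<xi>"
  proof -
    have "1 / japanese \<xi> = japanese \<xi> powr (- 1)"
      using japanese_ge_1[of \<xi>] by (simp add: powr_minus_divide)
    also have "\<dots> \<le> japanese \<xi> powr (s - 1)"
      using assms(1) japanese_ge_1[of \<xi>] by (intro powr_mono) auto
    finally have "norm \<xi> * (1 / japanese \<xi>) \<le> mu j \<xi> * japanese \<xi> powr (s - 1)"
      using assms(2) japanese_ge_1[of \<xi>] by (intro mult_mono) (auto simp: mu_def)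
    then show ?thesis by (simp add: weight_def)
  qed
  moreover have pos: "norm \<xi> / japanese \<xi> > 0" using assms(2) japanese_ge_1[of \<xi>] by simp
  ultimately have "(norm \<xi> / japanese \<xi>)\<^sup>2 \<le> (weight j s \<xi>)\<^sup>2" by (intro power_mono) auto
  then have "1 / (weight j s \<xi>)\<^sup>2 \<le> 1 / (norm \<xi> / japanese \<xi>)\<^sup>2"
    by (intro divide_left_mono mult_pos_pos zero_less_power weight_pos pos) auto
  also have "\<dots> = (1 + (norm \<xi>)\<^sup>2) / (norm \<xi>)\<^sup>2"
    by (simp add: japanese_def power_divide)
  also have "\<dots> = 1 + 1 / (norm \<xi>)\<^sup>2" using assms(2) by (simp add: add_divide_distrib)
  finally show ?thesis .
qed

text \<open>
  Enumerating the integers by the natural numbers with \<open>\<bar>int_decode n\<bar> \<ge> n div 2\<close> reduces the sum to a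
  multiple of the series of inverse squares.
\<close>

lemma nn_integral_lattice_finite:
  assumes "L > 0"
  shows "(\<integral>\<^sup>+t. ennreal (1 / (1 + t\<^sup>2)) \<partial>count_space (dual_factor (Circle L))) < \<infinity>"
proof -
  \<comment> \<open>The largest constant with \<open>c * (1 + m\<^sup>2) \<le> 1 + (m / L)\<^sup>2\<close> for all \<open>m\<close>.\<close>
  define c where "c = min 1 (1 / L\<^sup>2)"
  have c: "c > 0" using assms by (simp add: c_def)
  have "inj (\<lambda>k::int. of_int k / L)" using assms by (auto simp: inj_on_def)
  then have "bij_betw (\<lambda>k::int. of_int k / L) UNIV (dual_factor (Circle L))"
    by (simp add: bij_betw_def dual_factor_def)
  moreover have "bij_betw int_decode UNIV UNIV" by (simp add: bij_int_decode)
  ultimately have bij: "bij_betw (\<lambda>n. of_int (int_decode n) / L) UNIV (dual_factor (Circle L))"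
    using bij_betw_trans[of int_decode UNIV UNIV "\<lambda>k::int. of_int k / L"] by (simp add: o_def)
  have bound: "1 / (1 + (of_int (int_decode n) / L)\<^sup>2) \<le> (8 / c) * (1 / (real (Suc n))\<^sup>2)" for n
  proof -
    define m where "m = real (n div 2)"
    have "Suc n \<le> 2 * (n div 2 + 1)" by presburger
    then have "real (Suc n) \<le> real (2 * (n div 2 + 1))" by (rule of_nat_mono)
    then have m: "real (Suc n) \<le> 2 * (m + 1)" "m \<ge> 0" by (simp_all add: m_def)
    have "m \<le> \<bar>of_int (int_decode n)\<bar>"
      by (auto simp: m_def int_decode_def sum_decode_def)
    then have "m\<^sup>2 \<le> (of_int (int_decode n))\<^sup>2" using m by (simp add: abs_le_square_iff[symmetric])
    then have "c * m\<^sup>2 \<le> (1 / L\<^sup>2) * (of_int (int_decode n))\<^sup>2"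
      using c by (intro mult_mono) (auto simp: c_def)
    moreover have "c \<le> 1" by (simp add: c_def)
    ultimately have "c * (1 + m\<^sup>2) \<le> 1 + (of_int (int_decode n) / L)\<^sup>2"
      by (simp add: algebra_simps power_divide)
    moreover have "(real (Suc n))\<^sup>2 \<le> 8 * (1 + m\<^sup>2)"
    proof -
      have "(real (Suc n))\<^sup>2 \<le> (2 * (m + 1))\<^sup>2" using m by (intro power_mono) auto
      also have "\<dots> \<le> 8 * (1 + m\<^sup>2)" using sum_squares_bound[of m 1] by (simp add: power2_eq_square algebra_simps)
      finally show ?thesis .
    qed
    then have "c / 8 * (real (Suc n))\<^sup>2 \<le> c / 8 * (8 * (1 + m\<^sup>2))"
      by (rule mult_left_mono) (use c in simp)
    moreover have "c / 8 * (8 * (1 + m\<^sup>2)) = c * (1 + m\<^sup>2)" by simp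
    ultimately have "c / 8 * (real (Suc n))\<^sup>2 \<le> 1 + (of_int (int_decode n) / L)\<^sup>2" by linarith
    then have "1 / (1 + (of_int (int_decode n) / L)\<^sup>2) \<le> 1 / (c / 8 * (real (Suc n))\<^sup>2)"
      using c by (intro divide_left_mono) (auto simp: add_pos_nonneg)
    then show ?thesis by simp
  qed
  have "summable (\<lambda>n. inverse ((real n)\<^sup>2))" by (rule inverse_power_summable) simp
  then have "summable (\<lambda>n. inverse ((real (Suc n))\<^sup>2))" by (rule summable_Suc_iff[THEN iffD2])
  then have "summable (\<lambda>n. (8 / c) * (1 / (real (Suc n))\<^sup>2))" by (intro summable_mult) (simp add: inverse_eq_divide)
  then have sm: "summable (\<lambda>n. 1 / (1 + (of_int (int_decode n) / L)\<^sup>2))"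
    by (rule summable_comparison_test'[of _ 0]) (use bound in \<open>simp add: add_nonneg_nonneg\<close>)
  have "(\<integral>\<^sup>+t. ennreal (1 / (1 + t\<^sup>2)) \<partial>count_space (dual_factor (Circle L)))
      = (\<integral>\<^sup>+n. ennreal (1 / (1 + (of_int (int_decode n) / L)\<^sup>2)) \<partial>count_space UNIV)"
    by (rule nn_integral_bij_count_space[OF bij, symmetric])
  also have "\<dots> = (\<Sum>n. ennreal (1 / (1 + (of_int (int_decode n) / L)\<^sup>2)))"
    by (rule nn_integral_count_space_nat)
  also have "\<dots> = ennreal (\<Sum>n. 1 / (1 + (of_int (int_decode n) / L)\<^sup>2))"
    by (rule suminf_ennreal2[OF _ sm]) simp
  finally show ?thesis by simp
qed

lemma nn_integral_inverse_1_plus_square: "(\<integral>\<^sup>+t. ennreal (1 / (1 + t\<^sup>2)) \<partial>lborel) < \<infinity>"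
  using integrable_inverse_1_plus_square_line by (simp add: integrable_iff_bounded)

lemma nn_integral_singular_power:
  assumes "0 < a" "a < 1"
  shows "(\<integral>\<^sup>+t. ennreal (\<bar>t\<bar> powr (- a) * (1 / (1 + t\<^sup>2))) \<partial>lborel) < \<infinity>"
proof -
  define f where "f t = indicator {0..1} t * t powr (- a)" for t :: real
  have [measurable]: "f \<in> borel_measurable borel" unfolding f_def[abs_def] by measurable
  have f_nonneg: "f t \<ge> 0" for t by (simp add: f_def)
  have "((\<lambda>t. t powr (- a)) has_integral (1 powr (- a + 1) / (- a + 1))) {0..1}"
    using assms by (intro has_integral_powr_from_0) auto
  then have "((\<lambda>t. if t \<in> {0..1} then t powr (- a) else 0) has_integral (1 / (1 - a))) UNIV"
    by (subst has_integral_restrict_UNIV) simp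
  also have "(\<lambda>t. if t \<in> {0..1} then t powr (- a) else 0) = f"
    by (simp add: fun_eq_iff f_def)
  finally have "(f has_integral (1 / (1 - a))) UNIV" .
  then have f: "(\<integral>\<^sup>+t. ennreal (f t) \<partial>lborel) = ennreal (1 / (1 - a))"
    by (intro nn_integral_has_integral_lborel f_nonneg) auto
  have f': "(\<integral>\<^sup>+t. ennreal (f (- t)) \<partial>lborel) = (\<integral>\<^sup>+t. ennreal (f t) \<partial>lborel)"
    by (subst lborel_distr_uminus[symmetric], subst nn_integral_distr) auto
  have "\<bar>t\<bar> powr (- a) * (1 / (1 + t\<^sup>2)) \<le> f t + f (- t) + 1 / (1 + t\<^sup>2)" for t
  proof (cases "\<bar>t\<bar> \<le> 1")
    case True
    then have "\<bar>t\<bar> powr (- a) \<le> f t + f (- t)" by (cases "t \<ge> 0") (auto simp: f_def indicator_def)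
    moreover have "\<bar>t\<bar> powr (- a) * (1 / (1 + t\<^sup>2)) \<le> \<bar>t\<bar> powr (- a) * 1"
      by (intro mult_left_mono) (auto simp: divide_le_eq add_pos_nonneg)
    moreover have "0 \<le> 1 / (1 + t\<^sup>2)" by simp
    ultimately show ?thesis by linarith
  next
    case False
    then have "\<bar>t\<bar> powr (- a) \<le> \<bar>t\<bar> powr 0" using assms by (intro powr_mono) auto
    then have "\<bar>t\<bar> powr (- a) * (1 / (1 + t\<^sup>2)) \<le> 1 * (1 / (1 + t\<^sup>2))"
      using False by (intro mult_right_mono) (auto split: if_splits)
    moreover have "0 \<le> f t" "0 \<le> f (- t)" by (auto simp: f_def)
    ultimately show ?thesis by linarith
  qed
  then have "(\<integral>\<^sup>+t. ennreal (\<bar>t\<bar> powr (- a) * (1 / (1 + t\<^sup>2))) \<partial>lborel)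
      \<le> (\<integral>\<^sup>+t. ennreal (f t) + ennreal (f (- t)) + ennreal (1 / (1 + t\<^sup>2)) \<partial>lborel)"
    by (intro nn_integral_mono) (auto simp: f_def ennreal_plus[symmetric] simp del: ennreal_plus intro!: ennreal_leI)
  also have "\<dots> = (\<integral>\<^sup>+t. ennreal (f t) \<partial>lborel) + (\<integral>\<^sup>+t. ennreal (f (- t)) \<partial>lborel) + (\<integral>\<^sup>+t. ennreal (1 / (1 + t\<^sup>2)) \<partial>lborel)"
    by (simp add: nn_integral_add)
  also have "\<dots> < \<infinity>"
    unfolding f' f using nn_integral_inverse_1_plus_square by simp
  finally show ?thesis .
qed

lemma AE_line_coordinate_nonzero:
  assumes "i \<in> line_indices \<Gamma>"
  shows "AE \<xi> in dual_measure \<Gamma>. \<xi> $ i \<noteq> 0"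
proof -
  let ?A = "\<lambda>k. if k = i then {0} else UNIV :: real set"
  have "emeasure (dual_measure \<Gamma>) {\<xi>. \<forall>k. \<xi> $ k \<in> ?A k} = 0"
    using assms by (subst emeasure_dual_measure_box)
      (auto intro!: prod_zero bexI[of _ i] simp: line_indices_def dual_factor_measure_def dual_factor_def)
  moreover have "{\<xi>. \<forall>k. \<xi> $ k \<in> ?A k} = {\<xi>. \<xi> $ i = 0}" by (auto split: if_splits)
  moreover have "{\<xi>::real ^ 'a. \<xi> $ i = 0} \<in> sets borel"
    by (intro borel_closed closed_Collect_eq continuous_intros)
  ultimately show ?thesis
    by (intro AE_I'[of "{\<xi>. \<xi> $ i = 0}"]) (auto simp: null_sets_def)
qed

text \<open>
  The inequality \<open>\<bar>\<xi>\<bar>\<^sup>2 \<ge> (\<Prod>i\<in>R. \<bar>\<xi>\<^sub>i\<bar> powr (2 / r))\<close> with \<open>r = card R\<close> replaces polar coordinates: it reduces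
  the integrability of the inverse weight to that of \<open>\<bar>t\<bar> powr (- 2 / r)\<close> near \<open>0\<close> on the real line.
\<close>

lemma nn_integral_decay_over_weight:
  fixes \<Gamma> :: "'n::finite \<Rightarrow> factor"
  assumes adm: "admissible \<Gamma>" and s: "s \<ge> 0" and r: "card (line_indices \<Gamma>) > 2"
  shows "(\<integral>\<^sup>+\<xi>. ennreal ((dual_decay \<xi> / weight j s \<xi>)\<^sup>2) \<partial>dual_measure \<Gamma>) < \<infinity>"
proof -
  define R where "R = line_indices \<Gamma>"
  define a where "a = 2 / real (card R)"
  have a: "0 < a" "a < 1" using r by (auto simp: a_def R_def)
  have R: "finite R" "R \<noteq> {}" using r by (auto simp: R_def)
  define p where "p i t = 1 / (1 + t\<^sup>2)" for i :: 'n and t :: real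
  define q where "q i t = (if i \<in> R then \<bar>t\<bar> powr (- a) else 1) * (1 / (1 + t\<^sup>2))" for i t
  have p_nonneg: "p i t \<ge> 0" and q_nonneg: "q i t \<ge> 0" for i t by (auto simp: p_def q_def)
  have [measurable]: "p i \<in> borel_measurable borel" "q i \<in> borel_measurable borel" for i
    unfolding p_def[abs_def] q_def[abs_def] by measurable
  have p_fin: "(\<integral>\<^sup>+t. ennreal (p i t) \<partial>dual_factor_measure (\<Gamma> i)) < \<infinity>" for i
    using nn_integral_lattice_finite nn_integral_inverse_1_plus_square adm
    by (cases "\<Gamma> i") (auto simp: p_def dual_factor_measure_def admissible_def)
  have q_fin: "(\<integral>\<^sup>+t. ennreal (q i t) \<partial>dual_factor_measure (\<Gamma> i)) < \<infinity>" for i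
  proof (cases "i \<in> R")
    case True
    then show ?thesis using nn_integral_singular_power[OF a] by (simp add: q_def R_def line_indices_def dual_factor_measure_def)
  next
    case False
    then show ?thesis using p_fin[of i] by (simp add: q_def p_def)
  qed
  have "AE \<xi> in dual_measure \<Gamma>. ennreal ((dual_decay \<xi> / weight j s \<xi>)\<^sup>2) \<le> (\<Prod>i\<in>UNIV. ennreal (p i (\<xi> $ i))) + (\<Prod>i\<in>UNIV. ennreal (q i (\<xi> $ i)))"
  proof -
    have "AE \<xi> in dual_measure \<Gamma>. \<forall>i\<in>R. \<xi> $ i \<noteq> 0"
      using AE_line_coordinate_nonzero R by (intro AE_finite_allI) (auto simp: R_def)
    then show ?thesis
    proof eventually_elim
      case (elim \<xi>)
      then have \<xi>: "\<xi> \<noteq> 0" using R by auto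
      have "(\<Prod>i\<in>R. \<bar>\<xi> $ i\<bar> powr a) \<le> (\<Prod>i\<in>R. norm \<xi> powr a)"
        using a by (intro prod_mono conjI powr_mono2) (auto simp: component_le_norm_cart)
      also have "\<dots> = (norm \<xi>) powr (real (card R) * a)"
        using \<xi> by (simp add: powr_realpow[symmetric] powr_powr mult.commute)
      also have "real (card R) * a = 2" using R by (simp add: a_def)
      also have "(norm \<xi>) powr 2 = (norm \<xi>)\<^sup>2" using \<xi> by (simp add: powr_numeral)
      finally have le: "(\<Prod>i\<in>R. \<bar>\<xi> $ i\<bar> powr a) \<le> (norm \<xi>)\<^sup>2" .
      have pos: "(\<Prod>i\<in>R. \<bar>\<xi> $ i\<bar> powr a) > 0" using elim by (intro prod_pos) auto
      have "1 / (norm \<xi>)\<^sup>2 \<le> 1 / (\<Prod>i\<in>R. \<bar>\<xi> $ i\<bar> powr a)"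
        using le pos \<xi> by (intro divide_left_mono) auto
      also have "\<dots> = (\<Prod>i\<in>R. \<bar>\<xi> $ i\<bar> powr (- a))" by (simp add: powr_minus_divide prod_dividef)
      also have "\<dots> = (\<Prod>i\<in>UNIV. if i \<in> R then \<bar>\<xi> $ i\<bar> powr (- a) else 1)" by (simp add: prod.If_cases)
      finally have inv: "1 / (weight j s \<xi>)\<^sup>2 \<le> 1 + (\<Prod>i\<in>UNIV. if i \<in> R then \<bar>\<xi> $ i\<bar> powr (- a) else 1)"
        using inverse_weight_sq_le[OF s \<xi>, of j] by linarith
      have "(dual_decay \<xi> / weight j s \<xi>)\<^sup>2 = (dual_decay \<xi>)\<^sup>2 * (1 / (weight j s \<xi>)\<^sup>2)"
        by (simp add: power_divide)
      also have "\<dots> \<le> dual_decay \<xi> * (1 + (\<Prod>i\<in>UNIV. if i \<in> R then \<bar>\<xi> $ i\<bar> powr (- a) else 1))"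
        using dual_decay_pos[of \<xi>] dual_decay_le_1[of \<xi>] inv
        by (intro mult_mono) (auto simp: power2_eq_square mult_left_le)
      also have "\<dots> = (\<Prod>i\<in>UNIV. p i (\<xi> $ i)) + (\<Prod>i\<in>UNIV. q i (\<xi> $ i))"
      proof -
        have "(\<Prod>i\<in>UNIV. q i (\<xi> $ i)) = (\<Prod>i\<in>UNIV. if i \<in> R then \<bar>\<xi> $ i\<bar> powr (- a) else 1) * dual_decay \<xi>"
          unfolding q_def dual_decay_def by (rule prod.distrib)
        moreover have "(\<Prod>i\<in>UNIV. p i (\<xi> $ i)) = dual_decay \<xi>"
          unfolding p_def dual_decay_def ..
        ultimately show ?thesis by (simp only: distrib_left mult_1_right mult.commute)
      qed
      finally have "ennreal ((dual_decay \<xi> / weight j s \<xi>)\<^sup>2) \<le> ennreal ((\<Prod>i\<in>UNIV. p i (\<xi> $ i)) + (\<Prod>i\<in>UNIV. q i (\<xi> $ i)))"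
        by (rule ennreal_leI)
      then show ?case
        by (simp add: ennreal_plus prod_nonneg p_nonneg q_nonneg prod_ennreal)
    qed
  qed
  then have "(\<integral>\<^sup>+\<xi>. ennreal ((dual_decay \<xi> / weight j s \<xi>)\<^sup>2) \<partial>dual_measure \<Gamma>)
      \<le> (\<integral>\<^sup>+\<xi>. (\<Prod>i\<in>UNIV. ennreal (p i (\<xi> $ i))) + (\<Prod>i\<in>UNIV. ennreal (q i (\<xi> $ i))) \<partial>dual_measure \<Gamma>)"
    by (rule nn_integral_mono_AE)
  also have "\<dots> = (\<integral>\<^sup>+\<xi>. (\<Prod>i\<in>UNIV. ennreal (p i (\<xi> $ i))) \<partial>dual_measure \<Gamma>) + (\<integral>\<^sup>+\<xi>. (\<Prod>i\<in>UNIV. ennreal (q i (\<xi> $ i))) \<partial>dual_measure \<Gamma>)"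
  proof (rule nn_integral_add)
    show "(\<lambda>\<xi>. \<Prod>i\<in>UNIV. ennreal (p i (\<xi> $ i))) \<in> borel_measurable (dual_measure \<Gamma>)" by measurable
    show "(\<lambda>\<xi>. \<Prod>i\<in>UNIV. ennreal (q i (\<xi> $ i))) \<in> borel_measurable (dual_measure \<Gamma>)" by measurable
  qed
  also have "\<dots> = (\<Prod>i\<in>UNIV. \<integral>\<^sup>+t. ennreal (p i t) \<partial>dual_factor_measure (\<Gamma> i)) + (\<Prod>i\<in>UNIV. \<integral>\<^sup>+t. ennreal (q i t) \<partial>dual_factor_measure (\<Gamma> i))"
    by (intro arg_cong2[where f = "(+)"] nn_integral_dual_prod) measurable
  also have "\<dots> < \<infinity>"
    using p_fin q_fin by (auto simp: less_top[symmetric] ennreal_prod_eq_top)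
  finally show ?thesis .
qed


section \<open>Completeness of weighted square-integrable functions\<close>

text \<open>
  Along a subsequence \<open>r\<close>, the weighted increments \<open>d\<^sub>k\<close> have squared norm at most \<open>8\<^sup>-\<^sup>k\<close>.  Then
  \<open>\<Sum>k. 2\<^sup>k d\<^sub>k\<^sup>2\<close> has finite integral, and \<open>d\<^sub>k \<le> 2\<^sup>-\<^sup>k + 2\<^sup>k d\<^sub>k\<^sup>2\<close> shows that the increments are summable almost
  everywhere.  Convergence in norm follows by Fatou's lemma.
\<close>

lemma square_integrable_Cauchy_limit:
  fixes g :: "nat \<Rightarrow> 'a \<Rightarrow> complex" and w :: "'a \<Rightarrow> real"
  assumes [measurable]: "\<And>n. g n \<in> borel_measurable M" "w \<in> borel_measurable M" and w: "\<And>x. w x > 0"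
    and Cauchy: "\<And>e. e > 0 \<Longrightarrow> \<exists>N. \<forall>m\<ge>N. \<forall>n\<ge>N. (\<integral>\<^sup>+x. ennreal ((w x * norm (g m x - g n x))\<^sup>2) \<partial>M) \<le> ennreal e"
  shows "\<exists>r h. strict_mono r \<and> h \<in> borel_measurable M \<and> (AE x in M. (\<lambda>k. g (r k) x) \<longlonglongrightarrow> h x) \<and>
    (\<forall>e>0. \<exists>N. \<forall>n\<ge>N. (\<integral>\<^sup>+x. ennreal ((w x * norm (g n x - h x))\<^sup>2) \<partial>M) \<le> ennreal e)"
proof -
  have "\<exists>N. \<forall>m\<ge>N. \<forall>n\<ge>N. (\<integral>\<^sup>+x. ennreal ((w x * norm (g m x - g n x))\<^sup>2) \<partial>M) \<le> ennreal ((1 / 8) ^ k)" for k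
    by (rule Cauchy) simp
  then obtain N where N: "\<And>k m n. m \<ge> N k \<Longrightarrow> n \<ge> N k \<Longrightarrow>
      (\<integral>\<^sup>+x. ennreal ((w x * norm (g m x - g n x))\<^sup>2) \<partial>M) \<le> ennreal ((1 / 8) ^ k)"
    by metis
  \<comment> \<open>The sum makes \<open>r\<close> strictly increasing and keeps it above each \<open>N k\<close>.\<close>
  define r where "r k = (\<Sum>i\<le>k. N i) + k" for k
  have r: "strict_mono r" by (rule strict_monoI_Suc) (simp add: r_def)
  have rN: "r k \<ge> N k" for k
    using member_le_sum[of k "{..k}" N] by (simp add: r_def)
  have rN': "r (Suc k) \<ge> N k" for k using rN[of k] strict_mono_Suc_iff[THEN iffD1, OF r, rule_format, of k] by simp
  define d where "d k x = w x * norm (g (r (Suc k)) x - g (r k) x)" for k x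
  have [measurable]: "d k \<in> borel_measurable M" for k unfolding d_def[abs_def] by measurable
  have d_nonneg: "d k x \<ge> 0" for k x using w[of x] by (simp add: d_def less_imp_le)
  have "(\<integral>\<^sup>+x. (\<Sum>k. ennreal (2 ^ k * (d k x)\<^sup>2)) \<partial>M) = (\<Sum>k. \<integral>\<^sup>+x. ennreal (2 ^ k * (d k x)\<^sup>2) \<partial>M)"
    by (rule nn_integral_suminf) measurable
  also have "\<dots> = (\<Sum>k. ennreal (2 ^ k) * (\<integral>\<^sup>+x. ennreal ((d k x)\<^sup>2) \<partial>M))"
    by (simp add: ennreal_mult nn_integral_cmult)
  also have "\<dots> \<le> (\<Sum>k. ennreal (2 ^ k) * ennreal ((1 / 8) ^ k))"
    by (intro suminf_le mult_left_mono) (auto simp: d_def intro!: N rN rN')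
  also have "\<dots> = (\<Sum>k. ennreal ((1 / 4) ^ k))"
    by (simp add: ennreal_mult[symmetric] power_mult_distrib[symmetric])
  also have "\<dots> = ennreal (\<Sum>k. (1 / 4) ^ k)"
    by (rule suminf_ennreal2) (auto intro: summable_geometric)
  also have "\<dots> < \<infinity>" by simp
  finally have "(\<integral>\<^sup>+x. (\<Sum>k. ennreal (2 ^ k * (d k x)\<^sup>2)) \<partial>M) \<noteq> \<infinity>" by simp
  then have "AE x in M. (\<Sum>k. ennreal (2 ^ k * (d k x)\<^sup>2)) \<noteq> \<infinity>"
    by (intro nn_integral_PInf_AE) measurable
  then have conv: "AE x in M. convergent (\<lambda>k. g (r k) x)"
  proof eventually_elim
    case (elim x)
    have "summable (\<lambda>k. 2 ^ k * (d k x)\<^sup>2)"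
      using elim by (intro summable_suminf_not_top) (auto simp: top_ennreal_def[symmetric])
    moreover have "summable (\<lambda>k. (1 / 2 :: real) ^ k)" by (rule summable_geometric) simp
    ultimately have sm: "summable (\<lambda>k. ((1 / 2) ^ k + 2 ^ k * (d k x)\<^sup>2) / w x)"
      by (intro summable_divide summable_add)
    have "d k x \<le> (1 / 2) ^ k + 2 ^ k * (d k x)\<^sup>2" for k
    proof -
      have "d k x = (1 / 2) ^ k * (2 ^ k * d k x)" by (simp add: power_divide)
      also have "\<dots> \<le> (1 / 2) ^ k * (1 + (2 ^ k * d k x)\<^sup>2)"
      proof (rule mult_left_mono)
        have "2 * (2 ^ k * d k x) \<le> (2 ^ k * d k x)\<^sup>2 + 1" using sum_squares_bound[of "2 ^ k * d k x" 1] by simp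
        moreover have "0 \<le> 2 ^ k * d k x" using d_nonneg by simp
        ultimately show "2 ^ k * d k x \<le> 1 + (2 ^ k * d k x)\<^sup>2" by linarith
      qed simp
      also have "\<dots> = (1 / 2) ^ k + 2 ^ k * (d k x)\<^sup>2"
        by (simp add: power_mult_distrib distrib_left power_divide power2_eq_square)
      finally show ?thesis .
    qed
    then have nb: "norm (g (r (Suc k)) x - g (r k) x) \<le> ((1 / 2) ^ k + 2 ^ k * (d k x)\<^sup>2) / w x" for k
      using w[of x] by (simp add: pos_le_divide_eq d_def mult.commute)
    have "summable (\<lambda>k. g (r (Suc k)) x - g (r k) x)"
      by (rule summable_comparison_test'[OF sm, where N = 0]) (rule nb)
    then have "convergent (\<lambda>n. \<Sum>k<n. g (r (Suc k)) x - g (r k) x)"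
      by (simp add: summable_iff_convergent)
    then have "convergent (\<lambda>n. (g (r n) x - g (r 0) x) + g (r 0) x)"
      by (subst (asm) sum_lessThan_telescope) (intro convergent_add convergent_const)
    then show ?case by simp
  qed
  define h where "h x = lim (\<lambda>k. g (r k) x)" for x
  have [measurable]: "h \<in> borel_measurable M" unfolding h_def[abs_def] by measurable
  have lim: "AE x in M. (\<lambda>k. g (r k) x) \<longlonglongrightarrow> h x"
    using conv by eventually_elim (simp add: h_def convergent_LIMSEQ_iff)
  have "\<exists>N. \<forall>n\<ge>N. (\<integral>\<^sup>+x. ennreal ((w x * norm (g n x - h x))\<^sup>2) \<partial>M) \<le> ennreal e" if e: "e > 0" for e
  proof -
    obtain K where K: "\<And>m n. m \<ge> K \<Longrightarrow> n \<ge> K \<Longrightarrow> (\<integral>\<^sup>+x. ennreal ((w x * norm (g m x - g n x))\<^sup>2) \<partial>M) \<le> ennreal e"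
      using Cauchy[OF e] by blast
    have "(\<integral>\<^sup>+x. ennreal ((w x * norm (g n x - h x))\<^sup>2) \<partial>M) \<le> ennreal e" if n: "n \<ge> K" for n
    proof -
      have "(\<integral>\<^sup>+x. ennreal ((w x * norm (g n x - h x))\<^sup>2) \<partial>M)
          = (\<integral>\<^sup>+x. liminf (\<lambda>k. ennreal ((w x * norm (g n x - g (r k) x))\<^sup>2)) \<partial>M)"
      proof (rule nn_integral_cong_AE)
        show "AE x in M. ennreal ((w x * norm (g n x - h x))\<^sup>2) = liminf (\<lambda>k. ennreal ((w x * norm (g n x - g (r k) x))\<^sup>2))"
          using lim
        proof eventually_elim
          case (elim x)
          have "(\<lambda>k. ennreal ((w x * norm (g n x - g (r k) x))\<^sup>2)) \<longlonglongrightarrow> ennreal ((w x * norm (g n x - h x))\<^sup>2)"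
            using elim by (intro tendsto_ennrealI tendsto_intros)
          then show ?case by (rule lim_imp_Liminf[OF sequentially_bot, symmetric])
        qed
      qed
      also have "\<dots> \<le> liminf (\<lambda>k. \<integral>\<^sup>+x. ennreal ((w x * norm (g n x - g (r k) x))\<^sup>2) \<partial>M)"
        by (rule nn_integral_liminf) measurable
      also have "\<dots> \<le> limsup (\<lambda>k. \<integral>\<^sup>+x. ennreal ((w x * norm (g n x - g (r k) x))\<^sup>2) \<partial>M)"
        by (rule Liminf_le_Limsup) simp
      also have "\<dots> \<le> ennreal e"
      proof (rule Limsup_bounded)
        show "\<forall>\<^sub>F k in sequentially. (\<integral>\<^sup>+x. ennreal ((w x * norm (g n x - g (r k) x))\<^sup>2) \<partial>M) \<le> ennreal e"
          using eventually_ge_at_top[of K]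
        proof eventually_elim
          case (elim k)
          then have "r k \<ge> K" using strict_mono_imp_increasing[OF r, of k] by simp
          then show ?case using K n by simp
        qed
      qed
      finally show ?thesis .
    qed
    then show ?thesis by blast
  qed
  with r lim show ?thesis by (intro exI[of _ r] exI[of _ h]) auto
qed


section \<open>The norm of a distribution in terms of its Fourier transform\<close>

lemma weighted_sq_norm_cong_AE:
  "AE \<xi> in dual_measure \<Gamma>. g \<xi> = h \<xi> \<Longrightarrow> weighted_sq_norm \<Gamma> j s g = weighted_sq_norm \<Gamma> j s h"
  unfolding weighted_sq_norm_def by (rule nn_integral_cong_AE) (auto elim!: eventually_mono)

lemma X_norm_sq_eq:
  assumes "admissible \<Gamma>" "fourier_is_fun \<Gamma> f g"
  shows "X_norm_sq \<Gamma> j s f = weighted_sq_norm \<Gamma> j s g"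
  using weighted_sq_norm_cong_AE[OF fourier_fun_AE[OF assms]]
  by (simp add: X_norm_sq_def weighted_sq_norm_def weight_def)

lemma X_norm_diff:
  assumes "admissible \<Gamma>" "f \<in> tempered \<Gamma>" "f' \<in> tempered \<Gamma>" "fourier_is_fun \<Gamma> f g" "fourier_is_fun \<Gamma> f' g'"
  shows "X_norm \<Gamma> j s (\<lambda>\<phi>. f \<phi> - f' \<phi>) = sqrt (enn2real (weighted_sq_norm \<Gamma> j s (\<lambda>\<xi>. g \<xi> - g' \<xi>)))"
proof -
  obtain h where h: "fourier_is_fun \<Gamma> (\<lambda>\<phi>. f \<phi> - f' \<phi>) h" "AE \<xi> in dual_measure \<Gamma>. h \<xi> = g \<xi> - g' \<xi>"
    using fourier_is_fun_diff[OF assms] by blast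
  show ?thesis
    using X_norm_sq_eq[OF assms(1) h(1)] weighted_sq_norm_cong_AE[OF h(2)] by (simp add: X_norm_def)
qed

lemma weighted_sq_norm_diff_le:
  assumes [measurable]: "g \<in> borel_measurable borel" "h \<in> borel_measurable borel"
  shows "weighted_sq_norm \<Gamma> j s (\<lambda>\<xi>. g \<xi> - h \<xi>) \<le> 2 * weighted_sq_norm \<Gamma> j s g + 2 * weighted_sq_norm \<Gamma> j s h"
proof -
  have m: "(\<lambda>\<xi>. ennreal ((weight j s \<xi> * norm (f \<xi>))\<^sup>2)) \<in> borel_measurable (dual_measure \<Gamma>)"
    if [measurable]: "f \<in> borel_measurable borel" for f :: "real ^ 'a \<Rightarrow> complex"
  proof -
    have "(\<lambda>\<xi>. ennreal ((weight j s \<xi> * norm (f \<xi>))\<^sup>2)) \<in> borel_measurable borel" by measurable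
    then show ?thesis by simp
  qed
  have "(weight j s \<xi> * norm (g \<xi> - h \<xi>))\<^sup>2 \<le> 2 * (weight j s \<xi> * norm (g \<xi>))\<^sup>2 + 2 * (weight j s \<xi> * norm (h \<xi>))\<^sup>2" for \<xi>
  proof -
    let ?a = "weight j s \<xi> * norm (g \<xi>)" and ?b = "weight j s \<xi> * norm (h \<xi>)"
    have "weight j s \<xi> * norm (g \<xi> - h \<xi>) \<le> ?a + ?b"
      using weight_pos[of j s \<xi>] norm_triangle_ineq4[of "g \<xi>" "h \<xi>"] by (simp add: distrib_left[symmetric])
    then have "(weight j s \<xi> * norm (g \<xi> - h \<xi>))\<^sup>2 \<le> (?a + ?b)\<^sup>2"
      using weight_pos[of j s \<xi>] by (intro power_mono) auto
    also have "\<dots> \<le> 2 * ?a\<^sup>2 + 2 * ?b\<^sup>2" using sum_squares_bound[of ?a ?b] by (simp add: power2_sum)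
    finally show ?thesis .
  qed
  then have "weighted_sq_norm \<Gamma> j s (\<lambda>\<xi>. g \<xi> - h \<xi>) \<le>
      (\<integral>\<^sup>+\<xi>. 2 * ennreal ((weight j s \<xi> * norm (g \<xi>))\<^sup>2) + 2 * ennreal ((weight j s \<xi> * norm (h \<xi>))\<^sup>2) \<partial>dual_measure \<Gamma>)"
    unfolding weighted_sq_norm_def
    by (intro nn_integral_mono) (auto simp: ennreal_mult[symmetric] ennreal_plus[symmetric] ennreal_numeral[symmetric]
        simp del: ennreal_plus ennreal_numeral intro!: ennreal_leI)
  also have "\<dots> = 2 * weighted_sq_norm \<Gamma> j s g + 2 * weighted_sq_norm \<Gamma> j s h"
    unfolding weighted_sq_norm_def using m assms by (simp add: nn_integral_add nn_integral_cmult)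
  finally show ?thesis .
qed

lemma sqrt_enn2real_less_iff:
  assumes "x < \<infinity>" "e > 0"
  shows "sqrt (enn2real x) < e \<longleftrightarrow> x < ennreal (e\<^sup>2)"
proof -
  obtain y where y: "x = ennreal y" "y \<ge> 0" using assms(1) by (cases x) auto
  have "sqrt y < e \<longleftrightarrow> y < e\<^sup>2"
    using assms(2) y(2) by (metis less_imp_le real_sqrt_abs2 real_sqrt_less_iff abs_of_nonneg power2_eq_square)
  then show ?thesis using y by (simp add: ennreal_less_iff)
qed

lemma X_spaceE:
  assumes "admissible \<Gamma>" "f \<in> X_space \<F> \<Gamma> j s"
  obtains g where "f \<in> tempered \<Gamma>" "fourier_is_fun \<Gamma> f g" "weighted_sq_norm \<Gamma> j s g < \<infinity>"
    "\<F> = Real_scalars \<Longrightarrow> f = cnj_dist f"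
  using assms X_norm_sq_eq[OF assms(1)] unfolding X_space_def by force

lemma inverse_fourier_dist_in_X_space:
  assumes "admissible \<Gamma>" "moderate \<Gamma> g" "weighted_sq_norm \<Gamma> j s g < \<infinity>"
    and "\<F> = Real_scalars \<Longrightarrow> AE \<xi> in dual_measure \<Gamma>. g (- \<xi>) = cnj (g \<xi>)"
  obtains h where "inverse_fourier_dist \<Gamma> g \<in> X_space \<F> \<Gamma> j s" "fourier_is_fun \<Gamma> (inverse_fourier_dist \<Gamma> g) h"
    "AE \<xi> in dual_measure \<Gamma>. h \<xi> = g \<xi>"
proof
  let ?h = "\<lambda>\<xi>. if \<xi> \<in> dual_group \<Gamma> then g \<xi> else 1"
  show h: "fourier_is_fun \<Gamma> (inverse_fourier_dist \<Gamma> g) ?h"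
    by (rule fourier_is_fun_inverse_fourier_dist[OF assms(1,2)])
  show AE: "AE \<xi> in dual_measure \<Gamma>. ?h \<xi> = g \<xi>"
    using AE_dual_group by eventually_elim simp
  have "X_norm_sq \<Gamma> j s (inverse_fourier_dist \<Gamma> g) < \<infinity>"
    using X_norm_sq_eq[OF assms(1) h] weighted_sq_norm_cong_AE[OF AE] assms(3) by simp
  then show "inverse_fourier_dist \<Gamma> g \<in> X_space \<F> \<Gamma> j s"
    using inverse_fourier_dist_tempered[OF assms(1,2)] h inverse_fourier_dist_real[OF assms(1,2)] assms(4)
    unfolding X_space_def by blast
qed


section \<open>Completeness in at least three line directions\<close>

text \<open>
  The Cauchy--Schwarz inequality in the form \<open>\<bar>g\<bar> \<rho> \<le> (w \<bar>g\<bar>)\<^sup>2 + (\<rho> / w)\<^sup>2\<close>, where \<open>\<rho>\<close> is the decay of the Fourier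
  transforms of Schwartz functions.
\<close>

lemma moderate_of_weighted_sq_norm:
  assumes "admissible \<Gamma>" "s \<ge> 0" "card (line_indices \<Gamma>) > 2"
    and [measurable]: "g \<in> borel_measurable borel" and "weighted_sq_norm \<Gamma> j s g < \<infinity>"
  shows "moderate \<Gamma> g"
  unfolding moderate_def
proof
  have "(\<lambda>\<xi>. norm (g \<xi>) * dual_decay \<xi>) \<in> borel_measurable borel" by measurable
  moreover have "(\<integral>\<^sup>+\<xi>. ennreal (norm (norm (g \<xi>) * dual_decay \<xi>)) \<partial>dual_measure \<Gamma>) < \<infinity>"
  proof -
    have "norm (norm (g \<xi>) * dual_decay \<xi>) \<le> (weight j s \<xi> * norm (g \<xi>))\<^sup>2 + (dual_decay \<xi> / weight j s \<xi>)\<^sup>2" for \<xi>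
    proof -
      let ?a = "weight j s \<xi> * norm (g \<xi>)" and ?b = "dual_decay \<xi> / weight j s \<xi>"
      have w: "weight j s \<xi> > 0" and d: "dual_decay \<xi> > 0" by (rule weight_pos, rule dual_decay_pos)
      have "norm (norm (g \<xi>) * dual_decay \<xi>) = ?a * ?b" using w d by (simp add: abs_mult)
      moreover have "2 * (?a * ?b) \<le> ?a\<^sup>2 + ?b\<^sup>2" using sum_squares_bound[of ?a ?b] by (simp only: mult.assoc)
      moreover have "?a * ?b \<ge> 0" using w d by (intro mult_nonneg_nonneg) auto
      ultimately show ?thesis by linarith
    qed
    then have "(\<integral>\<^sup>+\<xi>. ennreal (norm (norm (g \<xi>) * dual_decay \<xi>)) \<partial>dual_measure \<Gamma>) \<le>
        (\<integral>\<^sup>+\<xi>. ennreal ((weight j s \<xi> * norm (g \<xi>))\<^sup>2) + ennreal ((dual_decay \<xi> / weight j s \<xi>)\<^sup>2) \<partial>dual_measure \<Gamma>)"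
      by (intro nn_integral_mono) (simp add: ennreal_plus[symmetric] del: ennreal_plus)
    also have "\<dots> = weighted_sq_norm \<Gamma> j s g + (\<integral>\<^sup>+\<xi>. ennreal ((dual_decay \<xi> / weight j s \<xi>)\<^sup>2) \<partial>dual_measure \<Gamma>)"
      unfolding weighted_sq_norm_def
    proof (rule nn_integral_add)
      show "(\<lambda>\<xi>. ennreal ((weight j s \<xi> * norm (g \<xi>))\<^sup>2)) \<in> borel_measurable (dual_measure \<Gamma>)" by measurable
      show "(\<lambda>\<xi>. ennreal ((dual_decay \<xi> / weight j s \<xi>)\<^sup>2)) \<in> borel_measurable (dual_measure \<Gamma>)" by measurable
    qed
    also have "\<dots> < \<infinity>"
      using assms(5) nn_integral_decay_over_weight[OF assms(1-3)] by simp
    finally show ?thesis .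
  qed
  ultimately show "integrable (dual_measure \<Gamma>) (\<lambda>\<xi>. norm (g \<xi>) * dual_decay \<xi>)"
    by (simp add: integrable_iff_bounded)
qed fact

text \<open>
  The limit of the Fourier transforms in the weighted space is the Fourier transform of a tempered distribution
  by \<open>moderate_of_weighted_sq_norm\<close>.  A subsequence converges almost everywhere, so that the symmetry that
  characterises real distributions is inherited by the limit.
\<close>

theorem X_complete_of_three_lines:
  fixes \<Gamma> :: "'n::finite \<Rightarrow> factor"
  assumes adm: "admissible \<Gamma>" and s: "s \<ge> 0" and r: "card (line_indices \<Gamma>) > 2"
  shows "X_complete \<F> \<Gamma> j s"
  unfolding X_complete_def
proof (intro allI impI, elim conjE)
  fix \<sigma> :: "nat \<Rightarrow> 'n functional"
  assume X: "\<forall>n. \<sigma> n \<in> X_space \<F> \<Gamma> j s"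
    and Cauchy: "\<forall>\<epsilon>>0. \<exists>N. \<forall>m\<ge>N. \<forall>n\<ge>N. X_norm \<Gamma> j s (\<lambda>\<phi>. \<sigma> m \<phi> - \<sigma> n \<phi>) < \<epsilon>"
  have "\<exists>g. \<sigma> n \<in> tempered \<Gamma> \<and> fourier_is_fun \<Gamma> (\<sigma> n) g \<and> weighted_sq_norm \<Gamma> j s g < \<infinity> \<and>
      (\<F> = Real_scalars \<longrightarrow> \<sigma> n = cnj_dist (\<sigma> n))" for n
    using X_spaceE[OF adm X[rule_format, of n]] by metis
  then obtain g where t: "\<And>n. \<sigma> n \<in> tempered \<Gamma>" and g: "\<And>n. fourier_is_fun \<Gamma> (\<sigma> n) (g n)"
    and fin: "\<And>n. weighted_sq_norm \<Gamma> j s (g n) < \<infinity>"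
    and real: "\<And>n. \<F> = Real_scalars \<Longrightarrow> \<sigma> n = cnj_dist (\<sigma> n)"
    by metis
  have gb [measurable]: "g n \<in> borel_measurable borel" for n using g by (rule fourier_is_fun_borel)
  have fin_diff: "weighted_sq_norm \<Gamma> j s (\<lambda>\<xi>. g m \<xi> - g n \<xi>) < \<infinity>" for m n
    using weighted_sq_norm_diff_le[OF gb gb, of \<Gamma> j s m n] fin[of m] fin[of n]
    by (auto simp: ennreal_mult_less_top intro: le_less_trans)
  have g_Cauchy: "\<exists>N. \<forall>m\<ge>N. \<forall>n\<ge>N. weighted_sq_norm \<Gamma> j s (\<lambda>\<xi>. g m \<xi> - g n \<xi>) \<le> ennreal e" if "e > 0" for e
  proof -
    have "sqrt e > 0" using that by simp
    then obtain N where N: "\<And>m n. m \<ge> N \<Longrightarrow> n \<ge> N \<Longrightarrow> X_norm \<Gamma> j s (\<lambda>\<phi>. \<sigma> m \<phi> - \<sigma> n \<phi>) < sqrt e"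
      using Cauchy by blast
    have "weighted_sq_norm \<Gamma> j s (\<lambda>\<xi>. g m \<xi> - g n \<xi>) \<le> ennreal e" if "m \<ge> N" "n \<ge> N" for m n
      using N[OF that] \<open>sqrt e > 0\<close> \<open>e > 0\<close> unfolding X_norm_diff[OF adm t t g g] sqrt_enn2real_less_iff[OF fin_diff \<open>sqrt e > 0\<close>]
      by (simp add: less_imp_le)
    then show ?thesis by blast
  qed
  have "\<exists>\<rho> h. strict_mono \<rho> \<and> h \<in> borel_measurable (dual_measure \<Gamma>) \<and>
      (AE \<xi> in dual_measure \<Gamma>. (\<lambda>k. g (\<rho> k) \<xi>) \<longlonglongrightarrow> h \<xi>) \<and>
      (\<forall>e>0. \<exists>N. \<forall>n\<ge>N. weighted_sq_norm \<Gamma> j s (\<lambda>\<xi>. g n \<xi> - h \<xi>) \<le> ennreal e)"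
    unfolding weighted_sq_norm_def
    by (rule square_integrable_Cauchy_limit[OF _ _ weight_pos g_Cauchy[unfolded weighted_sq_norm_def]]) simp_all
  then obtain \<rho> h where h_meas: "h \<in> borel_measurable (dual_measure \<Gamma>)"
    and lim: "AE \<xi> in dual_measure \<Gamma>. (\<lambda>k. g (\<rho> k) \<xi>) \<longlonglongrightarrow> h \<xi>"
    and conv: "\<And>e. e > 0 \<Longrightarrow> \<exists>N. \<forall>n\<ge>N. weighted_sq_norm \<Gamma> j s (\<lambda>\<xi>. g n \<xi> - h \<xi>) \<le> ennreal e"
    by blast
  have hb [measurable]: "h \<in> borel_measurable borel"
    using h_meas measurable_cong_sets[OF sets_dual_measure refl] by blast
  have h_fin: "weighted_sq_norm \<Gamma> j s h < \<infinity>"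
  proof -
    obtain N where N: "weighted_sq_norm \<Gamma> j s (\<lambda>\<xi>. g N \<xi> - h \<xi>) \<le> ennreal 1" using conv[of 1] by auto
    have "weighted_sq_norm \<Gamma> j s h = weighted_sq_norm \<Gamma> j s (\<lambda>\<xi>. g N \<xi> - (g N \<xi> - h \<xi>))" by simp
    also have "\<dots> \<le> 2 * weighted_sq_norm \<Gamma> j s (g N) + 2 * weighted_sq_norm \<Gamma> j s (\<lambda>\<xi>. g N \<xi> - h \<xi>)"
      by (rule weighted_sq_norm_diff_le) measurable
    also have "\<dots> < \<infinity>"
      using fin[of N] N by (auto simp: ennreal_mult_less_top intro: le_less_trans)
    finally show ?thesis .
  qed
  have mod: "moderate \<Gamma> h" by (rule moderate_of_weighted_sq_norm[OF adm s r hb h_fin])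
  have sym: "AE \<xi> in dual_measure \<Gamma>. h (- \<xi>) = cnj (h \<xi>)" if "\<F> = Real_scalars"
  proof -
    have "AE \<xi> in dual_measure \<Gamma>. \<forall>n. g n (- \<xi>) = cnj (g n \<xi>)"
      unfolding AE_all_countable using real_dist_fourier_symmetric[OF adm real[OF that] g] by blast
    then show ?thesis using lim AE_dual_reflect[OF lim]
    proof eventually_elim
      case (elim \<xi>)
      have "(\<lambda>k. g (\<rho> k) (- \<xi>)) \<longlonglongrightarrow> cnj (h \<xi>)" using elim(1,2) by (simp add: tendsto_cnj)
      then show ?case using elim(3) by (rule LIMSEQ_unique[rotated])
    qed
  qed
  obtain h' where f: "inverse_fourier_dist \<Gamma> h \<in> X_space \<F> \<Gamma> j s" "fourier_is_fun \<Gamma> (inverse_fourier_dist \<Gamma> h) h'"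
    and h': "AE \<xi> in dual_measure \<Gamma>. h' \<xi> = h \<xi>"
    using inverse_fourier_dist_in_X_space[OF adm mod h_fin sym] by blast
  have "(\<lambda>n. X_norm \<Gamma> j s (\<lambda>\<phi>. \<sigma> n \<phi> - inverse_fourier_dist \<Gamma> h \<phi>)) \<longlonglongrightarrow> 0"
  proof (rule LIMSEQ_I)
    fix e :: real assume e: "e > 0"
    then have "e\<^sup>2 / 2 > 0" by simp
    then obtain N where N: "\<And>n. n \<ge> N \<Longrightarrow> weighted_sq_norm \<Gamma> j s (\<lambda>\<xi>. g n \<xi> - h \<xi>) \<le> ennreal (e\<^sup>2 / 2)"
      using conv by blast
    have "norm (X_norm \<Gamma> j s (\<lambda>\<phi>. \<sigma> n \<phi> - inverse_fourier_dist \<Gamma> h \<phi>) - 0) < e" if "n \<ge> N" for n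
    proof -
      have "AE \<xi> in dual_measure \<Gamma>. g n \<xi> - h' \<xi> = g n \<xi> - h \<xi>" using h' by eventually_elim simp
      then have "X_norm \<Gamma> j s (\<lambda>\<phi>. \<sigma> n \<phi> - inverse_fourier_dist \<Gamma> h \<phi>) = sqrt (enn2real (weighted_sq_norm \<Gamma> j s (\<lambda>\<xi>. g n \<xi> - h \<xi>)))"
        using X_norm_diff[OF adm t inverse_fourier_dist_tempered[OF adm mod] g f(2)] weighted_sq_norm_cong_AE by metis
      moreover have "weighted_sq_norm \<Gamma> j s (\<lambda>\<xi>. g n \<xi> - h \<xi>) < ennreal (e\<^sup>2)"
        using N[OF that] e by (rule_tac le_less_trans) (auto simp: ennreal_less_iff)
      moreover from this have "weighted_sq_norm \<Gamma> j s (\<lambda>\<xi>. g n \<xi> - h \<xi>) < \<infinity>"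
        by (rule less_trans) simp
      ultimately show ?thesis using e sqrt_enn2real_less_iff by simp
    qed
    then show "\<exists>N. \<forall>n\<ge>N. norm (X_norm \<Gamma> j s (\<lambda>\<phi>. \<sigma> n \<phi> - inverse_fourier_dist \<Gamma> h \<phi>) - 0) < e" by blast
  qed
  with f(1) show "\<exists>f\<in>X_space \<F> \<Gamma> j s. (\<lambda>n. X_norm \<Gamma> j s (\<lambda>\<phi>. \<sigma> n \<phi> - f \<phi>)) \<longlonglongrightarrow> 0" by blast
qed


section \<open>Incompleteness in one or two line directions\<close>

text \<open>
  The cubes lie in the component of the origin, where all circle coordinates vanish.
\<close>

definition dyadic_cube :: "('n::finite \<Rightarrow> factor) \<Rightarrow> nat \<Rightarrow> (real ^ 'n) set" where
  "dyadic_cube \<Gamma> k = {\<xi>. \<forall>i. \<xi> $ i \<in> (if i \<in> line_indices \<Gamma> then {- (1 / 2 ^ k)..1 / 2 ^ k} else {0})}"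

definition dyadic_shell :: "('n::finite \<Rightarrow> factor) \<Rightarrow> nat \<Rightarrow> (real ^ 'n) set" where
  "dyadic_shell \<Gamma> k = dyadic_cube \<Gamma> k - dyadic_cube \<Gamma> (Suc k)"

lemma dyadic_cube_antimono: "k \<le> l \<Longrightarrow> dyadic_cube \<Gamma> l \<subseteq> dyadic_cube \<Gamma> k"
proof
  fix \<xi> assume "k \<le> l" and \<xi>: "\<xi> \<in> dyadic_cube \<Gamma> l"
  then have "(1::real) / 2 ^ l \<le> 1 / 2 ^ k" by (intro divide_left_mono) (auto intro: power_increasing)
  then show "\<xi> \<in> dyadic_cube \<Gamma> k"
    using \<xi> unfolding dyadic_cube_def by (auto split: if_splits) (smt (verit))+
qed

lemma dyadic_shell_disjoint:
  assumes "\<xi> \<in> dyadic_shell \<Gamma> k" "\<xi> \<in> dyadic_shell \<Gamma> l"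
  shows "k = l"
proof (rule ccontr)
  assume "k \<noteq> l"
  then consider "Suc k \<le> l" | "Suc l \<le> k" by linarith
  then show False
    using assms dyadic_cube_antimono[of "Suc k" l \<Gamma>] dyadic_cube_antimono[of "Suc l" k \<Gamma>]
    by cases (auto simp: dyadic_shell_def)
qed

lemma dyadic_cube_borel [measurable]: "dyadic_cube \<Gamma> k \<in> sets borel"
proof -
  have "dyadic_cube \<Gamma> k = cbox (\<chi> i. if i \<in> line_indices \<Gamma> then - (1 / 2 ^ k) else 0) (\<chi> i. if i \<in> line_indices \<Gamma> then 1 / 2 ^ k else 0)"
    by (auto simp: dyadic_cube_def mem_box_cart split: if_splits)
  then show ?thesis by simp
qed

lemma dyadic_shell_borel [measurable]: "dyadic_shell \<Gamma> k \<in> sets borel"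
  unfolding dyadic_shell_def by measurable

lemma uminus_dyadic_cube: "- \<xi> \<in> dyadic_cube \<Gamma> k \<longleftrightarrow> \<xi> \<in> dyadic_cube \<Gamma> k"
  by (auto simp: dyadic_cube_def split: if_splits)

lemma uminus_dyadic_shell: "- \<xi> \<in> dyadic_shell \<Gamma> k \<longleftrightarrow> \<xi> \<in> dyadic_shell \<Gamma> k"
  by (simp add: dyadic_shell_def uminus_dyadic_cube)

lemma zero_in_dual_factor: "0 \<in> dual_factor F"
proof (cases F)
  case (Circle L)
  then show ?thesis using rangeI[of "\<lambda>k::int. of_int k / L" 0] by (simp add: dual_factor_def)
qed (simp add: dual_factor_def)

lemma emeasure_dyadic_cube:
  "emeasure (dual_measure \<Gamma>) (dyadic_cube \<Gamma> k) = ennreal ((2 / 2 ^ k) ^ card (line_indices \<Gamma>))"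
proof -
  let ?A = "\<lambda>i. if i \<in> line_indices \<Gamma> then {- (1 / 2 ^ k)..1 / 2 ^ k} else {0} :: real set"
  have "emeasure (dual_measure \<Gamma>) (dyadic_cube \<Gamma> k) = (\<Prod>i\<in>UNIV. emeasure (dual_factor_measure (\<Gamma> i)) (?A i \<inter> dual_factor (\<Gamma> i)))"
    unfolding dyadic_cube_def by (rule emeasure_dual_measure_box) simp
  also have "\<dots> = (\<Prod>i\<in>UNIV. if i \<in> line_indices \<Gamma> then ennreal (2 / 2 ^ k) else 1)"
  proof (intro prod.cong refl)
    fix i
    show "emeasure (dual_factor_measure (\<Gamma> i)) (?A i \<inter> dual_factor (\<Gamma> i)) = (if i \<in> line_indices \<Gamma> then ennreal (2 / 2 ^ k) else 1)"
    proof (cases "\<Gamma> i")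
      case Line
      then show ?thesis by (simp add: line_indices_def dual_factor_measure_def dual_factor_def)
    next
      case (Circle L)
      then show ?thesis using zero_in_dual_factor[of "Circle L"]
        by (simp add: line_indices_def dual_factor_measure_def emeasure_count_space)
    qed
  qed
  also have "\<dots> = ennreal (2 / 2 ^ k) ^ card (line_indices \<Gamma>)"
    by (simp add: prod.If_cases)
  also have "\<dots> = ennreal ((2 / 2 ^ k) ^ card (line_indices \<Gamma>))"
    by (rule ennreal_power) simp
  finally show ?thesis .
qed

text \<open>
  The measure of the shell of index \<open>k\<close> in \<open>r\<close> line directions; see \<open>emeasure_dyadic_shell\<close>.
\<close>

definition shell_measure :: "nat \<Rightarrow> nat \<Rightarrow> real" where
  "shell_measure r k = (2 ^ r - 1) / (2 ^ k) ^ r"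

lemma emeasure_dyadic_shell:
  "emeasure (dual_measure \<Gamma>) (dyadic_shell \<Gamma> k) = ennreal (shell_measure (card (line_indices \<Gamma>)) k)"
proof -
  let ?r = "card (line_indices \<Gamma>)"
  have "emeasure (dual_measure \<Gamma>) (dyadic_shell \<Gamma> k)
      = emeasure (dual_measure \<Gamma>) (dyadic_cube \<Gamma> k) - emeasure (dual_measure \<Gamma>) (dyadic_cube \<Gamma> (Suc k))"
    unfolding dyadic_shell_def
    by (intro emeasure_Diff) (auto simp: emeasure_dyadic_cube dyadic_cube_antimono)
  also have "\<dots> = ennreal ((2 / 2 ^ k) ^ ?r - (2 / 2 ^ Suc k) ^ ?r)"
    unfolding emeasure_dyadic_cube by (rule ennreal_minus) simp
  also have "(2 / 2 ^ k) ^ ?r - (2 / 2 ^ Suc k) ^ ?r = shell_measure ?r k"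
    by (simp add: shell_measure_def power_divide diff_divide_distrib)
  finally show ?thesis .
qed

lemma shell_measure_pos: "r > 0 \<Longrightarrow> shell_measure r k > 0"
  using one_less_power[of "2::real" r] by (simp add: shell_measure_def)

text \<open>
  Chosen such that height times measure is a constant multiple of \<open>1 / (k + 1)\<close>: the harmonic series
  diverges while the series of the squares converges.
\<close>

definition shell_height :: "nat \<Rightarrow> nat \<Rightarrow> real" where
  "shell_height r k = (2 ^ k) ^ r / real (Suc k)"

definition shell_function :: "('n::finite \<Rightarrow> factor) \<Rightarrow> nat \<Rightarrow> real ^ 'n \<Rightarrow> real" where
  "shell_function \<Gamma> n \<xi> = (\<Sum>k<n. shell_height (card (line_indices \<Gamma>)) k * indicator (dyadic_shell \<Gamma> k) \<xi>)"

lemma shell_function_borel [measurable]: "shell_function \<Gamma> n \<in> borel_measurable borel"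
  unfolding shell_function_def[abs_def] by measurable

lemma shell_function_on_shell:
  assumes "\<xi> \<in> dyadic_shell \<Gamma> k"
  shows "shell_function \<Gamma> n \<xi> = (if k < n then shell_height (card (line_indices \<Gamma>)) k else 0)"
proof -
  have "indicator (dyadic_shell \<Gamma> l) \<xi> = (if l = k then 1 else 0 :: real)" for l
    using assms dyadic_shell_disjoint[of \<xi> \<Gamma>] by (auto simp: indicator_def)
  then show ?thesis by (simp add: shell_function_def sum.delta if_distrib[where f = "\<lambda>x. _ * x"] cong: if_cong)
qed

lemma shell_function_off_shells:
  assumes "\<And>k. \<xi> \<notin> dyadic_shell \<Gamma> k"
  shows "shell_function \<Gamma> n \<xi> = 0"
  using assms by (simp add: shell_function_def)

lemma shell_function_reflect: "shell_function \<Gamma> n (- \<xi>) = shell_function \<Gamma> n \<xi>"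
  by (simp add: shell_function_def indicator_def uminus_dyadic_shell)

lemma norm_dyadic_cube:
  fixes \<Gamma> :: "'n::finite \<Rightarrow> factor"
  assumes "\<xi> \<in> dyadic_cube \<Gamma> k"
  shows "(norm \<xi>)\<^sup>2 \<le> real CARD('n) / 4 ^ k"
proof -
  have "(\<xi> $ i)\<^sup>2 \<le> 1 / 4 ^ k" for i
  proof -
    have "\<bar>\<xi> $ i\<bar> \<le> 1 / 2 ^ k"
      using assms by (auto simp: dyadic_cube_def abs_le_iff minus_le_iff split: if_splits dest!: spec[of _ i])
    then have "\<bar>\<xi> $ i\<bar>\<^sup>2 \<le> (1 / 2 ^ k)\<^sup>2" by (intro power_mono) auto
    then show ?thesis by (simp add: power_divide power_mult[symmetric] mult.commute[of k] power_mult)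
  qed
  then have "(\<Sum>i\<in>UNIV. (\<xi> $ i)\<^sup>2) \<le> (\<Sum>i\<in>(UNIV::'n set). 1 / 4 ^ k)" by (intro sum_mono)
  then show ?thesis by (simp add: power2_norm_vec)
qed

lemma norm_dyadic_shell_le:
  fixes \<Gamma> :: "'n::finite \<Rightarrow> factor"
  assumes "\<xi> \<in> dyadic_shell \<Gamma> k"
  shows "norm \<xi> \<le> real CARD('n)"
proof -
  have "\<xi> \<in> dyadic_cube \<Gamma> 0" using assms dyadic_cube_antimono[of 0 k \<Gamma>] by (auto simp: dyadic_shell_def)
  then have "(norm \<xi>)\<^sup>2 \<le> real CARD('n)" using norm_dyadic_cube[of \<xi> \<Gamma> 0] by simp
  also have "\<dots> \<le> (real CARD('n))\<^sup>2" by (simp add: power2_eq_square mult_le_cancel_left1 del: of_nat_mult)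
  finally show ?thesis by (rule power2_le_imp_le) simp
qed

text \<open>
  Since \<open>j\<close> is a circle direction, \<open>\<xi>\<^sub>j\<close> vanishes on the shells, and of \<open>mu j \<xi>\<close> only the summand \<open>\<bar>\<xi>\<bar>\<close> remains.
\<close>

lemma weight_on_shell:
  fixes \<Gamma> :: "'n::finite \<Rightarrow> factor"
  assumes "j \<notin> line_indices \<Gamma>"
  obtains C where "C \<ge> 0" "\<And>\<xi> k. \<xi> \<in> dyadic_shell \<Gamma> k \<Longrightarrow> (weight j s \<xi>)\<^sup>2 \<le> C / 4 ^ k"
proof
  let ?d = "real CARD('n)"
  let ?K = "(1 + ?d) powr \<bar>s - 1\<bar>"
  show "?K\<^sup>2 * ?d \<ge> 0" by simp
  fix \<xi> k assume \<xi>: "\<xi> \<in> dyadic_shell \<Gamma> k"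
  then have cube: "\<xi> \<in> dyadic_cube \<Gamma> k" by (simp add: dyadic_shell_def)
  have "0 \<in> dyadic_cube \<Gamma> (Suc k)" by (simp add: dyadic_cube_def)
  then have nz: "\<xi> \<noteq> 0" using \<xi> by (auto simp: dyadic_shell_def)
  have "\<xi> $ j = 0" using cube assms by (auto simp: dyadic_cube_def split: if_splits dest!: spec[of _ j])
  then have mu: "mu j \<xi> = norm \<xi>" using nz by (simp add: mu_def)
  have "japanese \<xi> \<le> 1 + norm \<xi>" unfolding japanese_def by (rule real_le_lsqrt) (auto simp: power2_sum)
  then have jap: "japanese \<xi> \<le> 1 + ?d" using norm_dyadic_shell_le[OF \<xi>] by simp
  have "japanese \<xi> powr (s - 1) \<le> japanese \<xi> powr \<bar>s - 1\<bar>"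
    using japanese_ge_1[of \<xi>] by (intro powr_mono) auto
  also have "\<dots> \<le> ?K" using jap japanese_ge_1[of \<xi>] by (intro powr_mono2) auto
  finally have "weight j s \<xi> \<le> norm \<xi> * ?K" by (simp add: weight_def mu mult_left_mono)
  then have "(weight j s \<xi>)\<^sup>2 \<le> (norm \<xi> * ?K)\<^sup>2"
    using weight_pos[of j s \<xi>] by (intro power_mono) auto
  also have "\<dots> = ?K\<^sup>2 * (norm \<xi>)\<^sup>2" by (simp add: power_mult_distrib)
  also have "\<dots> \<le> ?K\<^sup>2 * (?d / 4 ^ k)" by (intro mult_left_mono norm_dyadic_cube[OF cube]) simp
  finally show "(weight j s \<xi>)\<^sup>2 \<le> ?K\<^sup>2 * ?d / 4 ^ k" by simp
qed

text \<open>
  The weight contributes \<open>4\<^sup>-\<^sup>k\<close>, and one height is cancelled by the measure.  The other height is of order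
  \<open>2\<^sup>k\<^sup>r\<close>, which the weight compensates because \<open>r \<le> 2\<close>.
\<close>

lemma shell_energy_le:
  assumes "r \<le> 2"
  shows "(shell_height r k)\<^sup>2 / 4 ^ k * shell_measure r k \<le> 4 / (real (Suc k))\<^sup>2"
proof -
  have p: "(2 ^ k :: real) ^ r > 0" by simp
  have "(shell_height r k)\<^sup>2 * shell_measure r k = ((2 ^ k) ^ r) * (2 ^ r - 1) / (real (Suc k))\<^sup>2"
    using p by (simp add: shell_height_def shell_measure_def power_divide power2_eq_square)
  also have "\<dots> \<le> (4 ^ k * 4) / (real (Suc k))\<^sup>2"
  proof (intro divide_right_mono mult_mono)
    have "(2 ^ k :: real) ^ r \<le> (2 ^ k) ^ 2" using assms by (intro power_increasing) auto
    also have "\<dots> = 4 ^ k" by (simp add: power_mult[symmetric] mult.commute[of k] power_mult)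
    finally show "(2 ^ k :: real) ^ r \<le> 4 ^ k" .
    have "(2::real) ^ r \<le> 2 ^ 2" using assms by (intro power_increasing) auto
    then show "(2::real) ^ r - 1 \<le> 4" by simp
  qed auto
  finally have "(shell_height r k)\<^sup>2 * shell_measure r k / 4 ^ k \<le> (4 ^ k * 4) / (real (Suc k))\<^sup>2 / 4 ^ k"
    by (rule divide_right_mono) simp
  then show ?thesis by simp
qed

lemma weighted_sq_norm_shell_diff:
  fixes \<Gamma> :: "'n::finite \<Rightarrow> factor"
  assumes r: "0 < card (line_indices \<Gamma>)" "card (line_indices \<Gamma>) \<le> 2"
    and C: "C \<ge> 0" "\<And>\<xi> k. \<xi> \<in> dyadic_shell \<Gamma> k \<Longrightarrow> (weight j s \<xi>)\<^sup>2 \<le> C / 4 ^ k"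
    and "n \<le> m"
  shows "weighted_sq_norm \<Gamma> j s (\<lambda>\<xi>. of_real (shell_function \<Gamma> m \<xi>) - of_real (shell_function \<Gamma> n \<xi>))
     \<le> ennreal (\<Sum>k=n..<m. 4 * C / (real (Suc k))\<^sup>2)"
proof -
  let ?r = "card (line_indices \<Gamma>)"
  define e where "e k = C / 4 ^ k * (shell_height ?r k)\<^sup>2" for k
  have e: "e k \<ge> 0" for k using C by (simp add: e_def)
  have "(weight j s \<xi> * norm (complex_of_real (shell_function \<Gamma> m \<xi>) - of_real (shell_function \<Gamma> n \<xi>)))\<^sup>2
      \<le> (\<Sum>k=n..<m. e k * indicator (dyadic_shell \<Gamma> k) \<xi>)" for \<xi>
  proof (cases "\<exists>k\<in>{n..<m}. \<xi> \<in> dyadic_shell \<Gamma> k")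
    case True
    then obtain k where k: "n \<le> k" "k < m" "\<xi> \<in> dyadic_shell \<Gamma> k" by auto
    then have "complex_of_real (shell_function \<Gamma> m \<xi>) - of_real (shell_function \<Gamma> n \<xi>) = of_real (shell_height ?r k)"
      by (simp add: shell_function_on_shell)
    then have "(weight j s \<xi> * norm (complex_of_real (shell_function \<Gamma> m \<xi>) - of_real (shell_function \<Gamma> n \<xi>)))\<^sup>2
        = (weight j s \<xi>)\<^sup>2 * (shell_height ?r k)\<^sup>2" by (simp add: power_mult_distrib)
    also have "\<dots> \<le> e k * indicator (dyadic_shell \<Gamma> k) \<xi>"
      unfolding e_def using k(3) mult_right_mono[OF C(2)[OF k(3)], of "(shell_height ?r k)\<^sup>2"] by simp
    also have "\<dots> \<le> (\<Sum>k=n..<m. e k * indicator (dyadic_shell \<Gamma> k) \<xi>)"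
      using k e by (intro member_le_sum) auto
    finally show ?thesis .
  next
    case False
    have "shell_function \<Gamma> m \<xi> = shell_function \<Gamma> n \<xi>"
    proof (cases "\<exists>k. \<xi> \<in> dyadic_shell \<Gamma> k")
      case True
      then obtain k where k: "\<xi> \<in> dyadic_shell \<Gamma> k" by blast
      then have "k < n \<or> k \<ge> m" using False by auto
      then show ?thesis using k \<open>n \<le> m\<close> by (auto simp: shell_function_on_shell)
    qed (simp add: shell_function_off_shells)
    then show ?thesis using e by (simp add: sum_nonneg)
  qed
  then have "weighted_sq_norm \<Gamma> j s (\<lambda>\<xi>. of_real (shell_function \<Gamma> m \<xi>) - of_real (shell_function \<Gamma> n \<xi>))
      \<le> (\<integral>\<^sup>+\<xi>. ennreal (\<Sum>k=n..<m. e k * indicator (dyadic_shell \<Gamma> k) \<xi>) \<partial>dual_measure \<Gamma>)"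
    unfolding weighted_sq_norm_def by (intro nn_integral_mono ennreal_leI)
  also have "\<dots> = (\<integral>\<^sup>+\<xi>. (\<Sum>k=n..<m. ennreal (e k) * indicator (dyadic_shell \<Gamma> k) \<xi>) \<partial>dual_measure \<Gamma>)"
  proof (intro nn_integral_cong)
    fix \<xi>
    have "ennreal (\<Sum>k=n..<m. e k * indicator (dyadic_shell \<Gamma> k) \<xi>) = (\<Sum>k=n..<m. ennreal (e k * indicator (dyadic_shell \<Gamma> k) \<xi>))"
      using e by (intro sum_ennreal[symmetric]) auto
    then show "ennreal (\<Sum>k=n..<m. e k * indicator (dyadic_shell \<Gamma> k) \<xi>) = (\<Sum>k=n..<m. ennreal (e k) * indicator (dyadic_shell \<Gamma> k) \<xi>)"
      using e by (simp add: ennreal_mult' ennreal_indicator)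
  qed
  also have "\<dots> = (\<Sum>k=n..<m. \<integral>\<^sup>+\<xi>. ennreal (e k) * indicator (dyadic_shell \<Gamma> k) \<xi> \<partial>dual_measure \<Gamma>)"
    by (rule nn_integral_sum) simp
  also have "\<dots> = (\<Sum>k=n..<m. ennreal (e k) * ennreal (shell_measure ?r k))"
    by (simp add: nn_integral_cmult_indicator emeasure_dyadic_shell)
  also have "\<dots> = ennreal (\<Sum>k=n..<m. e k * shell_measure ?r k)"
    using e shell_measure_pos[OF r(1)]
    by (subst sum_ennreal[symmetric]) (simp_all add: ennreal_mult' less_imp_le)
  also have "\<dots> \<le> ennreal (\<Sum>k=n..<m. 4 * C / (real (Suc k))\<^sup>2)"
  proof (intro ennreal_leI sum_mono)
    fix k
    have "e k * shell_measure ?r k = C * ((shell_height ?r k)\<^sup>2 / 4 ^ k * shell_measure ?r k)" by (simp add: e_def)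
    also have "\<dots> \<le> C * (4 / (real (Suc k))\<^sup>2)" by (intro mult_left_mono shell_energy_le r C)
    finally show "e k * shell_measure ?r k \<le> 4 * C / (real (Suc k))\<^sup>2" by (simp add: mult.commute)
  qed
  finally show ?thesis .
qed

lemma shell_function_moderate:
  fixes \<Gamma> :: "'n::finite \<Rightarrow> factor"
  assumes "admissible \<Gamma>"
  shows "moderate \<Gamma> (\<lambda>\<xi>. of_real (shell_function \<Gamma> n \<xi>))"
  unfolding moderate_def
proof
  let ?B = "\<Sum>k<n. shell_height (card (line_indices \<Gamma>)) k"
  have h: "shell_height r k \<ge> 0" for r k by (simp add: shell_height_def)
  have nn: "0 \<le> shell_function \<Gamma> n \<xi>" for \<xi> unfolding shell_function_def using h by (intro sum_nonneg) auto
  have le: "shell_function \<Gamma> n \<xi> \<le> ?B" for \<xi>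
    unfolding shell_function_def using h by (intro sum_mono) (auto simp: indicator_def)
  show "integrable (dual_measure \<Gamma>) (\<lambda>\<xi>. norm (complex_of_real (shell_function \<Gamma> n \<xi>)) * dual_decay \<xi>)"
  proof (rule integrable_bounded_support[OF assms])
    show "(\<lambda>\<xi>. norm (complex_of_real (shell_function \<Gamma> n \<xi>)) * dual_decay \<xi>) \<in> borel_measurable borel" by measurable
    show "norm (norm (complex_of_real (shell_function \<Gamma> n \<xi>)) * dual_decay \<xi>) \<le> ?B * 1" for \<xi>
    proof -
      have "norm (norm (complex_of_real (shell_function \<Gamma> n \<xi>)) * dual_decay \<xi>) = shell_function \<Gamma> n \<xi> * dual_decay \<xi>"
        using nn[of \<xi>] dual_decay_pos[of \<xi>] by (simp add: abs_mult)
      also have "\<dots> \<le> ?B * 1"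
        using nn[of \<xi>] le[of \<xi>] dual_decay_pos[of \<xi>] dual_decay_le_1[of \<xi>] by (intro mult_mono) auto
      finally show ?thesis .
    qed
    show "norm (complex_of_real (shell_function \<Gamma> n \<xi>)) * dual_decay \<xi> = 0" if "norm \<xi> > real CARD('n)" for \<xi>
      using shell_function_off_shells[of \<xi> \<Gamma> n] norm_dyadic_shell_le[of \<xi> \<Gamma>] that by force
  qed
qed measurable

lemma inverse_squares_tail:
  assumes "e > 0"
  shows "\<exists>N. \<forall>m n. N \<le> n \<longrightarrow> (\<Sum>k=n..<m. C / (real (Suc k))\<^sup>2) < e"
proof -
  have "summable (\<lambda>n. inverse ((real n)\<^sup>2))" by (rule inverse_power_summable) simp
  then have "summable (\<lambda>n. inverse ((real (Suc n))\<^sup>2))" by (rule summable_Suc_iff[THEN iffD2])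
  then have "summable (\<lambda>n. C / (real (Suc n))\<^sup>2)" using summable_mult[of _ C] by (simp add: divide_inverse)
  then obtain N where "\<And>m n. m \<ge> N \<Longrightarrow> norm (\<Sum>k=m..<n. C / (real (Suc k))\<^sup>2) < e"
    unfolding summable_Cauchy using assms by blast
  then show ?thesis by (metis abs_le_D1 le_less_trans order_refl real_norm_def)
qed

lemma shell_mass_unbounded:
  assumes "r > 0"
  shows "\<exists>n. (\<Sum>k<n. shell_height r k * shell_measure r k) > B"
proof -
  define c where "c = (2::real) ^ r - 1"
  have c: "c > 0" using one_less_power[of "2::real" r] assms by (simp add: c_def)
  have eq: "shell_height r k * shell_measure r k = c * (1 / real (Suc k))" for k
    by (simp add: shell_height_def shell_measure_def c_def)
  have "\<exists>n. (\<Sum>k<n. 1 / real (Suc k)) > B / c"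
  proof (rule ccontr)
    assume neg: "\<nexists>n. (\<Sum>k<n. 1 / real (Suc k)) > B / c"
    have "summable (\<lambda>k. 1 / real (Suc k))"
    proof (rule bounded_imp_summable[where B = "B / c"])
      show "(\<Sum>k\<le>n. 1 / real (Suc k)) \<le> B / c" for n
        using neg unfolding lessThan_Suc_atMost[symmetric] by (meson not_less)
    qed simp
    then have "summable (\<lambda>k. inverse (real (Suc k)))" by (simp add: inverse_eq_divide)
    then have "summable (\<lambda>k. inverse (real k))" by (rule summable_Suc_iff[THEN iffD1])
    then show False using not_summable_harmonic[where 'a = real] by simp
  qed
  then obtain n where n: "(\<Sum>k<n. 1 / real (Suc k)) > B / c" by blast
  have "(\<Sum>k<n. shell_height r k * shell_measure r k) = c * (\<Sum>k<n. 1 / real (Suc k))"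
    unfolding eq by (rule sum_distrib_left[symmetric])
  then show ?thesis using n c by (auto simp: pos_divide_less_eq mult.commute intro!: exI[of _ n])
qed

text \<open>
  The partial sums of the shell functions are real and even, so that the counterexample serves for both
  kinds of scalars.
\<close>

theorem not_X_complete_of_few_lines:
  fixes \<Gamma> :: "'n::finite \<Rightarrow> factor"
  assumes adm: "admissible \<Gamma>" and j: "j \<notin> line_indices \<Gamma>"
    and r: "0 < card (line_indices \<Gamma>)" "card (line_indices \<Gamma>) \<le> 2"
  shows "\<not> X_complete \<F> \<Gamma> j s"
proof
  assume complete: "X_complete \<F> \<Gamma> j s"
  let ?r = "card (line_indices \<Gamma>)"
  define G where "G n \<xi> = complex_of_real (shell_function \<Gamma> n \<xi>)" for n \<xi>
  have Gb [measurable]: "G n \<in> borel_measurable borel" for n unfolding G_def[abs_def] by measurable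
  obtain C where C: "C \<ge> 0" "\<And>\<xi> k. \<xi> \<in> dyadic_shell \<Gamma> k \<Longrightarrow> (weight j s \<xi>)\<^sup>2 \<le> C / 4 ^ k"
    using weight_on_shell[OF j, of s] by metis
  have diff: "weighted_sq_norm \<Gamma> j s (\<lambda>\<xi>. G m \<xi> - G n \<xi>) \<le> ennreal (\<Sum>k=n..<m. 4 * C / (real (Suc k))\<^sup>2)" if "n \<le> m" for m n
    unfolding G_def by (rule weighted_sq_norm_shell_diff[OF r C that])
  have diff_sym: "weighted_sq_norm \<Gamma> j s (\<lambda>\<xi>. G m \<xi> - G n \<xi>) = weighted_sq_norm \<Gamma> j s (\<lambda>\<xi>. G n \<xi> - G m \<xi>)" for m n
    by (simp add: weighted_sq_norm_def norm_minus_commute)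
  have fin: "weighted_sq_norm \<Gamma> j s (G n) < \<infinity>" for n
  proof -
    have "G 0 \<xi> = 0" for \<xi> by (simp add: G_def shell_function_def)
    then have "weighted_sq_norm \<Gamma> j s (G n) \<le> ennreal (\<Sum>k=0..<n. 4 * C / (real (Suc k))\<^sup>2)"
      using diff[of 0 n] by (simp only: diff_0_right le0 simp_thms)
    then show ?thesis by (rule le_less_trans) simp
  qed
  have mod: "moderate \<Gamma> (G n)" for n unfolding G_def by (rule shell_function_moderate[OF adm])
  have sym: "AE \<xi> in dual_measure \<Gamma>. G n (- \<xi>) = cnj (G n \<xi>)" for n
    by (simp add: G_def shell_function_reflect)
  define \<sigma> where "\<sigma> n = inverse_fourier_dist \<Gamma> (G n)" for n
  have "\<exists>g. \<sigma> n \<in> X_space \<F> \<Gamma> j s \<and> fourier_is_fun \<Gamma> (\<sigma> n) g \<and> (AE \<xi> in dual_measure \<Gamma>. g \<xi> = G n \<xi>)" for n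
    unfolding \<sigma>_def using inverse_fourier_dist_in_X_space[OF adm mod fin sym] by metis
  then obtain g where X: "\<And>n. \<sigma> n \<in> X_space \<F> \<Gamma> j s" and g: "\<And>n. fourier_is_fun \<Gamma> (\<sigma> n) (g n)"
    and gG: "\<And>n. AE \<xi> in dual_measure \<Gamma>. g n \<xi> = G n \<xi>"
    by metis
  have t: "\<sigma> n \<in> tempered \<Gamma>" for n using X by (simp add: X_space_def)
  have \<sigma>_diff: "X_norm \<Gamma> j s (\<lambda>\<phi>. \<sigma> m \<phi> - \<sigma> n \<phi>) = sqrt (enn2real (weighted_sq_norm \<Gamma> j s (\<lambda>\<xi>. G m \<xi> - G n \<xi>)))" for m n
  proof -
    have "AE \<xi> in dual_measure \<Gamma>. g m \<xi> - g n \<xi> = G m \<xi> - G n \<xi>"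
      using gG[of m] gG[of n] by eventually_elim simp
    then show ?thesis using X_norm_diff[OF adm t t g g] weighted_sq_norm_cong_AE by metis
  qed
  have "\<forall>\<epsilon>>0. \<exists>N. \<forall>m\<ge>N. \<forall>n\<ge>N. X_norm \<Gamma> j s (\<lambda>\<phi>. \<sigma> m \<phi> - \<sigma> n \<phi>) < \<epsilon>"
  proof (intro allI impI)
    fix \<epsilon> :: real assume \<epsilon>: "\<epsilon> > 0"
    then obtain N where N: "\<And>m n. N \<le> n \<Longrightarrow> (\<Sum>k=n..<m. 4 * C / (real (Suc k))\<^sup>2) < \<epsilon>\<^sup>2"
      using inverse_squares_tail[of "\<epsilon>\<^sup>2" "4 * C"] by auto
    have less: "weighted_sq_norm \<Gamma> j s (\<lambda>\<xi>. G m \<xi> - G n \<xi>) < ennreal (\<epsilon>\<^sup>2)" if "N \<le> n" "n \<le> m" for m n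
      using diff[OF that(2)] N[OF that(1), of m] C(1) \<epsilon>
      by (auto simp: ennreal_less_iff sum_nonneg intro: le_less_trans)
    have "X_norm \<Gamma> j s (\<lambda>\<phi>. \<sigma> m \<phi> - \<sigma> n \<phi>) < \<epsilon>" if "m \<ge> N" "n \<ge> N" for m n
    proof -
      have l: "weighted_sq_norm \<Gamma> j s (\<lambda>\<xi>. G m \<xi> - G n \<xi>) < ennreal (\<epsilon>\<^sup>2)"
        using less[of n m] less[of m n] that diff_sym[of m n] by (cases "n \<le> m") auto
      then have "weighted_sq_norm \<Gamma> j s (\<lambda>\<xi>. G m \<xi> - G n \<xi>) < \<infinity>" by (rule less_trans) simp
      then show ?thesis using l \<epsilon> sqrt_enn2real_less_iff by (simp add: \<sigma>_diff)
    qed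
    then show "\<exists>N. \<forall>m\<ge>N. \<forall>n\<ge>N. X_norm \<Gamma> j s (\<lambda>\<phi>. \<sigma> m \<phi> - \<sigma> n \<phi>) < \<epsilon>" by blast
  qed
  then obtain f where f: "f \<in> X_space \<F> \<Gamma> j s" and conv: "(\<lambda>n. X_norm \<Gamma> j s (\<lambda>\<phi>. \<sigma> n \<phi> - f \<phi>)) \<longlonglongrightarrow> 0"
    using complete X unfolding X_complete_def by blast
  obtain h where ft: "f \<in> tempered \<Gamma>" and h: "fourier_is_fun \<Gamma> f h" and h_fin: "weighted_sq_norm \<Gamma> j s h < \<infinity>"
    using X_spaceE[OF adm f] by metis
  have hb [measurable]: "h \<in> borel_measurable borel" using h by (rule fourier_is_fun_borel)
  have Gh_fin: "weighted_sq_norm \<Gamma> j s (\<lambda>\<xi>. G n \<xi> - h \<xi>) < \<infinity>" for n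
    using weighted_sq_norm_diff_le[OF Gb hb, of \<Gamma> j s n] fin[of n] h_fin
    by (auto simp: ennreal_mult_less_top intro: le_less_trans)
  have Gh_conv: "\<exists>N. \<forall>n\<ge>N. weighted_sq_norm \<Gamma> j s (\<lambda>\<xi>. G n \<xi> - h \<xi>) < ennreal (e\<^sup>2)" if e: "e > 0" for e
  proof -
    obtain N where N: "\<And>n. n \<ge> N \<Longrightarrow> norm (X_norm \<Gamma> j s (\<lambda>\<phi>. \<sigma> n \<phi> - f \<phi>)) < e"
      using LIMSEQ_D[OF conv e] by auto
    have "weighted_sq_norm \<Gamma> j s (\<lambda>\<xi>. G n \<xi> - h \<xi>) < ennreal (e\<^sup>2)" if n: "n \<ge> N" for n
    proof -
      have "AE \<xi> in dual_measure \<Gamma>. g n \<xi> - h \<xi> = G n \<xi> - h \<xi>" using gG[of n] by eventually_elim simp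
      then have "X_norm \<Gamma> j s (\<lambda>\<phi>. \<sigma> n \<phi> - f \<phi>) = sqrt (enn2real (weighted_sq_norm \<Gamma> j s (\<lambda>\<xi>. G n \<xi> - h \<xi>)))"
        using X_norm_diff[OF adm t ft g h] weighted_sq_norm_cong_AE by metis
      then show ?thesis using N[OF n] sqrt_enn2real_less_iff[OF Gh_fin e] by simp
    qed
    then show ?thesis by blast
  qed
  \<comment> \<open>On a fixed shell all later partial sums have the same value, and the distance of \<open>h\<close> from them tends to zero.\<close>
  have h_shell: "AE \<xi> in dual_measure \<Gamma>. \<xi> \<in> dyadic_shell \<Gamma> k \<longrightarrow> h \<xi> = of_real (shell_height ?r k)" for k
  proof -
    let ?u = "\<lambda>\<xi>. ennreal ((weight j s \<xi> * norm (of_real (shell_height ?r k) - h \<xi>))\<^sup>2) * indicator (dyadic_shell \<Gamma> k) \<xi>"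
    have um: "?u \<in> borel_measurable (dual_measure \<Gamma>)"
    proof -
      have "?u \<in> borel_measurable borel" by measurable
      then show ?thesis by simp
    qed
    have le: "(\<integral>\<^sup>+\<xi>. ?u \<xi> \<partial>dual_measure \<Gamma>) \<le> weighted_sq_norm \<Gamma> j s (\<lambda>\<xi>. G n \<xi> - h \<xi>)" if "n > k" for n
      unfolding weighted_sq_norm_def
      using that by (intro nn_integral_mono) (auto simp: indicator_def G_def shell_function_on_shell)
    have "(\<integral>\<^sup>+\<xi>. ?u \<xi> \<partial>dual_measure \<Gamma>) = 0"
    proof (rule ccontr)
      assume nz: "(\<integral>\<^sup>+\<xi>. ?u \<xi> \<partial>dual_measure \<Gamma>) \<noteq> 0"
      have "(\<integral>\<^sup>+\<xi>. ?u \<xi> \<partial>dual_measure \<Gamma>) < \<infinity>" using le[of "Suc k"] Gh_fin[of "Suc k"] by (auto intro: le_less_trans)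
      then obtain y where y: "(\<integral>\<^sup>+\<xi>. ?u \<xi> \<partial>dual_measure \<Gamma>) = ennreal y" "y \<ge> 0"
        by (cases "\<integral>\<^sup>+\<xi>. ?u \<xi> \<partial>dual_measure \<Gamma>") auto
      then have "sqrt y > 0" using nz by (auto simp: le_less)
      then obtain N where "\<And>n. n \<ge> N \<Longrightarrow> weighted_sq_norm \<Gamma> j s (\<lambda>\<xi>. G n \<xi> - h \<xi>) < ennreal ((sqrt y)\<^sup>2)"
        using Gh_conv by blast
      then have "weighted_sq_norm \<Gamma> j s (\<lambda>\<xi>. G (max N (Suc k)) \<xi> - h \<xi>) < ennreal y"
        using y(2) by simp
      moreover have "ennreal y \<le> weighted_sq_norm \<Gamma> j s (\<lambda>\<xi>. G (max N (Suc k)) \<xi> - h \<xi>)"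
        using le[of "max N (Suc k)"] unfolding y(1) by simp
      ultimately show False by (simp add: leD)
    qed
    then have "AE \<xi> in dual_measure \<Gamma>. ?u \<xi> = 0" using nn_integral_0_iff_AE[OF um] by simp
    then show ?thesis
    proof eventually_elim
      case (elim \<xi>)
      show ?case
      proof
        assume "\<xi> \<in> dyadic_shell \<Gamma> k"
        then have "(weight j s \<xi> * norm (of_real (shell_height ?r k) - h \<xi>))\<^sup>2 = 0"
          using elim by (simp add: ennreal_eq_0_iff)
        then show "h \<xi> = of_real (shell_height ?r k)" using weight_pos[of j s \<xi>] by simp
      qed
    qed
  qed
  \<comment> \<open>The ball contains all shells, and their masses are the terms of a harmonic series.\<close>
  let ?K = "cball 0 (real CARD('n)) :: (real ^ 'n) set"
  have "set_integrable (dual_measure \<Gamma>) ?K h"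
    using h unfolding fourier_is_fun_def locally_integrable_def by (meson compact_cball)
  then have "(\<integral>\<^sup>+\<xi>. ennreal (norm (indicator ?K \<xi> *\<^sub>R h \<xi>)) \<partial>dual_measure \<Gamma>) < \<infinity>"
    by (simp add: set_integrable_def integrable_iff_bounded)
  then obtain B where B: "(\<integral>\<^sup>+\<xi>. ennreal (norm (indicator ?K \<xi> *\<^sub>R h \<xi>)) \<partial>dual_measure \<Gamma>) = ennreal B" "B \<ge> 0"
    by (cases "\<integral>\<^sup>+\<xi>. ennreal (norm (indicator ?K \<xi> *\<^sub>R h \<xi>)) \<partial>dual_measure \<Gamma>") auto
  obtain n where n: "(\<Sum>k<n. shell_height ?r k * shell_measure ?r k) > B"
    using shell_mass_unbounded[OF r(1)] by blast
  have hn: "shell_height ?r k \<ge> 0" for k by (simp add: shell_height_def)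
  have "ennreal (\<Sum>k<n. shell_height ?r k * shell_measure ?r k) = (\<Sum>k<n. ennreal (shell_height ?r k) * ennreal (shell_measure ?r k))"
    using hn shell_measure_pos[OF r(1)]
    by (subst sum_ennreal[symmetric]) (simp_all add: ennreal_mult' less_imp_le)
  also have "\<dots> = (\<Sum>k<n. \<integral>\<^sup>+\<xi>. ennreal (shell_height ?r k) * indicator (dyadic_shell \<Gamma> k) \<xi> \<partial>dual_measure \<Gamma>)"
    by (simp add: nn_integral_cmult_indicator emeasure_dyadic_shell)
  also have "\<dots> = (\<integral>\<^sup>+\<xi>. (\<Sum>k<n. ennreal (shell_height ?r k) * indicator (dyadic_shell \<Gamma> k) \<xi>) \<partial>dual_measure \<Gamma>)"
    by (rule nn_integral_sum[symmetric]) simp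
  also have "\<dots> = (\<integral>\<^sup>+\<xi>. ennreal (shell_function \<Gamma> n \<xi>) \<partial>dual_measure \<Gamma>)"
    unfolding shell_function_def using hn
    by (intro nn_integral_cong, subst sum_ennreal[symmetric]) (simp_all add: ennreal_mult' ennreal_indicator)
  also have "\<dots> \<le> (\<integral>\<^sup>+\<xi>. ennreal (norm (indicator ?K \<xi> *\<^sub>R h \<xi>)) \<partial>dual_measure \<Gamma>)"
  proof (rule nn_integral_mono_AE)
    have "AE \<xi> in dual_measure \<Gamma>. \<forall>k. \<xi> \<in> dyadic_shell \<Gamma> k \<longrightarrow> h \<xi> = of_real (shell_height ?r k)"
      unfolding AE_all_countable using h_shell by blast
    then show "AE \<xi> in dual_measure \<Gamma>. ennreal (shell_function \<Gamma> n \<xi>) \<le> ennreal (norm (indicator ?K \<xi> *\<^sub>R h \<xi>))"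
    proof eventually_elim
      case (elim \<xi>)
      show ?case
      proof (cases "\<exists>k. \<xi> \<in> dyadic_shell \<Gamma> k")
        case True
        then obtain k where k: "\<xi> \<in> dyadic_shell \<Gamma> k" by blast
        then have "\<xi> \<in> ?K" using norm_dyadic_shell_le by auto
        moreover have "h \<xi> = of_real (shell_height ?r k)" using elim k by blast
        ultimately show ?thesis using k hn[of k] by (intro ennreal_leI) (simp add: shell_function_on_shell)
      qed (simp add: shell_function_off_shells)
    qed
  qed
  also have "\<dots> = ennreal B" by (rule B(1))
  finally have "(\<Sum>k<n. shell_height ?r k * shell_measure ?r k) \<le> B"
    using B(2) by (simp add: ennreal_le_iff)
  with n show False by simp
qed

theorem proposition2p3:
  fixes \<Gamma> :: "'n::finite \<Rightarrow> factor" and j :: 'n and s :: real and \<F> :: scalars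
  assumes "admissible \<Gamma>" and "s \<ge> 0"
    and "j \<notin> line_indices \<Gamma>" and "line_indices \<Gamma> \<noteq> {}"
  shows "X_complete \<F> \<Gamma> j s \<longleftrightarrow> card (line_indices \<Gamma>) > 2"
proof -
  have "0 < card (line_indices \<Gamma>)" using assms(4) by (simp add: card_gt_0_iff)
  then show ?thesis
    using X_complete_of_three_lines[OF assms(1,2)] not_X_complete_of_few_lines[OF assms(1,3)]
    by (meson not_le)
qed

end
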